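(* Let $(m_1,\ldots,m_n;r_1,\ldots,r_p)$ be an admissible collection of degrees and put $\deg v_j=m_j$, $j=1,\ldots,n$. Then, for a Weil generic set of homogeneous relations $e_1,\ldots,e_p\in\mathbb C\langle v_1,\ldots,v_n\rangle$, of degrees $r_1,\ldots,r_p$ respectively, the algebra $\mathbb C\langle v_1,\ldots,v_n\rangle/(e_1,\ldots,e_p)$ is an asymptotic RCI.
   Context: Two (possibly equal) nonempty words $e,f$ in the alphabet $v_1,\dots,v_n$ are non-overlapping if neither is a proper subword of the other and neither begins the way the other one ends; equivalently, any word that contains both $e$ and $f$ (in different ways if $e=f$) is of the form $w_1ew_2fw_3$ or $w_1fw_2ew_3$. (For $e=f$ the second condition means that no nonempty proper prefix of $e$ is a suffix of $e$.) A collection of positive integers $(m_1,\dots,m_n;r_1,\dots,r_p)$ is admissible if, with $\deg v_i=m_i$, there exist (distinct) pairwise non-overlapping words $w_1,\dots,w_p$ (each also non-overlapping with itself) with $\deg w_j=r_j$ for all $j$. A statement holds for a Weil generic $p$-tuple of homogeneous elements of degrees $r_1,\dots,r_p$ if it holds for all $p$-tuples in some at most countable intersection of nonempty Zariski open subsets of the direct sum of the homogeneous components of $\mathbb C\langle v_1,\dots,v_n\rangle$ of degrees $r_1,\dots,r_p$. Asymptotic RCI (for ground ring $\mathbb C$): let $V$ be the graded vector space with basis $v_1,\dots,v_n$, $TV=\mathbb C\langle v_1,\dots,v_n\rangle$, $L\subset TV$ the graded span of $e_1,\dots,e_p$, $A=TV/(L)$. Put $L^\circ=L\cap[TV,TV]$,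 where $[TV,TV]$ is the linear span of commutators. For an integer $d\ge1$ let $\mathbf E_d=\mathrm{End}(\mathbb C^d)$, $\mathbb V_d=\mathrm{Hom}_{\mathbb C}(V,\mathbf E_d)$, $\mathbb L_d=\mathrm{Hom}_{\mathbb C}(L,\mathbf E_d)$. Each $\rho\in\mathbb V_d$ extends to an algebra map $TV\to\mathbf E_d$; restricting it to $L$ gives a morphism $\mathbb V_d\to\mathbb L_d$ whose image lies in $\mathbb L^\sharp_d:=\{\varphi\in\mathbb L_d:\mathrm{Tr}\,\varphi(\ell)=0\ \forall\ell\in L^\circ\}$; let $p_d:\mathbb V_d\to\mathbb L^\sharp_d$ be the resulting morphism, whose scheme-theoretic zero fiber is the representation scheme $\mathrm{Rep}_dA$. The Koszul complex $\mathbf K_\bullet(\mathrm{Rep}_dA)=\mathbb C[\mathbb V_d]\otimes\Lambda^\bullet(\mathbb L^\sharp_d)^*$ has the $\mathbb C[\mathbb V_d]$-linear derivation $d_K$ of degree $-1$ with $d_K(f)=f\circ p_d$ for $f\in(\mathbb L_d^\sharp)^*$, and a weight grading preserved by $d_K$ in which linear functions on $\mathbb V_d$, resp. $\mathbb L_d$, coming from degree $r$ elements of $V$, resp. $L$, have weight $r$; $[s]$ is the weight $s$ part. $A$ is an asymptotic RCI if for any positive integers $r,N$ there is $d>N$ with $H_p\big(\bigoplus_{s\le r}\mathbf K_\bullet(\mathrm{Rep}_dA)[s],d_K\big)=0$ for all $p>0$. *)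

theory Defs
  imports Complex_Main "HOL-Library.Poly_Mapping" "HOL-Library.Sublist"
    "HOL-Library.Countable_Set" "Jordan_Normal_Form.Matrix"
begin

section \<open>Free algebras, polynomials, spans\<close>

text \<open>With concatenation as the (noncommutative) addition on words, the convolution product of
  \<^theory>\<open>HOL-Library.Poly_Mapping\<close> makes the finitely supported functions on words
  into the free associative algebra; \<open>Poly_Mapping.single [] c\<close> is the scalar \<open>c\<close>.\<close>

instantiation list :: (type) monoid_add
begin
definition zero_list :: "'a list" where "zero_list = []"
definition plus_list :: "'a list \<Rightarrow> 'a list \<Rightarrow> 'a list" where "plus_list = (@)"
instance by standard (auto simp: zero_list_def plus_list_def)
end

type_synonym ncpoly = "nat list \<Rightarrow>\<^sub>0 complex"
type_synonym 'x cpoly = "('x \<Rightarrow>\<^sub>0 nat) \<Rightarrow>\<^sub>0 complex"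

definition poly_value :: "('x \<Rightarrow> complex) \<Rightarrow> 'x cpoly \<Rightarrow> complex" where
  "poly_value x g = (\<Sum>\<mu>\<in>Poly_Mapping.keys g. Poly_Mapping.lookup g \<mu> *
     (\<Prod>v\<in>Poly_Mapping.keys \<mu>. x v ^ Poly_Mapping.lookup \<mu> v))"

text \<open>All finite sums of elements of a set. It is applied only to sets that are closed under
  scalar multiplication, for which it is the linear span.\<close>

inductive_set finite_sums :: "'a::comm_monoid_add set \<Rightarrow> 'a set" for S where
  zero: "0 \<in> finite_sums S"
| add: "x \<in> S \<Longrightarrow> y \<in> finite_sums S \<Longrightarrow> x + y \<in> finite_sums S"

section \<open>Admissible degrees and Weil generic relations\<close>

definition non_overlapping :: "'a list \<Rightarrow> 'a list \<Rightarrow> bool" where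
  "non_overlapping e f \<longleftrightarrow> e \<noteq> [] \<and> f \<noteq> [] \<and>
     \<not> strict_sublist e f \<and> \<not> strict_sublist f e \<and>
     \<not> (\<exists>u. u \<noteq> [] \<and> prefix u e \<and> suffix u f \<and> (e = f \<longrightarrow> u \<noteq> e)) \<and>
     \<not> (\<exists>u. u \<noteq> [] \<and> prefix u f \<and> suffix u e \<and> (e = f \<longrightarrow> u \<noteq> e))"

text \<open>The generators \<open>v\<^sub>1, \<dots>, v\<^sub>n\<close> are the letters \<open>0, \<dots>, n - 1\<close>, of degrees
  \<open>m 0, \<dots>, m (n - 1)\<close>; relations are indexed in the same way.\<close>

definition word_degree :: "(nat \<Rightarrow> nat) \<Rightarrow> nat list \<Rightarrow> nat" where
  "word_degree m w = sum_list (map m w)"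

definition admissible :: "nat \<Rightarrow> (nat \<Rightarrow> nat) \<Rightarrow> nat \<Rightarrow> (nat \<Rightarrow> nat) \<Rightarrow> bool" where
  "admissible n m p r \<longleftrightarrow> (\<forall>i<n. m i > 0) \<and> (\<forall>j<p. r j > 0) \<and>
     (\<exists>w :: nat \<Rightarrow> nat list.
        (\<forall>j<p. set (w j) \<subseteq> {..<n} \<and> word_degree m (w j) = r j) \<and>
        inj_on w {..<p} \<and>
        (\<forall>i<p. \<forall>j<p. non_overlapping (w i) (w j)))"

definition TV :: "nat \<Rightarrow> ncpoly set" where
  "TV n = {x. \<forall>w\<in>Poly_Mapping.keys x. set w \<subseteq> {..<n}}"

definition TV_component :: "nat \<Rightarrow> (nat \<Rightarrow> nat) \<Rightarrow> nat \<Rightarrow> ncpoly set" where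
  "TV_component n m s = {x \<in> TV n. \<forall>w\<in>Poly_Mapping.keys x. word_degree m w = s}"

text \<open>The direct sum of the components of degrees \<open>r 0, \<dots>, r (p - 1)\<close>; the entries with index
  \<open>\<ge> p\<close> carry no information.\<close>

definition relation_space ::
  "nat \<Rightarrow> (nat \<Rightarrow> nat) \<Rightarrow> nat \<Rightarrow> (nat \<Rightarrow> nat) \<Rightarrow> (nat \<Rightarrow> ncpoly) set" where
  "relation_space n m p r =
     {e. (\<forall>j<p. e j \<in> TV_component n m (r j)) \<and> (\<forall>j\<ge>p. e j = 0)}"

text \<open>The coordinate with index \<open>(j, w)\<close> is the coefficient of the word \<open>w\<close> in the \<open>j\<close>-th relation.
  A closed set is the zero locus of a set \<open>S\<close> of polynomials in the coordinates.\<close>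

definition zariski_open ::
  "nat \<Rightarrow> (nat \<Rightarrow> nat) \<Rightarrow> nat \<Rightarrow> (nat \<Rightarrow> nat) \<Rightarrow> (nat \<Rightarrow> ncpoly) set \<Rightarrow> bool" where
  "zariski_open n m p r U \<longleftrightarrow> (\<exists>S :: (nat \<times> nat list) cpoly set.
     U = relation_space n m p r -
       {e. \<forall>f\<in>S. poly_value (\<lambda>(j, w). Poly_Mapping.lookup (e j) w) f = 0})"

definition weil_generic ::
  "nat \<Rightarrow> (nat \<Rightarrow> nat) \<Rightarrow> nat \<Rightarrow> (nat \<Rightarrow> nat) \<Rightarrow> ((nat \<Rightarrow> ncpoly) \<Rightarrow> bool) \<Rightarrow> bool" where
  "weil_generic n m p r P \<longleftrightarrow> (\<exists>\<U>. countable \<U> \<and>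
     (\<forall>U\<in>\<U>. zariski_open n m p r U \<and> U \<noteq> {}) \<and>
     (\<forall>e \<in> relation_space n m p r \<inter> \<Inter>\<U>. P e))"

section \<open>Representation schemes\<close>

definition L_span :: "nat \<Rightarrow> (nat \<Rightarrow> ncpoly) \<Rightarrow> ncpoly set" where
  "L_span p e = {\<Sum>j<p. Poly_Mapping.single [] (c j) * e j | c. True}"

definition commutator_span :: "nat \<Rightarrow> ncpoly set" where
  "commutator_span n = finite_sums {a * b - b * a | a b. a \<in> TV n \<and> b \<in> TV n}"

definition L_circ :: "nat \<Rightarrow> nat \<Rightarrow> (nat \<Rightarrow> ncpoly) \<Rightarrow> ncpoly set" where
  "L_circ n p e = L_span p e \<inter> commutator_span n"

definition mat_tr :: "complex mat \<Rightarrow> complex" where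
  "mat_tr A = (\<Sum>i<dim_row A. A $$ (i, i))"

definition V_rep :: "nat \<Rightarrow> nat \<Rightarrow> (nat \<Rightarrow> complex mat) set" where
  "V_rep n d = {\<rho>. (\<forall>i<n. \<rho> i \<in> carrier_mat d d) \<and> (\<forall>i\<ge>n. \<rho> i = 0\<^sub>m d d)}"

text \<open>Maps on a subspace are total functions, normalised to be zero outside of the subspace, so that
  equality of functions is equality of the maps.\<close>

type_synonym matrix_map = "ncpoly \<Rightarrow> complex mat"

definition L_rep :: "nat \<Rightarrow> (nat \<Rightarrow> ncpoly) \<Rightarrow> nat \<Rightarrow> matrix_map set" where
  "L_rep p e d = {\<phi>. (\<forall>x\<in>L_span p e. \<phi> x \<in> carrier_mat d d) \<and>
     (\<forall>x\<in>L_span p e. \<forall>y\<in>L_span p e. \<phi> (x + y) = \<phi> x + \<phi> y) \<and>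
     (\<forall>c. \<forall>x\<in>L_span p e. \<phi> (Poly_Mapping.single [] c * x) = c \<cdot>\<^sub>m \<phi> x) \<and>
     (\<forall>x. x \<notin> L_span p e \<longrightarrow> \<phi> x = 0\<^sub>m d d)}"

definition L_sharp :: "nat \<Rightarrow> nat \<Rightarrow> (nat \<Rightarrow> ncpoly) \<Rightarrow> nat \<Rightarrow> matrix_map set" where
  "L_sharp n p e d = {\<phi> \<in> L_rep p e d. \<forall>x\<in>L_circ n p e. mat_tr (\<phi> x) = 0}"

definition word_value :: "nat \<Rightarrow> (nat \<Rightarrow> complex mat) \<Rightarrow> nat list \<Rightarrow> complex mat" where
  "word_value d \<rho> w = foldr (\<lambda>i A. \<rho> i * A) w (1\<^sub>m d)"

definition TV_value :: "nat \<Rightarrow> (nat \<Rightarrow> complex mat) \<Rightarrow> ncpoly \<Rightarrow> complex mat" where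
  "TV_value d \<rho> x = mat d d (\<lambda>ab. \<Sum>w\<in>Poly_Mapping.keys x.
     Poly_Mapping.lookup x w * word_value d \<rho> w $$ ab)"

definition rep_morphism :: "nat \<Rightarrow> (nat \<Rightarrow> ncpoly) \<Rightarrow> nat \<Rightarrow> (nat \<Rightarrow> complex mat) \<Rightarrow> matrix_map" where
  "rep_morphism p e d \<rho> = (\<lambda>x. if x \<in> L_span p e then TV_value d \<rho> x else 0\<^sub>m d d)"

text \<open>The coordinate ring of \<open>V_rep n d\<close>: the variable \<open>(i, a, b)\<close> is the \<open>(a, b)\<close> entry of the matrix
  assigned to the \<open>i\<close>-th generator.\<close>

type_synonym coord_poly = "(nat \<times> nat \<times> nat) cpoly"

definition coord_ring :: "nat \<Rightarrow> nat \<Rightarrow> coord_poly set" where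
  "coord_ring n d = {g. \<forall>\<mu>\<in>Poly_Mapping.keys g.
     Poly_Mapping.keys \<mu> \<subseteq> {..<n} \<times> {..<d} \<times> {..<d}}"

definition coord_ring_weight :: "nat \<Rightarrow> (nat \<Rightarrow> nat) \<Rightarrow> nat \<Rightarrow> nat \<Rightarrow> coord_poly set" where
  "coord_ring_weight n m d s = {g \<in> coord_ring n d. \<forall>\<mu>\<in>Poly_Mapping.keys g.
     (\<Sum>v\<in>Poly_Mapping.keys \<mu>. Poly_Mapping.lookup \<mu> v * m (fst v)) = s}"

definition coord_value :: "(nat \<Rightarrow> complex mat) \<Rightarrow> coord_poly \<Rightarrow> complex" where
  "coord_value \<rho> = poly_value (\<lambda>(i, a, b). \<rho> i $$ (a, b))"

section \<open>The Koszul complex\<close>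

type_synonym functional = "matrix_map \<Rightarrow> complex"

definition L_sharp_dual :: "nat \<Rightarrow> nat \<Rightarrow> (nat \<Rightarrow> ncpoly) \<Rightarrow> nat \<Rightarrow> functional set" where
  "L_sharp_dual n p e d = {f.
     (\<forall>\<phi>\<in>L_sharp n p e d. \<forall>\<psi>\<in>L_sharp n p e d. f (\<lambda>x. \<phi> x + \<psi> x) = f \<phi> + f \<psi>) \<and>
     (\<forall>c. \<forall>\<phi>\<in>L_sharp n p e d. f (\<lambda>x. c \<cdot>\<^sub>m \<phi> x) = c * f \<phi>) \<and>
     (\<forall>\<phi>. \<phi> \<notin> L_sharp n p e d \<longrightarrow> f \<phi> = 0)}"

text \<open>The functionals \<open>\<phi> \<mapsto> \<phi>(x)\<^sub>a\<^sub>b\<close> with \<open>x\<close> in \<open>L\<close> of degree \<open>s\<close> span the weight \<open>s\<close> part; collecting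
  terms, every linear combination of them has one element \<open>l a b\<close> for each matrix position.\<close>

definition L_sharp_dual_weight ::
  "nat \<Rightarrow> (nat \<Rightarrow> nat) \<Rightarrow> nat \<Rightarrow> (nat \<Rightarrow> ncpoly) \<Rightarrow> nat \<Rightarrow> nat \<Rightarrow> functional set" where
  "L_sharp_dual_weight n m p e d s =
     {\<lambda>\<phi>. if \<phi> \<in> L_sharp n p e d then \<Sum>a<d. \<Sum>b<d. \<phi> (l a b) $$ (a, b) else 0 | l.
        \<forall>a b. l a b \<in> L_span p e \<inter> TV_component n m s}"

text \<open>The regular function \<open>f \<circ> p\<^sub>d\<close> as an element of the coordinate ring.\<close>

definition pullback :: "nat \<Rightarrow> nat \<Rightarrow> (nat \<Rightarrow> ncpoly) \<Rightarrow> nat \<Rightarrow> functional \<Rightarrow> coord_poly" where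
  "pullback n p e d f = (THE g. g \<in> coord_ring n d \<and>
     (\<forall>\<rho>\<in>V_rep n d. coord_value \<rho> g = f (rep_morphism p e d \<rho>)))"

text \<open>The exterior algebra over \<open>\<complex>[V_rep]\<close> of the dual of \<open>L_sharp\<close> is the tensor algebra, that is the
  free algebra over \<open>\<complex>[V_rep]\<close> whose letters are all the functionals, modulo the ideal generated by
  the linear relations among functionals and by the squares of functionals. We compute in the
  tensor algebra with representatives, modulo this ideal.\<close>

type_synonym koszul_elem = "functional list \<Rightarrow>\<^sub>0 coord_poly"

definition tensor_algebra :: "nat \<Rightarrow> nat \<Rightarrow> (nat \<Rightarrow> ncpoly) \<Rightarrow> nat \<Rightarrow> koszul_elem set" where
  "tensor_algebra n p e d = {z. \<forall>w\<in>Poly_Mapping.keys z.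
     set w \<subseteq> L_sharp_dual n p e d \<and> Poly_Mapping.lookup z w \<in> coord_ring n d}"

definition exterior_relations :: "nat \<Rightarrow> nat \<Rightarrow> (nat \<Rightarrow> ncpoly) \<Rightarrow> nat \<Rightarrow> koszul_elem set" where
  "exterior_relations n p e d =
     {Poly_Mapping.single [\<lambda>\<phi>. f \<phi> + g \<phi>] 1 - Poly_Mapping.single [f] 1 - Poly_Mapping.single [g] 1
        | f g. f \<in> L_sharp_dual n p e d \<and> g \<in> L_sharp_dual n p e d} \<union>
     {Poly_Mapping.single [\<lambda>\<phi>. c * f \<phi>] 1 - Poly_Mapping.single [f] (Poly_Mapping.single 0 c)
        | c f. f \<in> L_sharp_dual n p e d} \<union>
     {Poly_Mapping.single [f, f] 1 | f. f \<in> L_sharp_dual n p e d}"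

definition exterior_ideal :: "nat \<Rightarrow> nat \<Rightarrow> (nat \<Rightarrow> ncpoly) \<Rightarrow> nat \<Rightarrow> koszul_elem set" where
  "exterior_ideal n p e d = finite_sums {a * x * b | a x b.
     a \<in> tensor_algebra n p e d \<and> x \<in> exterior_relations n p e d \<and> b \<in> tensor_algebra n p e d}"

text \<open>Representatives of the part of \<open>K\<^sub>k\<close> of weight \<open>s\<close>.\<close>

definition koszul_weight ::
  "nat \<Rightarrow> (nat \<Rightarrow> nat) \<Rightarrow> nat \<Rightarrow> (nat \<Rightarrow> ncpoly) \<Rightarrow> nat \<Rightarrow> nat \<Rightarrow> nat \<Rightarrow> koszul_elem set" where
  "koszul_weight n m p e d k s = finite_sums {Poly_Mapping.single fs g | fs g t ts.
     length fs = k \<and> list_all2 (\<lambda>f t. f \<in> L_sharp_dual_weight n m p e d t) fs ts \<and>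
     g \<in> coord_ring_weight n m d t \<and> t + sum_list ts = s}"

definition koszul_weight_le ::
  "nat \<Rightarrow> (nat \<Rightarrow> nat) \<Rightarrow> nat \<Rightarrow> (nat \<Rightarrow> ncpoly) \<Rightarrow> nat \<Rightarrow> nat \<Rightarrow> nat \<Rightarrow> koszul_elem set" where
  "koszul_weight_le n m p e d k r = finite_sums (\<Union>s\<le>r. koszul_weight n m p e d k s)"

text \<open>The odd derivation of the tensor algebra, linear over the coefficients, with \<open>f \<mapsto> \<theta> f\<close> on
  letters; see \<open>word_derivation_append\<close> for the Leibniz rule.\<close>

fun word_derivation :: "('f \<Rightarrow> 'r) \<Rightarrow> 'f list \<Rightarrow> ('f list \<Rightarrow>\<^sub>0 'r::comm_ring_1)" where
  "word_derivation \<theta> [] = 0"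
| "word_derivation \<theta> (f # fs) =
     Poly_Mapping.single fs (\<theta> f) - Poly_Mapping.single [f] 1 * word_derivation \<theta> fs"

lemma word_derivation_append:
  "word_derivation \<theta> (u @ v) =
     word_derivation \<theta> u * Poly_Mapping.single v 1 +
     (-1) ^ length u * Poly_Mapping.single u 1 * word_derivation \<theta> v"
proof (induction u)
  case Nil
  have "Poly_Mapping.single [] 1 = (1 :: 'a list \<Rightarrow>\<^sub>0 'b)"
    unfolding zero_list_def[symmetric] by (rule single_one)
  then show ?case by simp
next
  case (Cons f u)
  have s: "Poly_Mapping.single (u @ v) (\<theta> f) = Poly_Mapping.single u (\<theta> f) * Poly_Mapping.single v 1"
    by (simp add: mult_single plus_list_def)
  have t: "Poly_Mapping.single (f # u) (1::'b) = Poly_Mapping.single [f] 1 * Poly_Mapping.single u 1"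
    by (simp add: mult_single plus_list_def)
  have c: "x * (-1) ^ k = (-1) ^ k * x" for x :: "'a list \<Rightarrow>\<^sub>0 'b" and k :: nat
    by (cases "even k") simp_all
  have "Poly_Mapping.single [f] 1 * ((-1) ^ length u * Poly_Mapping.single u 1 * word_derivation \<theta> v)
      = (Poly_Mapping.single [f] 1 * (-1) ^ length u) * (Poly_Mapping.single u 1 * word_derivation \<theta> v)"
    by (simp only: mult.assoc)
  also have "\<dots> = (-1) ^ length u * Poly_Mapping.single (f # u) 1 * word_derivation \<theta> v"
    by (simp only: c t mult.assoc)
  finally have d: "Poly_Mapping.single [f] 1 *
      ((-1) ^ length u * Poly_Mapping.single u 1 * word_derivation \<theta> v) =
      (-1) ^ length u * Poly_Mapping.single (f # u) 1 * word_derivation \<theta> v" .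
  show ?case
    by (simp only: append_Cons word_derivation.simps Cons.IH s distrib_left left_diff_distrib
        list.size power_add power_one_right add_Suc_right add_0_right power_Suc mult_minus_left
        mult_1_left d[unfolded mult.assoc[symmetric]] mult.assoc[symmetric])
      (simp only: diff_conv_add_uminus minus_add_distrib add.assoc)
qed

definition koszul_d :: "nat \<Rightarrow> nat \<Rightarrow> (nat \<Rightarrow> ncpoly) \<Rightarrow> nat \<Rightarrow> koszul_elem \<Rightarrow> koszul_elem" where
  "koszul_d n p e d z = (\<Sum>w\<in>Poly_Mapping.keys z.
     Poly_Mapping.single [] (Poly_Mapping.lookup z w) * word_derivation (pullback n p e d) w)"

text \<open>Vanishing of the homology in degree \<open>k\<close> of the weight \<open>\<le> r\<close> part of the Koszul complex: every
  cycle modulo the ideal is a boundary modulo the ideal.\<close>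

definition koszul_homology_vanishes ::
  "nat \<Rightarrow> (nat \<Rightarrow> nat) \<Rightarrow> nat \<Rightarrow> (nat \<Rightarrow> ncpoly) \<Rightarrow> nat \<Rightarrow> nat \<Rightarrow> nat \<Rightarrow> bool" where
  "koszul_homology_vanishes n m p e d r k \<longleftrightarrow>
     (\<forall>z\<in>koszul_weight_le n m p e d k r. koszul_d n p e d z \<in> exterior_ideal n p e d \<longrightarrow>
        (\<exists>y\<in>koszul_weight_le n m p e d (Suc k) r. z - koszul_d n p e d y \<in> exterior_ideal n p e d))"

text \<open>The property depends on the presentation of \<open>A = TV / (e\<^sub>0, \<dots>, e\<^sub>p\<^sub>-\<^sub>1)\<close>: only \<open>TV\<close>, its grading
  and the span of the relations enter.\<close>

definition asymptotic_RCI :: "nat \<Rightarrow> (nat \<Rightarrow> nat) \<Rightarrow> nat \<Rightarrow> (nat \<Rightarrow> ncpoly) \<Rightarrow> bool" where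
  "asymptotic_RCI n m p e \<longleftrightarrow> (\<forall>r>0. \<forall>N>0. \<exists>d>N. \<forall>k>0. koszul_homology_vanishes n m p e d r k)"

end

theory Submission
  imports Defs "HOL-Library.Function_Algebras" "Jordan_Normal_Form.Determinant"
begin

text \<open>Admissibility provides pairwise non-overlapping words \<open>w j\<close>, and the relations \<open>e j = w j\<close> lie
  in the relation space. Non-overlapping words are pairwise non-conjugate, so for generic \<open>e\<close> no
  nontrivial combination of the relations is a sum of commutators. Then \<open>L\<^sup>\<circ> = 0\<close>, and the Koszul
  complex is the usual one on the matrix entries of the relations. Its part of weight at most \<open>R\<close> is
  finite-dimensional and depends polynomially on \<open>e\<close>; if \<open>h\<close> is a fixed operator of degree \<open>1\<close> and
  \<open>dh + hd\<close> is injective on it for one \<open>e\<close>, then it is injective for generic \<open>e\<close>, which makes every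
  cycle a boundary.

  For the words themselves let \<open>h\<close> be the normalised adjoint of \<open>d\<close>. Label the edges of a monomial.
  An exterior generator is then a set of labels (a block) together with the condition that a function
  of the labelling is spread evenly over all paths with given ends; this is the range of an orthogonal
  projection \<open>Q\<^sub>b\<close>, and \<open>d\<close> becomes the alternating sum of inclusions. The Laplacian is \<open>k\<close> plus a sum
  of the projections plus error terms that involve products \<open>Q\<^sub>b Q\<^sub>c\<close> with \<open>b \<noteq> c\<close> and \<open>b \<inter> c \<noteq> {}\<close>. Because
  the words do not overlap, \<open>b\<close> and \<open>c\<close> prescribe different successors or predecessors of a common
  label, so such a product has norm at most \<open>1 / d\<close>. The number of blocks does not depend on \<open>d\<close>, so
  the Laplacian is positive when \<open>d\<close> is large.\<close>

section \<open>Linear algebra\<close>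

text \<open>The operator \<open>h\<close> is built from the words alone and stays fixed while the
  relations vary; it preserves weights because \<open>w j\<close> and \<open>e j\<close> have the
  same degree. An adjoint taken at \<open>e\<close> itself would bring in complex conjugates of the
  coordinates of \<open>e\<close>, and the Laplacian would no longer be polynomial in them. On
  cycles \<open>dh + hd\<close> is just \<open>dh\<close>, and an injective endomorphism of the
  finite-dimensional space of cycles is onto.

  Labels are needed because a variable can occur several times in a monomial. With coefficients
  multiplied by factorials, multiplication by a path becomes a sum over the places it can take among
  labelled edges, and contraction becomes an average. The summand \<open>k\<close> arises from
  exchanging each block for itself. Since all generators have positive degree, weight at most
  \<open>R\<close> leaves at most \<open>R\<close> edges, which bounds the number of blocks before
  \<open>d\<close> is chosen. One \<open>d\<close> serves all \<open>k\<close>, so the open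
  conditions are indexed by countably many triples of \<open>R\<close>, \<open>N\<close> and
  \<open>k\<close>.

  As exterior powers are given by tensors modulo an ideal, a determinant map compares tensors with
  alternating functions; it has an inverse up to factorials.\<close>

lemma (in vector_space) inj_endo_surj:
  assumes W: "finite W" and Z: "subspace Z" "Z \<subseteq> span W"
    and f: "Vector_Spaces.linear scale scale f" "f ` Z \<subseteq> Z" "\<And>x. x \<in> Z \<Longrightarrow> f x = 0 \<Longrightarrow> x = 0"
  shows "Z \<subseteq> f ` Z"
proof
  fix z assume z: "z \<in> Z"
  interpret f: Vector_Spaces.linear scale scale f by (rule f)
  obtain B where B: "B \<subseteq> Z" "independent B" "Z \<subseteq> span B"
    using maximal_independent_subset[of Z] by blast
  have fB: "finite B" using independent_span_bound[OF W B(2)] B(1) Z(2) by blast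
  have spZ: "span B = Z" using B(1,3) Z(1) by (simp add: span_minimal subset_antisym)
  have injs: "inj_on f (span B)"
    using f.inj_on_iff_eq_0[OF Z(1)] f(3) spZ by auto
  have ind: "independent (f ` B)"
    using f.dependent_inj_imageD[of B] injs B(2) by blast
  have "z \<in> span (f ` B)"
  proof (rule ccontr)
    assume n: "z \<notin> span (f ` B)"
    then have "independent (insert z (f ` B))" using ind by (rule independent_insertI)
    moreover have "insert z (f ` B) \<subseteq> span B" using spZ f(2) B(1) z by auto
    ultimately have "card (insert z (f ` B)) \<le> card B"
      using independent_span_bound[OF fB] by blast
    moreover have "card (f ` B) = card B"
      using injs inj_on_subset[OF _ span_superset] card_image by blast
    moreover have "z \<notin> f ` B" using n span_base by blast
    ultimately show False using fB by simp
  qed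
  then show "z \<in> f ` Z" using f.span_image[of B] spZ by simp
qed

text \<open>The determinant in question is a Gram determinant of the images of a basis under \<open>M e\<^sub>0\<close> and
  under \<open>M e\<close>, so that at \<open>e\<^sub>0\<close> it is positive.\<close>

lemma injectivity_is_open:
  fixes scale :: "complex \<Rightarrow> 'b::ab_group_add \<Rightarrow> 'b" and M :: "'e \<Rightarrow> 'b \<Rightarrow> 'b"
    and co :: "'w \<Rightarrow> 'b \<Rightarrow> complex" and \<P> :: "('e \<Rightarrow> complex) set"
  assumes vs: "vector_space scale" and W: "finite W" and U: "module.subspace scale U" "U \<subseteq> module.span scale W"
    and M: "\<And>e. Vector_Spaces.linear scale scale (M e)" "M e0 ` U \<subseteq> U"
    and co: "\<And>\<omega>. Vector_Spaces.linear scale (*) (co \<omega>)" "\<And>x. x \<in> U \<Longrightarrow> (\<And>\<omega>. \<omega> \<in> \<Omega> \<Longrightarrow> co \<omega> x = 0) \<Longrightarrow> x = 0"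
    and \<Omega>: "finite \<Omega>"
    and P: "\<And>c. (\<lambda>_. c) \<in> \<P>" "\<And>f g. f \<in> \<P> \<Longrightarrow> g \<in> \<P> \<Longrightarrow> (\<lambda>e. f e + g e) \<in> \<P>"
      "\<And>f g. f \<in> \<P> \<Longrightarrow> g \<in> \<P> \<Longrightarrow> (\<lambda>e. f e * g e) \<in> \<P>"
    and coM: "\<And>\<omega> x. \<omega> \<in> \<Omega> \<Longrightarrow> x \<in> U \<Longrightarrow> (\<lambda>e. co \<omega> (M e x)) \<in> \<P>"
    and inj: "\<And>x. x \<in> U \<Longrightarrow> M e0 x = 0 \<Longrightarrow> x = 0"
  shows "\<exists>f\<in>\<P>. f e0 \<noteq> 0 \<and> (\<forall>e. f e \<noteq> 0 \<longrightarrow> (\<forall>x\<in>U. M e x = 0 \<longrightarrow> x = 0))"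
proof -
  interpret vector_space scale by (rule vs)
  obtain B where B: "B \<subseteq> U" "independent B" "U \<subseteq> span B"
    using maximal_independent_subset[of U] by blast
  have fB: "finite B" using independent_span_bound[OF W B(2)] B(1) U(2) by blast
  obtain b :: "nat \<Rightarrow> 'b" and t where b: "bij_betw b {..<t} B"
    using ex_bij_betw_nat_finite[OF fB] by (metis atLeast0LessThan)
  have bU: "b i \<in> U" if "i < t" for i using b B(1) that by (auto simp: bij_betw_def)
  have Psum: "(\<lambda>e. \<Sum>i\<in>I. f i e) \<in> \<P>" if "\<And>i. i \<in> I \<Longrightarrow> f i \<in> \<P>" for I :: "'i set" and f
    using that by (induction I rule: infinite_finite_induct) (auto intro: P)
  have Pprod: "(\<lambda>e. \<Prod>i\<in>I. f i e) \<in> \<P>" if "\<And>i. i \<in> I \<Longrightarrow> f i \<in> \<P>" for I :: "'i set" and f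
    using that by (induction I rule: infinite_finite_induct) (auto intro: P)
  \<comment> \<open>Only values at the fixed point \<open>e0\<close> are conjugated, so the Gram
    entries, and with them the determinant, remain in \<P> as functions of \<open>e\<close>.\<close>
  define g where "g e i j = (\<Sum>\<omega>\<in>\<Omega>. cnj (co \<omega> (M e0 (b i))) * co \<omega> (M e (b j)))" for e i j
  have gP: "(\<lambda>e. g e i j) \<in> \<P>" if "i < t" "j < t" for i j
    unfolding g_def using bU that by (intro Psum P coM) auto
  define G where "G e = mat t t (\<lambda>(i, j). g e i j)" for e
  have "(\<lambda>e. det (G e)) = (\<lambda>e. \<Sum>\<pi> | \<pi> permutes {0..<t}. signof \<pi> * (\<Prod>i = 0..<t. g e i (\<pi> i)))"
    unfolding det_def G_def by (intro ext) (auto intro!: sum.cong prod.cong simp: permutes_in_image)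
  also have "\<dots> \<in> \<P>"
    by (intro Psum P Pprod gP) (auto simp: permutes_in_image)
  finally have detP: "(\<lambda>e. det (G e)) \<in> \<P>" .
  have Gv: "(G e *\<^sub>v v) $ i = (\<Sum>\<omega>\<in>\<Omega>. cnj (co \<omega> (M e0 (b i))) * co \<omega> (M e (\<Sum>j<t. scale (v $ j) (b j))))"
    if "v \<in> carrier_vec t" "i < t" for e v i
  proof -
    interpret c: Vector_Spaces.linear scale "(*)" "co \<omega>" for \<omega> by (rule co)
    interpret m: Vector_Spaces.linear scale scale "M e" by (rule M)
    have "(G e *\<^sub>v v) $ i = (\<Sum>j<t. g e i j * v $ j)"
      using that by (simp add: G_def scalar_prod_def lessThan_atLeast0)
    also have "\<dots> = (\<Sum>j<t. \<Sum>\<omega>\<in>\<Omega>. cnj (co \<omega> (M e0 (b i))) * (v $ j * co \<omega> (M e (b j))))"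
      unfolding g_def sum_distrib_right by (intro sum.cong refl) (simp only: mult_ac)
    also have "\<dots> = (\<Sum>\<omega>\<in>\<Omega>. \<Sum>j<t. cnj (co \<omega> (M e0 (b i))) * (v $ j * co \<omega> (M e (b j))))"
      by (rule sum.swap)
    also have "\<dots> = (\<Sum>\<omega>\<in>\<Omega>. cnj (co \<omega> (M e0 (b i))) * co \<omega> (M e (\<Sum>j<t. scale (v $ j) (b j))))"
      unfolding sum_distrib_left[symmetric] by (simp only: m.sum m.scale c.sum c.scale)
    finally show ?thesis .
  qed
  have comb: "v = 0\<^sub>v t" if v: "v \<in> carrier_vec t" and z: "(\<Sum>j<t. scale (v $ j) (b j)) = 0" for v
  proof -
    have "(\<Sum>x\<in>B. scale (v $ (the_inv_into {..<t} b x)) x) = 0"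
      using z by (subst sum.reindex_bij_betw[OF b, symmetric])
        (simp add: the_inv_into_f_f[OF bij_betw_imp_inj_on[OF b]])
    from independentD[OF B(2) fB subset_refl this]
    have "v $ i = 0" if "i < t" for i
      using that b by (metis bij_betw_def imageI lessThan_iff the_inv_into_f_f)
    then show ?thesis using v by (intro eq_vecI) auto
  qed
  have inU: "(\<Sum>j<t. scale (v $ j) (b j)) \<in> U" for v
    by (intro subspace_sum U(1) subspace_scale bU) auto
  have "det (G e0) \<noteq> 0"
  proof
    assume "det (G e0) = 0"
    moreover have Gc: "G e0 \<in> carrier_mat t t" by (simp add: G_def)
    ultimately obtain v where v: "v \<in> carrier_vec t" "v \<noteq> 0\<^sub>v t" "G e0 *\<^sub>v v = 0\<^sub>v t"
      using det_0_iff_vec_prod_zero[OF Gc] by auto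
    define x where "x = (\<Sum>j<t. scale (v $ j) (b j))"
    interpret c: Vector_Spaces.linear scale "(*)" "co \<omega>" for \<omega> by (rule co)
    interpret m: Vector_Spaces.linear scale scale "M e0" by (rule M)
    have "0 = (\<Sum>i<t. cnj (v $ i) * (G e0 *\<^sub>v v) $ i)" using v by simp
    also have "\<dots> = (\<Sum>i<t. \<Sum>\<omega>\<in>\<Omega>. cnj (v $ i * co \<omega> (M e0 (b i))) * co \<omega> (M e0 x))"
    proof (intro sum.cong refl)
      fix i assume "i \<in> {..<t}"
      then have i: "i < t" by simp
      show "cnj (v $ i) * (G e0 *\<^sub>v v) $ i = (\<Sum>\<omega>\<in>\<Omega>. cnj (v $ i * co \<omega> (M e0 (b i))) * co \<omega> (M e0 x))"
        unfolding Gv[OF v(1) i] x_def[symmetric] by (simp only: sum_distrib_left complex_cnj_mult mult.assoc)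
    qed
    also have "\<dots> = (\<Sum>\<omega>\<in>\<Omega>. \<Sum>i<t. cnj (v $ i * co \<omega> (M e0 (b i))) * co \<omega> (M e0 x))"
      by (rule sum.swap)
    also have "\<dots> = (\<Sum>\<omega>\<in>\<Omega>. cnj (co \<omega> (M e0 x)) * co \<omega> (M e0 x))"
      unfolding sum_distrib_right[symmetric] cnj_sum[symmetric] x_def
      by (simp only: m.sum m.scale c.sum c.scale)
    also have "\<dots> = of_real (\<Sum>\<omega>\<in>\<Omega>. (cmod (co \<omega> (M e0 x)))\<^sup>2)"
      by (simp only: of_real_sum complex_norm_square mult.commute)
    finally have "(\<Sum>\<omega>\<in>\<Omega>. (cmod (co \<omega> (M e0 x)))\<^sup>2) = 0"
      by (metis of_real_eq_0_iff)
    then have "\<forall>\<omega>\<in>\<Omega>. co \<omega> (M e0 x) = 0" using \<Omega> by (simp add: sum_nonneg_eq_0_iff)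
    then have "M e0 x = 0" using M(2) inU unfolding x_def by (intro co(2)) auto
    then have "x = 0" using inj inU unfolding x_def by blast
    then show False using comb[OF v(1)] v(2) unfolding x_def by blast
  qed
  moreover have "x = 0" if e: "det (G e) \<noteq> 0" and x: "x \<in> U" "M e x = 0" for e x
  proof -
    have "x \<in> span B" using x B(3) by blast
    then obtain c where "x = (\<Sum>y\<in>B. scale (c y) y)" unfolding span_finite[OF fB] by auto
    then have xv: "x = (\<Sum>j<t. scale (vec t (c \<circ> b) $ j) (b j))"
      by (simp add: sum.reindex_bij_betw[OF b, symmetric])
    interpret c: Vector_Spaces.linear scale "(*)" "co \<omega>" for \<omega> by (rule co)
    have "G e *\<^sub>v vec t (c \<circ> b) = 0\<^sub>v t"
    proof (rule eq_vecI)
      fix i assume "i < dim_vec (0\<^sub>v t :: complex vec)"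
      then have i: "i < t" by simp
      show "(G e *\<^sub>v vec t (c \<circ> b)) $ i = 0\<^sub>v t $ i"
        unfolding Gv[OF vec_carrier i] xv[symmetric] x(2) using i by (simp add: c.zero)
    qed (simp add: G_def)
    moreover have Gc: "G e \<in> carrier_mat t t" by (simp add: G_def)
    ultimately have "vec t (c \<circ> b) = 0\<^sub>v t"
      using det_0_iff_vec_prod_zero[OF Gc] e vec_carrier by blast
    then have "x = (\<Sum>j<t. scale (0\<^sub>v t $ j) (b j))" using xv by simp
    then show "x = 0" by simp
  qed
  ultimately show ?thesis using detP by (intro bexI[of _ "\<lambda>e. det (G e)"]) auto
qed

section \<open>Alternating functions of lists\<close>

text \<open>The sum with alternating signs over all ways to split off one entry of the list, as in
  the expansion of a determinant along a row. The recursion moves the skipped entries into the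
  function, so inductions run with \<open>F\<close> arbitrary.\<close>

fun skew :: "('a \<Rightarrow> 'a list \<Rightarrow> 'c::ab_group_add) \<Rightarrow> 'a list \<Rightarrow> 'c" where
  "skew F [] = 0"
| "skew F (x # xs) = F x xs - skew (\<lambda>y ys. F y (x # ys)) xs"

definition alternating :: "('a list \<Rightarrow> 'c::ab_group_add) \<Rightarrow> bool" where
  "alternating G \<longleftrightarrow> (\<forall>u x y v. G (u @ x # y # v) = - G (u @ y # x # v))"

lemma alternatingD: "alternating G \<Longrightarrow> G (u @ x # y # v) = - G (u @ y # x # v)"
  unfolding alternating_def by (elim allE)

lemma alternating_swap: "alternating G \<Longrightarrow> G (x # y # v) = - G (y # x # v)"
  using alternatingD[of G "[]" x y v] by simp

lemma alternating_Cons: "alternating G \<Longrightarrow> alternating (\<lambda>xs. G (x # xs))"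
  unfolding alternating_def[of "\<lambda>xs. G (x # xs)"]
  by (intro allI) (metis alternatingD append_Cons)

lemma skew_uminus: "skew (\<lambda>x xs. - F x xs) xs = - skew F xs"
  by (induction xs arbitrary: F) auto

lemma skew_add: "skew (\<lambda>x xs. F x xs + G x xs) xs = skew F xs + skew G xs"
  by (induction xs arbitrary: F G) auto

lemma skew_sum: "skew (\<lambda>x xs. \<Sum>i\<in>I. F i x xs) xs = (\<Sum>i\<in>I. skew (F i) xs)"
  by (induction xs arbitrary: F) (auto simp: sum_subtractf)

lemma skew_mult: "skew (\<lambda>x xs. c * F x xs) xs = c * skew F xs" for c :: "'c::ring"
  by (induction xs arbitrary: F) (auto simp: algebra_simps)

lemma skew_hom:
  assumes "\<And>x y. h (x - y) = h x - h y"
  shows "h (skew F xs) = skew (\<lambda>x xs. h (F x xs)) xs"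
proof -
  have h0: "h 0 = 0" using assms[of 0 0] by simp
  show ?thesis
  proof (induction xs arbitrary: F)
    case (Cons x xs)
    show ?case unfolding skew.simps assms Cons.IH ..
  qed (simp add: h0)
qed

lemma alternating_skew:
  assumes "\<And>x. alternating (F x)"
  shows "alternating (skew F)"
  unfolding alternating_def
proof (intro allI)
  fix u x y v
  show "skew F (u @ x # y # v) = - skew F (u @ y # x # v)" using assms
  proof (induction u arbitrary: F)
    case Nil
    have "(\<lambda>z ys. F z (x # y # ys)) = (\<lambda>z ys. - F z (y # x # ys))"
      using alternating_swap[OF Nil] by (intro ext)
    then show ?case by (simp add: skew_uminus)
  next
    case (Cons a u)
    have "skew (\<lambda>z ys. F z (a # ys)) (u @ x # y # v) = - skew (\<lambda>z ys. F z (a # ys)) (u @ y # x # v)"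
      by (intro Cons.IH alternating_Cons Cons.prems)
    then show ?case using alternatingD[OF Cons.prems, of a u x y v] by simp
  qed
qed

text \<open>All summands are equal: moving an entry to the front costs exactly the sign that it
  carries in the sum.\<close>

lemma skew_alternating:
  fixes G :: "'a list \<Rightarrow> 'c::ring_1"
  assumes "alternating G"
  shows "skew (\<lambda>x xs. G (x # xs)) xs = of_nat (length xs) * G xs"
  using assms
proof (induction xs arbitrary: G)
  case (Cons a xs)
  have "(\<lambda>y ys. G (y # a # ys)) = (\<lambda>y ys. - G (a # y # ys))"
    using alternating_swap[OF Cons.prems] by (intro ext)
  then show ?case using Cons.IH[OF alternating_Cons[OF Cons.prems]]
    by (simp add: skew_uminus algebra_simps)
qed auto

definition del :: "nat \<Rightarrow> 'a list \<Rightarrow> 'a list" where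
  "del i xs = take i xs @ drop (Suc i) xs"

lemma del_Cons: "del 0 (x # xs) = xs" "del (Suc i) (x # xs) = x # del i xs"
  by (simp_all add: del_def)

lemma skew_eq_sum:
  fixes F :: "'a \<Rightarrow> 'a list \<Rightarrow> 'c::ring_1"
  shows "skew F xs = (\<Sum>i<length xs. (- 1) ^ i * F (xs ! i) (del i xs))"
  by (induction xs arbitrary: F)
    (auto simp: sum.lessThan_Suc_shift del_Cons sum_negf simp del: sum.lessThan_Suc)

text \<open>A number \<open>i\<close> of adjacent transpositions carries the first entry into the
  gap left by the removed one.\<close>

lemma alternating_del:
  fixes G :: "'a list \<Rightarrow> 'c::ring_1"
  assumes "alternating G" "i < length xs"
  shows "G (x # del i xs) = (- 1) ^ i * G (xs[i := x])"
  using assms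
proof (induction i arbitrary: G xs)
  case 0
  then show ?case by (cases xs) (auto simp: del_Cons)
next
  case (Suc i)
  then obtain a as where xs: "xs = a # as" by (cases xs) auto
  have "G (x # a # del i as) = - G (a # x # del i as)" by (rule alternating_swap[OF Suc.prems(1)])
  also have "G (a # x # del i as) = (- 1) ^ i * G (a # as[i := x])"
    using Suc.IH[OF alternating_Cons[OF Suc.prems(1)]] Suc.prems(2) xs by simp
  finally show ?case by (simp add: xs del_Cons)
qed

section \<open>Polynomials and paths\<close>

abbreviation "keys \<equiv> Poly_Mapping.keys"
abbreviation "lookup \<equiv> Poly_Mapping.lookup"
abbreviation "single \<equiv> Poly_Mapping.single"
abbreviation const_poly :: "'b::zero \<Rightarrow> 'a::zero \<Rightarrow>\<^sub>0 'b" where "const_poly \<equiv> single 0"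

lemma lookup_const_mult: "lookup (const_poly c * g) x = c * lookup g x"
  for g :: "'a::monoid_add \<Rightarrow>\<^sub>0 'b::semiring_0"
  unfolding mult_map_scale_conv_mult[symmetric]
  by transfer (auto simp: when_def)

lemma const_poly_mult: "const_poly (a * b) = const_poly a * (const_poly b :: 'a::monoid_add \<Rightarrow>\<^sub>0 'b::semiring_0)"
  by (simp add: mult_single)

lemma lookup_single_mult:
  fixes g :: "'a::cancel_comm_monoid_add \<Rightarrow>\<^sub>0 'b::semiring_0"
  shows "lookup (single \<nu> c * g) (\<nu> + \<mu>) = c * lookup g \<mu>"
proof -
  have "lookup (single \<nu> c * g) (\<nu> + \<mu>) =
      (\<Sum>l. lookup (single \<nu> c) l * (\<Sum>q. lookup g q when \<nu> + \<mu> = l + q))"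
    by (simp add: lookup_mult)
  also have "\<dots> = (\<Sum>l. (c * (\<Sum>q. lookup g q when \<nu> + \<mu> = \<nu> + q)) when l = \<nu>)"
    by (intro Sum_any.cong) (auto simp: lookup_single when_def)
  finally show ?thesis by (simp add: when_commute)
qed

lemma lookup_single_mult_eq_0:
  fixes g :: "'a::comm_monoid_add \<Rightarrow>\<^sub>0 'b::semiring_0"
  assumes "\<And>\<kappa>. \<mu> \<noteq> \<nu> + \<kappa>"
  shows "lookup (single \<nu> c * g) \<mu> = 0"
proof (rule ccontr)
  assume "lookup (single \<nu> c * g) \<mu> \<noteq> 0"
  then have "\<mu> \<in> keys (single \<nu> c * g)" by (simp add: in_keys_iff)
  then show False using keys_mult[of "single \<nu> c" g] assms by (auto split: if_splits)
qed

type_synonym idx = "nat \<times> nat \<times> nat"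

definition mon_of :: "'a list \<Rightarrow> 'a \<Rightarrow>\<^sub>0 nat" where
  "mon_of es = sum_list (map (\<lambda>v. single v 1) es)"

lemma mon_simps: "mon_of [] = 0" "mon_of (v # es) = single v 1 + mon_of es"
  by (simp_all add: mon_of_def)

lemma keys_add_nat: "keys (\<mu> + \<nu>) = keys \<mu> \<union> keys (\<nu> :: 'a \<Rightarrow>\<^sub>0 nat)"
  by (auto simp: in_keys_iff lookup_add)

lemma keys_mon: "keys (mon_of es) = set es"
  by (induction es) (auto simp: mon_simps keys_add_nat)

definition wt :: "(nat \<Rightarrow> nat) \<Rightarrow> (idx \<Rightarrow>\<^sub>0 nat) \<Rightarrow> nat" where
  "wt m \<mu> = (\<Sum>v\<in>keys \<mu>. lookup \<mu> v * m (fst v))"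

lemma wt_superset: "finite S \<Longrightarrow> keys \<mu> \<subseteq> S \<Longrightarrow> wt m \<mu> = (\<Sum>v\<in>S. lookup \<mu> v * m (fst v))"
  unfolding wt_def by (intro sum.mono_neutral_left) (auto simp: in_keys_iff)

lemma wt_add: "wt m (\<mu> + \<nu>) = wt m \<mu> + wt m \<nu>"
  using wt_superset[of "keys \<mu> \<union> keys \<nu>" "\<mu> + \<nu>" m] wt_superset[of "keys \<mu> \<union> keys \<nu>" \<mu> m]
    wt_superset[of "keys \<mu> \<union> keys \<nu>" \<nu> m]
  by (simp add: keys_add_nat lookup_add algebra_simps sum.distrib)

lemma wt_mon: "wt m (mon_of es) = sum_list (map (m \<circ> fst) es)"
proof (induction es)
  case (Cons e es)
  have "wt m (single e 1) = m (fst e)" by (simp add: wt_def)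
  then show ?case using Cons by (simp add: mon_simps wt_add)
qed (simp add: mon_simps wt_def)

text \<open>A variable (i, a, c) of the coordinate ring is read as an edge from a to c with letter
  i. Only targets of edges are compared with \<open>d\<close>; the bound on the start of a path
  appears as a separate hypothesis.\<close>

fun is_path :: "nat \<Rightarrow> nat list \<Rightarrow> nat \<Rightarrow> nat \<Rightarrow> idx list \<Rightarrow> bool" where
  "is_path d [] a b es \<longleftrightarrow> es = [] \<and> a = b"
| "is_path d (i # w) a b [] \<longleftrightarrow> False"
| "is_path d (i # w) a b (e # es) \<longleftrightarrow>
     fst e = i \<and> fst (snd e) = a \<and> snd (snd e) < d \<and> is_path d w (snd (snd e)) b es"

definition paths :: "nat \<Rightarrow> nat list \<Rightarrow> nat \<Rightarrow> nat \<Rightarrow> idx list set" where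
  "paths d w a b = {es. is_path d w a b es}"

lemma paths_Nil: "paths d [] a b = (if a = b then {[]} else {})"
  by (auto simp: paths_def)

lemma paths_Cons: "paths d (i # w) a b = (\<Union>c<d. (#) (i, a, c) ` paths d w c b)" (is "?L = ?R")
proof
  show "?L \<subseteq> ?R"
  proof
    fix es assume "es \<in> ?L"
    then show "es \<in> ?R" by (cases es) (auto simp: paths_def image_iff)
  qed
qed (auto simp: paths_def)

lemma finite_paths: "finite (paths d w a b)"
  by (induction w arbitrary: a) (auto simp: paths_Nil paths_Cons)

lemma path_word: "es \<in> paths d w a b \<Longrightarrow> map fst es = w"
  unfolding paths_def mem_Collect_eq by (induction d w a b es rule: is_path.induct) auto

lemma path_length: "es \<in> paths d w a b \<Longrightarrow> length es = length w"
  using path_word by (metis length_map)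

lemma path_ends:
  "es \<in> paths d w a b \<Longrightarrow> w \<noteq> [] \<Longrightarrow> fst (snd (hd es)) = a \<and> snd (snd (last es)) = b"
  unfolding paths_def mem_Collect_eq
proof (induction d w a b es rule: is_path.induct)
  case (3 d i w a b e es)
  then show ?case by (cases w; cases es) auto
qed auto

lemma path_vertices:
  "es \<in> paths d w a b \<Longrightarrow> a < d \<Longrightarrow> set es \<subseteq> set w \<times> {..<d} \<times> {..<d}"
  unfolding paths_def mem_Collect_eq
  by (induction d w a b es rule: is_path.induct) (auto simp: mem_Times_iff)

lemma path_meet:
  "es \<in> paths d w a b \<Longrightarrow> Suc t < length es \<Longrightarrow> fst (snd (es ! Suc t)) = snd (snd (es ! t))"
  unfolding paths_def mem_Collect_eq
proof (induction d w a b es arbitrary: t rule: is_path.induct)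
  case (3 d i w a b e es)
  then show ?case by (cases w; cases es; cases t) auto
qed auto

text \<open>Inner vertices of a path are free. This one degree of freedom is the source of the
  factor \<open>d\<close> in the estimates.\<close>

lemma path_change_vertex:
  "es \<in> paths d w a b \<Longrightarrow> Suc t < length es \<Longrightarrow> c < d \<Longrightarrow>
    es[t := (fst (es ! t), fst (snd (es ! t)), c),
       Suc t := (fst (es ! Suc t), c, snd (snd (es ! Suc t)))] \<in> paths d w a b"
  unfolding paths_def mem_Collect_eq
proof (induction d w a b es arbitrary: t rule: is_path.induct)
  case (3 d i w a b e es)
  then show ?case by (cases w; cases es; cases t) auto
qed auto

lemma wt_path: "es \<in> paths d w a b \<Longrightarrow> wt m (mon_of es) = word_degree m w"
  using path_word[of es d w a b] by (auto simp: wt_mon word_degree_def)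

section \<open>Coefficients normalised by factorials\<close>

definition monfact :: "('a \<Rightarrow>\<^sub>0 nat) \<Rightarrow> complex" where
  "monfact \<mu> = (\<Prod>v\<in>keys \<mu>. fact (lookup \<mu> v))"

lemma monfact_nonzero: "monfact \<mu> \<noteq> 0"
  by (simp add: monfact_def)

lemma monfact_superset: "finite S \<Longrightarrow> keys \<mu> \<subseteq> S \<Longrightarrow> monfact \<mu> = (\<Prod>v\<in>S. fact (lookup \<mu> v))"
  unfolding monfact_def by (intro prod.mono_neutral_left) (auto simp: in_keys_iff)

lemma monfact_add_single: "monfact (single v 1 + \<mu>) = of_nat (Suc (lookup \<mu> v)) * monfact \<mu>"
proof -
  have "monfact (single v 1 + \<mu>) = (\<Prod>u\<in>insert v (keys \<mu>). fact (lookup (single v 1 + \<mu>) u))"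
    by (intro monfact_superset) (auto simp: keys_add_nat)
  also have "\<dots> = fact (Suc (lookup \<mu> v)) * (\<Prod>u\<in>keys \<mu> - {v}. fact (lookup \<mu> u))"
    by (subst prod.insert_remove) (auto simp: lookup_add lookup_single when_def intro!: arg_cong2[where f = "(*)"] prod.cong split: if_splits)
  also have "\<dots> = of_nat (Suc (lookup \<mu> v)) * (\<Prod>u\<in>insert v (keys \<mu>). fact (lookup \<mu> u))"
    by (subst prod.insert_remove) auto
  also have "(\<Prod>u\<in>insert v (keys \<mu>). fact (lookup \<mu> u)) = monfact \<mu>"
    by (intro monfact_superset[symmetric]) auto
  finally show ?thesis .
qed

text \<open>In the coefficients normalised by factorials, multiplication by a variable becomes the sum over
  all ways to choose a factor of the monomial, and differentiation becomes a shift.\<close>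

definition dcoeff :: "'x cpoly \<Rightarrow> ('x \<Rightarrow>\<^sub>0 nat) \<Rightarrow> complex" where
  "dcoeff g \<mu> = lookup g \<mu> * monfact \<mu>"

lemma dcoeff_simps: "dcoeff 0 \<mu> = 0" "dcoeff (g + h) \<mu> = dcoeff g \<mu> + dcoeff h \<mu>"
  "dcoeff (- g) \<mu> = - dcoeff g \<mu>" "dcoeff (g - h) \<mu> = dcoeff g \<mu> - dcoeff h \<mu>"
  "dcoeff (const_poly c * g) \<mu> = c * dcoeff g \<mu>"
  "dcoeff (sum f S) \<mu> = (\<Sum>x\<in>S. dcoeff (f x) \<mu>)"
  by (simp_all add: dcoeff_def lookup_add lookup_minus lookup_const_mult lookup_sum sum_distrib_right
      distrib_right left_diff_distrib)

text \<open>The iterated partial derivative with multi-index \<nu>. It is adjoint to multiplication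
  by the monomial \<nu> for the inner product in which distinct monomials are orthogonal and \<mu>
  has squared norm \<open>monfact \<mu>\<close>.\<close>

definition mdiff :: "('x \<Rightarrow>\<^sub>0 nat) \<Rightarrow> 'x cpoly \<Rightarrow> 'x cpoly" where
  "mdiff \<nu> g = Abs_poly_mapping (\<lambda>\<mu>. dcoeff g (\<mu> + \<nu>) / monfact \<mu>)"

lemma lookup_mdiff: "lookup (mdiff \<nu> g) \<mu> = dcoeff g (\<mu> + \<nu>) / monfact \<mu>"
proof -
  have "finite ((\<lambda>\<mu>. \<mu> + \<nu>) -` keys g)" by (intro finite_vimageI) (auto intro: injI)
  then have "finite {\<mu>. dcoeff g (\<mu> + \<nu>) / monfact \<mu> \<noteq> 0}"
    by (rule rev_finite_subset) (auto simp: dcoeff_def in_keys_iff)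
  then show ?thesis by (simp add: mdiff_def)
qed

lemma dcoeff_mdiff: "dcoeff (mdiff \<nu> g) \<mu> = dcoeff g (\<mu> + \<nu>)"
  by (simp add: dcoeff_def[of "mdiff \<nu> g"] lookup_mdiff monfact_nonzero)

lemma mdiff_diff: "mdiff \<nu> (g - h) = mdiff \<nu> g - mdiff \<nu> h"
  by (intro poly_mapping_eqI) (simp add: lookup_mdiff lookup_minus dcoeff_simps diff_divide_distrib)

lemma mdiff_add: "mdiff \<nu> (g + h) = mdiff \<nu> g + mdiff \<nu> h"
  by (intro poly_mapping_eqI) (simp add: lookup_mdiff lookup_add dcoeff_simps add_divide_distrib)

lemma mdiff_const_mult: "mdiff \<nu> (const_poly c * g) = const_poly c * mdiff \<nu> g"
  by (intro poly_mapping_eqI) (simp add: lookup_mdiff lookup_const_mult dcoeff_simps)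

section \<open>The model of the Koszul complex\<close>

definition idxs :: "nat \<Rightarrow> nat \<Rightarrow> idx set" where
  "idxs p d = {..<p} \<times> {..<d} \<times> {..<d}"

lemma finite_idxs: "finite (idxs p d)" by (simp add: idxs_def)

text \<open>The (a, b) entry of the product of generic matrices spelled by \<open>w\<close>,
  expanded into monomials.\<close>

definition word_poly :: "nat \<Rightarrow> nat list \<Rightarrow> nat \<Rightarrow> nat \<Rightarrow> coord_poly" where
  "word_poly d w a b = (\<Sum>es\<in>paths d w a b. single (mon_of es) 1)"

definition entry :: "(nat \<Rightarrow> ncpoly) \<Rightarrow> nat \<Rightarrow> idx \<Rightarrow> coord_poly" where
  "entry e d = (\<lambda>(j, a, b). \<Sum>w\<in>keys (e j). const_poly (lookup (e j) w) * word_poly d w a b)"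

text \<open>An alternating function of index lists holds the coordinates of an element of an
  exterior power over the coordinate ring. In these coordinates the Koszul differential inserts the
  vector of entries of the relations into the first argument.\<close>

definition kos_d :: "nat \<Rightarrow> nat \<Rightarrow> (nat \<Rightarrow> ncpoly) \<Rightarrow> (idx list \<Rightarrow> coord_poly) \<Rightarrow> idx list \<Rightarrow> coord_poly" where
  "kos_d p d e F = (\<lambda>as. \<Sum>\<alpha>\<in>idxs p d. entry e d \<alpha> * F (\<alpha> # as))"

text \<open>If \<open>e j\<close> is the word \<open>w j\<close>, then \<open>contract d w \<alpha>\<close> is the adjoint of the multiplication by the
  entry with index \<open>\<alpha>\<close>, up to normalisation.\<close>

definition contract :: "nat \<Rightarrow> (nat \<Rightarrow> nat list) \<Rightarrow> idx \<Rightarrow> coord_poly \<Rightarrow> coord_poly" where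
  "contract d w = (\<lambda>(j, a, b) g.
     const_poly (1 / of_nat (card (paths d (w j) a b))) * (\<Sum>es\<in>paths d (w j) a b. mdiff (mon_of es) g))"

text \<open>\<open>contract\<close> makes sense for arbitrary triples, so values outside the index
  set have to be cut off for the result to be a cochain again.\<close>

definition kos_h :: "nat \<Rightarrow> nat \<Rightarrow> (nat \<Rightarrow> nat list) \<Rightarrow> (idx list \<Rightarrow> coord_poly) \<Rightarrow> idx list \<Rightarrow> coord_poly" where
  "kos_h p d w F = (\<lambda>as. if set as \<subseteq> idxs p d then skew (\<lambda>\<alpha> \<gamma>. contract d w \<alpha> (F \<gamma>)) as else 0)"

text \<open>The relations \<open>e\<close> enter only through \<open>kos_d\<close>, the words
  \<open>w\<close> only through \<open>kos_h\<close>. The two fit together as adjoints, up to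
  normalisation, when \<open>e\<close> is \<open>word_relations p w\<close>.\<close>

definition laplace :: "nat \<Rightarrow> nat \<Rightarrow> (nat \<Rightarrow> nat list) \<Rightarrow> (nat \<Rightarrow> ncpoly) \<Rightarrow> (idx list \<Rightarrow> coord_poly) \<Rightarrow>
    idx list \<Rightarrow> coord_poly" where
  "laplace p d w e F = kos_d p d e (kos_h p d w F) + kos_h p d w (kos_d p d e F)"

text \<open>A generator with index (j, a, b) has weight \<open>r j\<close>, which is added to the
  weight of the coefficient; with this convention both \<open>kos_d\<close> and \<open>kos_h\<close>
  respect the bound \<open>R\<close>.\<close>

definition cochains :: "nat \<Rightarrow> (nat \<Rightarrow> nat) \<Rightarrow> nat \<Rightarrow> (nat \<Rightarrow> nat) \<Rightarrow> nat \<Rightarrow> nat \<Rightarrow> nat \<Rightarrow>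
    (idx list \<Rightarrow> coord_poly) set" where
  "cochains n m p r d k R = {F. alternating F \<and>
     (\<forall>as. F as \<noteq> 0 \<longrightarrow> length as = k \<and> set as \<subseteq> idxs p d) \<and>
     (\<forall>as. \<forall>\<mu>\<in>keys (F as). keys \<mu> \<subseteq> idxs n d \<and> wt m \<mu> + sum_list (map (r \<circ> fst) as) \<le> R)}"

lemma cochainsD:
  assumes "F \<in> cochains n m p r d k R"
  shows "alternating F" "F as \<noteq> 0 \<Longrightarrow> length as = k" "F as \<noteq> 0 \<Longrightarrow> set as \<subseteq> idxs p d"
    "\<mu> \<in> keys (F as) \<Longrightarrow> keys \<mu> \<subseteq> idxs n d"
    "\<mu> \<in> keys (F as) \<Longrightarrow> wt m \<mu> + sum_list (map (r \<circ> fst) as) \<le> R"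
  using assms unfolding cochains_def mem_Collect_eq by simp_all

lemma cochainsI:
  assumes "alternating F" "\<And>as. F as \<noteq> 0 \<Longrightarrow> length as = k \<and> set as \<subseteq> idxs p d"
    "\<And>as \<mu>. \<mu> \<in> keys (F as) \<Longrightarrow> keys \<mu> \<subseteq> idxs n d \<and> wt m \<mu> + sum_list (map (r \<circ> fst) as) \<le> R"
  shows "F \<in> cochains n m p r d k R"
  using assms unfolding cochains_def mem_Collect_eq by simp

definition fscale :: "complex \<Rightarrow> (idx list \<Rightarrow> coord_poly) \<Rightarrow> idx list \<Rightarrow> coord_poly" where
  "fscale c F = (\<lambda>as. const_poly c * F as)"

interpretation fscale: vector_space fscale
  by standard (auto simp: fscale_def fun_eq_iff algebra_simps single_add const_poly_mult)

section \<open>Linearity and signs of the operators\<close>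

lemma contract_diff: "contract d w \<alpha> (g - h) = contract d w \<alpha> g - contract d w \<alpha> h"
  by (simp add: contract_def case_prod_beta mdiff_diff sum_subtractf right_diff_distrib)

lemma contract_add: "contract d w \<alpha> (g + h) = contract d w \<alpha> g + contract d w \<alpha> h"
  by (simp add: contract_def case_prod_beta mdiff_add sum.distrib distrib_left)

lemma contract_uminus: "contract d w \<alpha> (- g) = - contract d w \<alpha> g"
  using contract_diff[of d w \<alpha> 0 g] contract_diff[of d w \<alpha> 0 0] by simp

lemma contract_const_mult: "contract d w \<alpha> (const_poly c * g) = const_poly c * contract d w \<alpha> g"
  by (simp add: contract_def case_prod_beta mdiff_const_mult sum_distrib_left mult.left_commute)

lemma kos_d_add: "kos_d p d e (F + G) = kos_d p d e F + kos_d p d e G"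
  by (simp add: kos_d_def fun_eq_iff distrib_left sum.distrib)

lemma kos_d_scale: "kos_d p d e (fscale c F) = fscale c (kos_d p d e F)"
  by (simp add: kos_d_def fscale_def fun_eq_iff sum_distrib_left mult.left_commute)

lemma kos_h_add: "kos_h p d w (F + G) = kos_h p d w F + kos_h p d w G"
  by (simp add: kos_h_def fun_eq_iff contract_add skew_add)

lemma kos_h_scale: "kos_h p d w (fscale c F) = fscale c (kos_h p d w F)"
  by (simp add: kos_h_def fscale_def fun_eq_iff contract_const_mult skew_mult)

lemma laplace_linear: "Vector_Spaces.linear fscale fscale (laplace p d w e)"
  by (intro module_hom_iff_linear[THEN iffD1] module_hom.intro fscale.module_axioms
      module_hom_axioms.intro)
    (simp_all add: laplace_def kos_d_add kos_d_scale kos_h_add kos_h_scale fscale.scale_right_distrib)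

lemma alternating_kos_d: "alternating F \<Longrightarrow> alternating (kos_d p d e F)"
proof -
  assume F: "alternating F"
  show ?thesis unfolding alternating_def kos_d_def
  proof (intro allI)
    fix u x y v
    have "F (\<alpha> # u @ x # y # v) = - F (\<alpha> # u @ y # x # v)" for \<alpha>
      using alternatingD[OF F, of "\<alpha> # u" x y v] by simp
    then show "(\<Sum>\<alpha>\<in>idxs p d. entry e d \<alpha> * F (\<alpha> # u @ x # y # v)) =
        - (\<Sum>\<alpha>\<in>idxs p d. entry e d \<alpha> * F (\<alpha> # u @ y # x # v))"
      by (simp only: mult_minus_right sum_negf)
  qed
qed

lemma alternating_kos_h: "alternating F \<Longrightarrow> alternating (kos_h p d w F)"
proof -
  assume F: "alternating F"
  have "alternating (\<lambda>\<gamma>. contract d w \<alpha> (F \<gamma>))" for \<alpha>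
    unfolding alternating_def
  proof (intro allI)
    fix u x y v
    show "contract d w \<alpha> (F (u @ x # y # v)) = - contract d w \<alpha> (F (u @ y # x # v))"
      unfolding alternatingD[OF F, of u x y v] contract_uminus ..
  qed
  then have a: "alternating (skew (\<lambda>\<alpha> \<gamma>. contract d w \<alpha> (F \<gamma>)))" by (rule alternating_skew)
  show ?thesis unfolding alternating_def kos_h_def
  proof (intro allI)
    fix u x y v
    show "(if set (u @ x # y # v) \<subseteq> idxs p d then skew (\<lambda>\<alpha> \<gamma>. contract d w \<alpha> (F \<gamma>)) (u @ x # y # v) else 0) =
      - (if set (u @ y # x # v) \<subseteq> idxs p d then skew (\<lambda>\<alpha> \<gamma>. contract d w \<alpha> (F \<gamma>)) (u @ y # x # v) else 0)"
      unfolding alternatingD[OF a, of u x y v] by auto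
  qed
qed

lemma cpoly_eq_uminus_self: "g = - g \<Longrightarrow> g = (0 :: 'a \<Rightarrow>\<^sub>0 complex)"
proof (rule poly_mapping_eqI)
  fix x assume "g = - g"
  then have "lookup g x = - lookup g x" by (metis lookup_uminus)
  then show "lookup g x = lookup 0 x" by simp
qed

text \<open>Interchanging the two summations and swapping the first two arguments turns the double
  sum into its own negative.\<close>

lemma kos_d_squared:
  assumes F: "alternating F"
  shows "kos_d p d e (kos_d p d e F) = 0"
proof
  fix as
  let ?S = "\<Sum>\<alpha>\<in>idxs p d. \<Sum>\<beta>\<in>idxs p d. entry e d \<alpha> * (entry e d \<beta> * F (\<beta> # \<alpha> # as))"
  have "?S = (\<Sum>\<beta>\<in>idxs p d. \<Sum>\<alpha>\<in>idxs p d. entry e d \<alpha> * (entry e d \<beta> * F (\<beta> # \<alpha> # as)))"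
    by (rule sum.swap)
  also have "\<dots> = (\<Sum>\<beta>\<in>idxs p d. \<Sum>\<alpha>\<in>idxs p d. - (entry e d \<beta> * (entry e d \<alpha> * F (\<alpha> # \<beta> # as))))"
    by (intro sum.cong refl) (subst alternating_swap[OF F], simp add: mult.left_commute)
  also have "\<dots> = - ?S" by (simp add: sum_negf)
  finally have "?S = 0" by (rule cpoly_eq_uminus_self)
  then show "kos_d p d e (kos_d p d e F) as = 0 as"
    by (simp add: kos_d_def sum_distrib_left)
qed

section \<open>Supports and weights\<close>

lemma keys_sumE:
  assumes "\<mu> \<in> keys (sum f S)"
  obtains x where "x \<in> S" "\<mu> \<in> keys (f x)"
  using assms keys_sum[of f S] by blast

lemma keys_multE:
  assumes "\<mu> \<in> keys (f * g)"
  obtains a b where "a \<in> keys f" "b \<in> keys g" "\<mu> = a + b"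
  using assms keys_mult[of f g] by blast

lemma keys_const_multE:
  assumes "\<mu> \<in> keys (const_poly c * g)"
  shows "\<mu> \<in> keys g"
  using assms by (auto simp: in_keys_iff lookup_const_mult)

lemma keys_word_poly:
  assumes "\<mu> \<in> keys (word_poly d w a b)" "a < d"
  shows "keys \<mu> \<subseteq> set w \<times> {..<d} \<times> {..<d}" "wt m \<mu> = word_degree m w"
proof -
  obtain es where es: "es \<in> paths d w a b" "\<mu> = mon_of es"
    using assms(1) unfolding word_poly_def by (elim keys_sumE) (auto split: if_splits)
  show "keys \<mu> \<subseteq> set w \<times> {..<d} \<times> {..<d}" using path_vertices[OF es(1) assms(2)] es(2) by (simp add: keys_mon)
  show "wt m \<mu> = word_degree m w" using wt_path[OF es(1)] es(2) by simp
qed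

lemma keys_entry:
  assumes "e \<in> relation_space n m p r" "\<alpha> \<in> idxs p d" "\<mu> \<in> keys (entry e d \<alpha>)"
  shows "keys \<mu> \<subseteq> idxs n d" "wt m \<mu> = r (fst \<alpha>)"
proof -
  obtain j a b where \<alpha>: "\<alpha> = (j, a, b)" "j < p" "a < d" "b < d" using assms(2) by (auto simp: idxs_def)
  obtain w where w: "w \<in> keys (e j)" "\<mu> \<in> keys (word_poly d w a b)"
    using assms(3) unfolding \<alpha>(1) entry_def prod.case by (elim keys_sumE) (blast dest: keys_const_multE)
  have "set w \<subseteq> {..<n}" "word_degree m w = r j"
    using assms(1) \<alpha>(2) w(1) by (auto simp: relation_space_def TV_component_def TV_def)
  then show "keys \<mu> \<subseteq> idxs n d" "wt m \<mu> = r (fst \<alpha>)"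
    using keys_word_poly[OF w(2) \<alpha>(3)] \<alpha>(1) by (auto simp: idxs_def)
qed

lemma kos_d_cochains:
  assumes e: "e \<in> relation_space n m p r" and F: "F \<in> cochains n m p r d (Suc k) R"
  shows "kos_d p d e F \<in> cochains n m p r d k R"
proof -
  have 1: "length as = k \<and> set as \<subseteq> idxs p d" if "kos_d p d e F as \<noteq> 0" for as
  proof -
    obtain \<alpha> where "\<alpha> \<in> idxs p d" "F (\<alpha> # as) \<noteq> 0"
      using \<open>kos_d p d e F as \<noteq> 0\<close> unfolding kos_d_def
      by (elim sum.not_neutral_contains_not_neutral) fastforce
    then show ?thesis using cochainsD(2,3)[OF F, of "\<alpha> # as"] by simp
  qed
  have 2: "keys \<mu> \<subseteq> idxs n d \<and> wt m \<mu> + sum_list (map (r \<circ> fst) as) \<le> R"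
    if \<mu>: "\<mu> \<in> keys (kos_d p d e F as)" for as \<mu>
  proof -
    obtain \<alpha> \<mu>1 \<mu>2 where a: "\<alpha> \<in> idxs p d" "\<mu>1 \<in> keys (entry e d \<alpha>)" "\<mu>2 \<in> keys (F (\<alpha> # as))" "\<mu> = \<mu>1 + \<mu>2"
      using \<mu> unfolding kos_d_def by (elim keys_sumE keys_multE)
    show ?thesis using cochainsD(4,5)[OF F a(3)] keys_entry[OF e a(1,2)] a(4) by (auto simp: keys_add_nat wt_add)
  qed
  show ?thesis by (intro cochainsI alternating_kos_d cochainsD(1)[OF F] 1 2)
qed

lemma keys_contract:
  assumes "\<mu> \<in> keys (contract d w (j, a, b) g)"
  obtains es where "es \<in> paths d (w j) a b" "\<mu> + mon_of es \<in> keys g"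
proof -
  obtain es where "es \<in> paths d (w j) a b" "\<mu> \<in> keys (mdiff (mon_of es) g)"
    using assms unfolding contract_def prod.case by (blast dest: keys_const_multE elim: keys_sumE)
  then show ?thesis using that by (auto simp: in_keys_iff lookup_mdiff dcoeff_def)
qed

lemma length_del: "i < length as \<Longrightarrow> length (del i as) = length as - 1"
  by (auto simp: del_def)

lemma set_del: "i < length as \<Longrightarrow> set as = insert (as ! i) (set (del i as))"
  by (subst id_take_nth_drop[of i as]) (auto simp: del_def)

lemma sum_list_del: "i < length as \<Longrightarrow> sum_list (map f as) = f (as ! i) + sum_list (map f (del i as))"
  for f :: "'a \<Rightarrow> 'b::comm_monoid_add"
  by (subst id_take_nth_drop[of i as]) (auto simp: del_def ac_simps)

text \<open>Differentiating along a path for \<open>w j\<close> lowers the weight of the coefficient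
  by \<open>r j\<close>, which is the weight of the generator that is gained.\<close>

lemma kos_h_cochains:
  assumes w: "\<And>j. j < p \<Longrightarrow> word_degree m (w j) = r j" and F: "F \<in> cochains n m p r d k R"
  shows "kos_h p d w F \<in> cochains n m p r d (Suc k) R"
proof -
  have 1: "length as = Suc k \<and> set as \<subseteq> idxs p d" if "kos_h p d w F as \<noteq> 0" for as
  proof -
    have as: "set as \<subseteq> idxs p d" "skew (\<lambda>\<alpha> \<gamma>. contract d w \<alpha> (F \<gamma>)) as \<noteq> 0"
      using that by (auto simp: kos_h_def split: if_splits)
    then obtain i where i: "i < length as" "contract d w (as ! i) (F (del i as)) \<noteq> 0"
      unfolding skew_eq_sum by (elim sum.not_neutral_contains_not_neutral) fastforce
    have "contract d w \<alpha> 0 = 0" for \<alpha> using contract_diff[of d w \<alpha> 0 0] by simp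
    then have "F (del i as) \<noteq> 0" using i(2) by metis
    then have "length (del i as) = k" by (rule cochainsD(2)[OF F])
    then show ?thesis using length_del[OF i(1)] i(1) as(1) by auto
  qed
  have 2: "keys \<mu> \<subseteq> idxs n d \<and> wt m \<mu> + sum_list (map (r \<circ> fst) as) \<le> R"
    if \<mu>: "\<mu> \<in> keys (kos_h p d w F as)" for as \<mu>
  proof -
    have as: "set as \<subseteq> idxs p d" "\<mu> \<in> keys (skew (\<lambda>\<alpha> \<gamma>. contract d w \<alpha> (F \<gamma>)) as)"
      using \<mu> by (auto simp: kos_h_def split: if_splits)
    have "lookup ((- 1) ^ i * g) \<mu> = (- 1) ^ i * lookup g \<mu>" for i and g :: coord_poly
      by (cases "even i") auto
    then obtain i where i: "i < length as" "\<mu> \<in> keys (contract d w (as ! i) (F (del i as)))"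
      using as(2) unfolding skew_eq_sum by (elim keys_sumE) (auto simp: in_keys_iff)
    have "as ! i \<in> idxs p d" using as(1) nth_mem[OF i(1)] by blast
    then obtain j a b where asi: "as ! i = (j, a, b)" "j < p" by (auto simp: idxs_def)
    obtain es where es: "es \<in> paths d (w j) a b" "\<mu> + mon_of es \<in> keys (F (del i as))"
      using i(2) unfolding asi(1) by (rule keys_contract)
    show ?thesis using cochainsD(4,5)[OF F es(2)] wt_path[OF es(1)] w[OF asi(2)] sum_list_del[OF i(1), of "r \<circ> fst"] asi(1)
      by (auto simp: keys_add_nat wt_add)
  qed
  show ?thesis by (intro cochainsI alternating_kos_h cochainsD(1)[OF F] 1 2)
qed

section \<open>Labelled monomials\<close>

lemma non_overlapping_sym: "non_overlapping e f \<Longrightarrow> non_overlapping f e"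
  unfolding non_overlapping_def by metis

text \<open>Following successors and predecessors of the common label aligns \<open>M\<close> with
  \<open>L\<close> at the shift \<open>s - t\<close>. Either \<open>M\<close> ends inside
  \<open>L\<close>, so that its word is a subword, or a tail of \<open>L\<close> is a head of
  \<open>M\<close>. Non-overlapping words allow this only if the two lists coincide.\<close>

lemma non_overlapping_alignment:
  assumes no: "non_overlapping (map f L) (map f M)"
    and eq: "L ! s = M ! t" "s < length L" "t < length M" "t \<le> s"
    and out: "\<And>s t. Suc s < length L \<Longrightarrow> Suc t < length M \<Longrightarrow> L ! s = M ! t \<Longrightarrow> L ! Suc s = M ! Suc t"
    and inn: "\<And>s t. Suc s < length L \<Longrightarrow> Suc t < length M \<Longrightarrow> L ! Suc s = M ! Suc t \<Longrightarrow> L ! s = M ! t"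
  shows "L = M"
proof -
  define k where "k = s - t"
  \<comment> \<open>Predecessors lead from the common label back to the first label of
    \<open>M\<close>; there is room for this in \<open>L\<close> because
    \<open>t \<le> s\<close>.\<close>
  have down: "i \<le> t \<Longrightarrow> L ! (s - i) = M ! (t - i)" for i
  proof (induction i)
    case (Suc i)
    have "L ! Suc (s - Suc i) = M ! Suc (t - Suc i)"
      using Suc eq(4) by (simp add: Suc_diff_Suc)
    then show ?case using inn[of "s - Suc i" "t - Suc i"] Suc.prems eq by simp
  qed (use eq in simp)
  have al: "k + i < length L \<Longrightarrow> i < length M \<Longrightarrow> L ! (k + i) = M ! i" for i
  proof (induction i)
    case 0
    then show ?case using down[of t] by (simp add: k_def)
  next
    case (Suc i)
    then show ?case using out[of "k + i" i] by simp
  qed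
  have kL: "k < length L" using eq(2) by (simp add: k_def)
  show "L = M"
  proof (cases "length M \<le> length L - k")
    case True
    have "M = take (length M) (drop k L)"
      using True kL al by (intro nth_equalityI) auto
    then have "L = take k L @ M @ drop (length M) (drop k L)"
      by (metis append_take_drop_id)
    then have "sublist (map f M) (map f L)"
      by (metis map_append sublist_appendI)
    then have e: "map f M = map f L"
      using no unfolding non_overlapping_def strict_sublist_def by blast
    then have len: "length M = length L" by (metis length_map)
    then have "k = 0" using True kL by simp
    then show ?thesis using len al by (intro nth_equalityI) auto
  next
    case False
    \<comment> \<open>Now \<open>M\<close> runs past the end of \<open>L\<close>, so the common part
      is a suffix of one word and a prefix of the other.\<close>
    have d: "drop k L = take (length L - k) M"
      using False kL al by (intro nth_equalityI) auto
    let ?u = "map f (drop k L)"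
    have "suffix ?u (map f L)"
      by (metis append_take_drop_id map_append suffixI)
    moreover have "prefix ?u (map f M)"
      unfolding d by (metis take_is_prefix take_map)
    moreover have "?u \<noteq> []" using kL by simp
    ultimately have "map f L = map f M \<and> ?u = map f L"
      using no unfolding non_overlapping_def by blast
    then have "length L = length M" "length (drop k L) = length L" by (metis length_map)+
    then show ?thesis using False kL by simp
  qed
qed

section \<open>Changing the labels of a block and averaging over its paths\<close>

definition upd :: "('a \<Rightarrow> 'b) \<Rightarrow> 'a list \<Rightarrow> 'b list \<Rightarrow> 'a \<Rightarrow> 'b" where
  "upd y L es = (\<lambda>l. case map_of (zip L es) l of None \<Rightarrow> y l | Some e \<Rightarrow> e)"

lemma upd_notin: "l \<notin> set L \<Longrightarrow> upd y L es l = y l"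
proof -
  assume "l \<notin> set L"
  then have "map_of (zip L es) l = None" by (metis map_of_eq_None_iff set_zip_leftD imageE fst_conv surj_pair)
  then show ?thesis by (simp add: upd_def)
qed

lemma upd_nth: "distinct L \<Longrightarrow> length es = length L \<Longrightarrow> i < length L \<Longrightarrow> upd y L es (L ! i) = es ! i"
  by (simp add: upd_def map_of_zip_nth)

lemma map_upd: "distinct L \<Longrightarrow> length es = length L \<Longrightarrow> map (upd y L es) L = es"
  by (intro nth_equalityI) (auto simp: upd_nth)

lemma upd_eqI:
  assumes "distinct L" "length es = length L" "\<And>l. l \<notin> set L \<Longrightarrow> z l = y l" "map z L = es"
  shows "upd y L es = z"
proof
  fix l
  show "upd y L es l = z l"
  proof (cases "l \<in> set L")
    case True
    then obtain i where "i < length L" "l = L ! i" by (metis in_set_conv_nth)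
    then show ?thesis using assms upd_nth[of L es i y] by auto
  qed (simp add: upd_notin assms)
qed

lemma upd_upd: "distinct L \<Longrightarrow> length es = length L \<Longrightarrow> length fs = length L \<Longrightarrow>
    upd (upd y L es) L fs = upd y L fs"
  by (rule upd_eqI) (auto simp: upd_notin map_upd)

lemma upd_same: "distinct L \<Longrightarrow> upd y L (map y L) = y"
  by (rule upd_eqI) auto

type_synonym block = "nat \<times> nat list"

text \<open>A block \<open>(j, L)\<close> of labels below \<open>q\<close> is a place for an occurrence of \<open>w j\<close> among \<open>q\<close> labelled
  edges. A monomial of the Koszul complex corresponds to disjoint blocks, which stand for the
  exterior generators, and a labelling \<open>y\<close> of the edges; an exterior generator is spread out over
  all paths with the given ends.\<close>

locale words =
  fixes n p d q :: nat and w :: "nat \<Rightarrow> nat list"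
  assumes w_set: "j < p \<Longrightarrow> set (w j) \<subseteq> {..<n}"
    and w_inj: "inj_on w {..<p}"
    and w_no: "i < p \<Longrightarrow> j < p \<Longrightarrow> non_overlapping (w i) (w j)"
begin

lemma w_nonempty: "j < p \<Longrightarrow> w j \<noteq> []"
  using w_no[of j j] by (auto simp: non_overlapping_def)

definition blocks :: "block set" where
  "blocks = (SIGMA j:{..<p}. {L. distinct L \<and> set L \<subseteq> {..<q} \<and> length L = length (w j)})"

text \<open>Extensional functions, so that labels outside the range carry no information and the set
  is finite.\<close>

definition Y :: "(nat \<Rightarrow> idx) set" where "Y = {..<q} \<rightarrow>\<^sub>E idxs n d"

definition good :: "block \<Rightarrow> (nat \<Rightarrow> idx) \<Rightarrow> bool" where
  "good b y \<longleftrightarrow> (\<exists>s t. map y (snd b) \<in> paths d (w (fst b)) s t)"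

definition ends :: "(nat \<Rightarrow> idx) \<Rightarrow> block \<Rightarrow> idx" where
  "ends y b = (fst b, fst (snd (y (hd (snd b)))), snd (snd (y (last (snd b)))))"

definition cls :: "block \<Rightarrow> (nat \<Rightarrow> idx) \<Rightarrow> idx list set" where
  "cls b y = (if good b y then (case ends y b of (j, s, t) \<Rightarrow> paths d (w j) s t) else {})"

text \<open>The projection \<open>Q\<^sub>b\<close> of the overview. Where the labelling does not
  spell the word of the block, the class is empty and the value is 0 without a case
  distinction.\<close>

definition avg :: "block \<Rightarrow> ((nat \<Rightarrow> idx) \<Rightarrow> complex) \<Rightarrow> (nat \<Rightarrow> idx) \<Rightarrow> complex" where
  "avg b v y = 1 / of_nat (card (cls b y)) * (\<Sum>es\<in>cls b y. v (upd y (snd b) es))"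

definition invariant :: "block \<Rightarrow> ((nat \<Rightarrow> idx) \<Rightarrow> complex) \<Rightarrow> bool" where
  "invariant b u \<longleftrightarrow> (\<forall>y\<in>Y. (\<not> good b y \<longrightarrow> u y = 0) \<and> (\<forall>es\<in>cls b y. u (upd y (snd b) es) = u y))"

definition ip :: "((nat \<Rightarrow> idx) \<Rightarrow> complex) \<Rightarrow> ((nat \<Rightarrow> idx) \<Rightarrow> complex) \<Rightarrow> complex" where
  "ip u v = (\<Sum>y\<in>Y. cnj (u y) * v y)"

definition nrm :: "((nat \<Rightarrow> idx) \<Rightarrow> complex) \<Rightarrow> real" where
  "nrm u = (\<Sum>y\<in>Y. (cmod (u y))\<^sup>2)"

lemma finite_Y: "finite Y" unfolding Y_def by (intro finite_PiE) (auto simp: finite_idxs)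

lemma finite_blocks: "finite blocks"
proof -
  have "finite {L. distinct L \<and> set L \<subseteq> {..<q} \<and> length L = k}" for k
    by (rule finite_subset[OF _ finite_lists_length_eq[of "{..<q}" k]]) auto
  then show ?thesis unfolding blocks_def by auto
qed

lemma blocksD:
  assumes "b \<in> blocks"
  shows "fst b < p" "distinct (snd b)" "set (snd b) \<subseteq> {..<q}" "length (snd b) = length (w (fst b))"
    "w (fst b) \<noteq> []" "snd b \<noteq> []"
proof -
  show 1: "fst b < p" "distinct (snd b)" "set (snd b) \<subseteq> {..<q}" "length (snd b) = length (w (fst b))"
    using assms by (auto simp: blocks_def)
  show "w (fst b) \<noteq> []" using w_nonempty 1(1) by blast
  then show "snd b \<noteq> []" using 1(4) by auto
qed

lemma good_ends:
  assumes "b \<in> blocks" "map y (snd b) \<in> paths d (w (fst b)) s t"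
  shows "ends y b = (fst b, s, t)"
  using path_ends[OF assms(2)] blocksD[OF assms(1)] by (simp add: ends_def hd_map last_map)

lemma cls_eq:
  assumes "b \<in> blocks" "map y (snd b) \<in> paths d (w (fst b)) s t"
  shows "cls b y = paths d (w (fst b)) s t"
proof -
  have "good b y" using assms(2) by (auto simp: good_def)
  then show ?thesis by (simp add: cls_def good_ends[OF assms])
qed

lemma clsE:
  assumes "b \<in> blocks" "es \<in> cls b y"
  obtains s t where "map y (snd b) \<in> paths d (w (fst b)) s t" "es \<in> paths d (w (fst b)) s t"
proof -
  have "good b y" using assms(2) by (auto simp: cls_def split: if_splits)
  then obtain s t where st: "map y (snd b) \<in> paths d (w (fst b)) s t" by (auto simp: good_def)
  then show ?thesis using that assms cls_eq by blast
qed

lemma finite_cls: "finite (cls b y)"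
  by (auto simp: cls_def finite_paths split: prod.split)

lemma cls_length: "b \<in> blocks \<Longrightarrow> es \<in> cls b y \<Longrightarrow> length es = length (snd b)"
  by (metis clsE blocksD(4) path_length)

lemma self_in_cls: "b \<in> blocks \<Longrightarrow> good b y \<Longrightarrow> map y (snd b) \<in> cls b y"
  unfolding good_def using cls_eq by blast

lemma cls_upd:
  assumes b: "b \<in> blocks" and es: "es \<in> cls b y"
  shows "cls b (upd y (snd b) es) = cls b y" "good b (upd y (snd b) es)" "ends (upd y (snd b) es) b = ends y b"
proof -
  obtain s t where st: "map y (snd b) \<in> paths d (w (fst b)) s t" "es \<in> paths d (w (fst b)) s t"
    using clsE[OF b es] .
  have u: "map (upd y (snd b) es) (snd b) = es"
    using map_upd blocksD(2)[OF b] cls_length[OF b es] by blast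
  then show "cls b (upd y (snd b) es) = cls b y" "ends (upd y (snd b) es) b = ends y b"
    using cls_eq[OF b] good_ends[OF b] st by metis+
  show "good b (upd y (snd b) es)" using u st(2) by (auto simp: good_def)
qed

lemma cls_in_idxs:
  assumes b: "b \<in> blocks" and y: "y \<in> Y" and es: "es \<in> cls b y"
  shows "set es \<subseteq> idxs n d"
proof -
  obtain s t where st: "map y (snd b) \<in> paths d (w (fst b)) s t" "es \<in> paths d (w (fst b)) s t"
    using clsE[OF b es] .
  have "hd (snd b) \<in> {..<q}" using blocksD[OF b] hd_in_set by blast
  then have "y (hd (snd b)) \<in> idxs n d" using y by (auto simp: Y_def)
  then have "s < d" using good_ends[OF b st(1)] by (auto simp: ends_def idxs_def)
  then show ?thesis using path_vertices[OF st(2)] w_set[OF blocksD(1)[OF b]] by (auto simp: idxs_def)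
qed

lemma upd_in_Y:
  assumes b: "b \<in> blocks" and y: "y \<in> Y" and es: "es \<in> cls b y"
  shows "upd y (snd b) es \<in> Y"
  unfolding Y_def
proof (rule PiE_I)
  fix l assume l: "l \<in> {..<q}"
  show "upd y (snd b) es l \<in> idxs n d"
  proof (cases "l \<in> set (snd b)")
    case True
    then obtain i where i: "i < length (snd b)" "l = snd b ! i" by (metis in_set_conv_nth)
    then have "upd y (snd b) es l = es ! i"
      using upd_nth blocksD(2)[OF b] cls_length[OF b es] by blast
    then show ?thesis using cls_in_idxs[OF b y es] i(1) cls_length[OF b es] nth_mem by auto
  next
    case False
    then show ?thesis using y l by (auto simp: upd_notin Y_def)
  qed
next
  fix l assume l: "l \<notin> {..<q}"
  then have "l \<notin> set (snd b)" using blocksD(3)[OF b] by blast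
  then show "upd y (snd b) es l = undefined" using y l by (auto simp: upd_notin Y_def)
qed

lemma upd_back:
  assumes b: "b \<in> blocks" and es: "es \<in> cls b y"
  shows "upd (upd y (snd b) es) (snd b) (map y (snd b)) = y"
  using upd_upd[OF blocksD(2)[OF b] cls_length[OF b es]] upd_same[OF blocksD(2)[OF b]] by simp

lemma invariantD:
  assumes "invariant b u" "y \<in> Y"
  shows "\<not> good b y \<Longrightarrow> u y = 0" "es \<in> cls b y \<Longrightarrow> u (upd y (snd b) es) = u y"
  using assms unfolding invariant_def by blast+

lemma avg_invariant:
  assumes b: "b \<in> blocks" and u: "invariant b u" and y: "y \<in> Y"
  shows "avg b u y = u y"
proof (cases "good b y")
  case True
  then have "card (cls b y) \<noteq> 0" using self_in_cls[OF b True] finite_cls by auto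
  then show ?thesis using invariantD(2)[OF u y] by (simp add: avg_def)
next
  case False
  then show ?thesis using invariantD(1)[OF u y] by (simp add: avg_def cls_def)
qed

lemma invariant_avg:
  assumes b: "b \<in> blocks"
  shows "invariant b (avg b v)"
  unfolding invariant_def
proof (intro ballI conjI impI)
  fix y assume "\<not> good b y"
  then show "avg b v y = 0" by (simp add: avg_def cls_def)
next
  fix y es assume es: "es \<in> cls b y"
  have "upd (upd y (snd b) es) (snd b) fs = upd y (snd b) fs" if "fs \<in> cls b y" for fs
    using upd_upd blocksD(2)[OF b] cls_length[OF b] es that by blast
  then show "avg b v (upd y (snd b) es) = avg b v y"
    unfolding avg_def cls_upd(1)[OF b es] by (simp cong: sum.cong)
qed

text \<open>Exchanging a labelling with another one of its class is an involution on pairs. It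
  preserves the class and hence the weight of the average, so averaging is self-adjoint.\<close>

lemma ip_avg:
  assumes b: "b \<in> blocks"
  shows "ip u (avg b v) = ip (avg b u) v"
proof -
  define c where "c y = 1 / complex_of_nat (card (cls b y))" for y
  let ?S = "SIGMA y:Y. cls b y"
  let ?h = "\<lambda>(y, es). (upd y (snd b) es, map y (snd b))"
  have "ip u (avg b v) = (\<Sum>y\<in>Y. \<Sum>es\<in>cls b y. c y * (cnj (u y) * v (upd y (snd b) es)))"
    unfolding ip_def avg_def c_def by (simp add: sum_distrib_left mult.left_commute)
  also have "\<dots> = (\<Sum>(y, es)\<in>?S. c y * (cnj (u y) * v (upd y (snd b) es)))"
    by (intro sum.Sigma finite_Y) (auto simp: finite_cls)
  also have "\<dots> = (\<Sum>(y, es)\<in>?S. c y * (cnj (u (upd y (snd b) es)) * v y))"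
  proof (rule sum.reindex_bij_witness[of _ ?h ?h])
    fix z assume "z \<in> ?S"
    then obtain y es where z: "z = (y, es)" "y \<in> Y" "es \<in> cls b y" by blast
    have g: "good b y" using z(3) by (auto simp: cls_def split: if_splits)
    have m: "map (upd y (snd b) es) (snd b) = es"
      using map_upd blocksD(2)[OF b] cls_length[OF b z(3)] by blast
    show "?h (?h z) = z" using upd_back[OF b z(3)] m z(1) by simp
    show "?h z \<in> ?S" using upd_in_Y[OF b z(2,3)] cls_upd(1)[OF b z(3)] self_in_cls[OF b g] z(1) by simp
    show "?h (?h z) = z" using upd_back[OF b z(3)] m z(1) by simp
    show "?h z \<in> ?S" using upd_in_Y[OF b z(2,3)] cls_upd(1)[OF b z(3)] self_in_cls[OF b g] z(1) by simp
    show "(case ?h z of (y, es) \<Rightarrow> c y * (cnj (u (upd y (snd b) es)) * v y)) =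
        (case z of (y, es) \<Rightarrow> c y * (cnj (u y) * v (upd y (snd b) es)))"
      using upd_back[OF b z(3)] cls_upd(1)[OF b z(3)] z(1) by (simp add: c_def)
  qed
  also have "\<dots> = (\<Sum>y\<in>Y. \<Sum>es\<in>cls b y. c y * (cnj (u (upd y (snd b) es)) * v y))"
    by (intro sum.Sigma[symmetric] finite_Y) (auto simp: finite_cls)
  also have "\<dots> = ip (avg b u) v"
    unfolding ip_def avg_def c_def by (simp add: sum_distrib_left sum_distrib_right mult_ac)
  finally show ?thesis .
qed

lemma ip_cong: "(\<And>y. y \<in> Y \<Longrightarrow> u y = u' y) \<Longrightarrow> (\<And>y. y \<in> Y \<Longrightarrow> v y = v' y) \<Longrightarrow> ip u v = ip u' v'"
  unfolding ip_def by (intro sum.cong) auto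

lemma ip_avg_invariant:
  assumes "b \<in> blocks" "invariant b u"
  shows "ip u (avg b v) = ip u v"
  unfolding ip_avg[OF assms(1)] using avg_invariant[OF assms] by (intro ip_cong) auto

lemma ip_self: "ip u u = of_real (nrm u)"
  unfolding ip_def nrm_def by (simp only: of_real_sum complex_norm_square mult.commute)

lemma nrm_nonneg: "nrm u \<ge> 0"
  unfolding nrm_def by (intro sum_nonneg) auto

text \<open>A self-adjoint idempotent is positive.\<close>

lemma ip_avg_nonneg:
  assumes b: "b \<in> blocks"
  shows "Re (ip v (avg b v)) \<ge> 0"
proof -
  have "ip v (avg b v) = ip (avg b v) v" by (rule ip_avg[OF b])
  also have "\<dots> = ip (avg b v) (avg b v)" using ip_avg_invariant[OF b invariant_avg[OF b]] by simp
  finally show ?thesis using nrm_nonneg by (simp add: ip_self)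
qed

text \<open>Moving one inner vertex of a block spreads a value of an invariant function over \<open>d\<close> labellings.\<close>

lemma invariant_spread:
  fixes g :: "(nat \<Rightarrow> idx) \<Rightarrow> nat"
  assumes b: "b \<in> blocks" and u: "invariant b u" and s: "Suc s < length (snd b)"
    and S: "S \<subseteq> {y \<in> Y. good b y}"
    and g: "\<And>y c. y \<in> S \<Longrightarrow>
      g (y(snd b ! s := (fst (y (snd b ! s)), fst (snd (y (snd b ! s))), c),
          snd b ! Suc s := (fst (y (snd b ! Suc s)), c, snd (snd (y (snd b ! Suc s)))))) =
        snd (snd (y (snd b ! s)))"
  shows "real d * (\<Sum>y\<in>S. (cmod (u y))\<^sup>2) \<le> nrm u"
proof -
  let ?k = "snd b ! s" and ?l = "snd b ! Suc s"
  define h where "h y c = y(?k := (fst (y ?k), fst (snd (y ?k)), c), ?l := (fst (y ?l), c, snd (snd (y ?l))))"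
    for y :: "nat \<Rightarrow> idx" and c
  have kl: "?k \<noteq> ?l" using blocksD(2)[OF b] s by (simp add: nth_eq_iff_index_eq)
  have h: "h y c \<in> Y \<and> u (h y c) = u y" if "y \<in> S" "c < d" for y c
  proof -
    have y: "y \<in> Y" "good b y" using S that by auto
    define es where "es = (map y (snd b))[s := (fst (y ?k), fst (snd (y ?k)), c), Suc s := (fst (y ?l), c, snd (snd (y ?l)))]"
    obtain s' t' where st: "map y (snd b) \<in> paths d (w (fst b)) s' t'" using y(2) by (auto simp: good_def)
    have "es \<in> paths d (w (fst b)) s' t'"
      using path_change_vertex[OF st, of s c] s that(2) unfolding es_def by simp
    then have es: "es \<in> cls b y" using cls_eq[OF b st] by simp
    have "upd y (snd b) es = h y c"
    proof (rule upd_eqI[OF blocksD(2)[OF b]])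
      show "length es = length (snd b)" by (simp add: es_def)
      show "h y c l = y l" if "l \<notin> set (snd b)" for l
        using that s by (auto simp: h_def)
      show "map (h y c) (snd b) = es"
      proof (rule nth_equalityI)
        fix i assume "i < length (map (h y c) (snd b))"
        then have i: "i < length (snd b)" by simp
        have "snd b ! i = ?k \<longleftrightarrow> i = s" "snd b ! i = ?l \<longleftrightarrow> i = Suc s"
          using nth_eq_iff_index_eq[OF blocksD(2)[OF b] i] s by auto
        then show "map (h y c) (snd b) ! i = es ! i"
          using i s by (auto simp: es_def h_def nth_list_update)
      qed (simp add: es_def)
    qed
    then show ?thesis using upd_in_Y[OF b y(1) es] invariantD(2)[OF u y(1) es] by simp
  qed
  \<comment> \<open>The move forgets only the vertex between the two edges. The new vertex
    \<open>c\<close> can be read off the result, and \<open>g\<close> recovers the old one.\<close>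
  have inj: "inj_on (\<lambda>(y, c). h y c) (S \<times> {..<d})"
  proof (rule inj_onI, clarify)
    fix y c z e assume yz: "y \<in> S" "z \<in> S" "h y c = h z e"
    have "snd (snd (h y c ?k)) = c" "snd (snd (h z e ?k)) = e" using kl by (simp_all add: h_def)
    then have ce: "c = e" using yz(3) by simp
    have v: "snd (snd (y ?k)) = snd (snd (z ?k))"
      using g[OF yz(1), of c] g[OF yz(2), of e] yz(3) unfolding h_def by simp
    have in_l: "fst (snd (x ?l)) = snd (snd (x ?k))" if "x \<in> S" for x
    proof -
      have "good b x" using S that by auto
      then obtain s' t' where st: "map x (snd b) \<in> paths d (w (fst b)) s' t'" by (auto simp: good_def)
      show ?thesis using path_meet[OF st, of s] s by simp
    qed
    have "y l = z l" for l
    proof -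
      have "h y c l = h z e l" using yz(3) by simp
      then show ?thesis
        using v in_l[OF yz(1)] in_l[OF yz(2)] kl by (auto simp: h_def prod_eq_iff split: if_splits)
    qed
    then show "y = z \<and> c = e" using ce by blast
  qed
  have "real d * (\<Sum>y\<in>S. (cmod (u y))\<^sup>2) = (\<Sum>y\<in>S. \<Sum>c<d. (cmod (u (h y c)))\<^sup>2)"
    using h by (simp add: sum_distrib_left)
  also have "\<dots> = (\<Sum>(y, c)\<in>S \<times> {..<d}. (cmod (u (h y c)))\<^sup>2)"
    by (rule sum.cartesian_product)
  also have "\<dots> = (\<Sum>x\<in>(\<lambda>(y, c). h y c) ` (S \<times> {..<d}). (cmod (u x))\<^sup>2)"
    by (subst sum.reindex[OF inj]) (auto simp: case_prod_beta)
  also have "\<dots> \<le> nrm u"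
    unfolding nrm_def using h by (intro sum_mono2 finite_Y) auto
  finally show ?thesis .
qed

text \<open>Where both words are spelled, some common label is continued differently by the two
  blocks, forwards or backwards. The adjacent vertex, though free within one block, is also recorded
  on an edge of the other, so these labellings carry at most the fraction 1/d of the squared norm of
  either function. The inequality between geometric and arithmetic means gives the rest.\<close>

lemma conflict_bound:
  assumes b: "b \<in> blocks" "b' \<in> blocks" "b \<noteq> b'" "set (snd b) \<inter> set (snd b') \<noteq> {}"
    and u: "invariant b u" and v: "invariant b' v"
  shows "2 * real d * cmod (ip u v) \<le> nrm u + nrm v"
proof -
  define S where "S = {y \<in> Y. good b y \<and> good b' y}"
  have SY: "S \<subseteq> Y" by (auto simp: S_def)
  have key: "real d * (\<Sum>y\<in>S. (cmod (u y))\<^sup>2) \<le> nrm u \<and> real d * (\<Sum>y\<in>S. (cmod (v y))\<^sup>2) \<le> nrm v"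
  proof (cases "S = {}")
    case False
    then obtain y where y: "good b y" "good b' y" by (auto simp: S_def)
    have wd: "map (fst \<circ> y) (snd b) = w (fst b)" "map (fst \<circ> y) (snd b') = w (fst b')"
      using y path_word by (fastforce simp: good_def)+
    have ne: "snd b \<noteq> snd b'"
    proof
      assume "snd b = snd b'"
      then have "w (fst b) = w (fst b')" using wd by simp
      then have "fst b = fst b'" using inj_onD[OF w_inj] blocksD(1)[OF b(1)] blocksD(1)[OF b(2)] by auto
      then show False using b(3) \<open>snd b = snd b'\<close> by (simp add: prod_eq_iff)
    qed
    obtain s t where st: "s < length (snd b)" "t < length (snd b')" "snd b ! s = snd b' ! t"
      using b(4) by (metis disjoint_iff in_set_conv_nth)
    have no: "non_overlapping (map (fst \<circ> y) (snd b)) (map (fst \<circ> y) (snd b'))"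
      unfolding wd using w_no blocksD(1)[OF b(1)] blocksD(1)[OF b(2)] by blast
    have meet: "fst (snd (x (snd c ! Suc i))) = snd (snd (x (snd c ! i)))"
      if "good c x" "Suc i < length (snd c)" for x c i
    proof -
      from that(1) obtain s' t' where st: "map x (snd c) \<in> paths d (w (fst c)) s' t'"
        by (auto simp: good_def)
      show ?thesis using path_meet[OF st, of i] that(2) by simp
    qed
    \<comment> \<open>If the blocks agreed on neighbours wherever they share a label, the alignment
      lemma would identify their label lists.\<close>
    have "(\<exists>s t. Suc s < length (snd b) \<and> Suc t < length (snd b') \<and> snd b ! s = snd b' ! t \<and> snd b ! Suc s \<noteq> snd b' ! Suc t)
      \<or> (\<exists>s t. Suc s < length (snd b) \<and> Suc t < length (snd b') \<and> snd b ! Suc s = snd b' ! Suc t \<and> snd b ! s \<noteq> snd b' ! t)"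
      (is "?O \<or> ?I")
    proof (rule ccontr)
      assume n: "\<not> (?O \<or> ?I)"
      have o: "snd b ! Suc s = snd b' ! Suc t"
        if "Suc s < length (snd b)" "Suc t < length (snd b')" "snd b ! s = snd b' ! t" for s t
        using n that by blast
      have i: "snd b ! s = snd b' ! t"
        if "Suc s < length (snd b)" "Suc t < length (snd b')" "snd b ! Suc s = snd b' ! Suc t" for s t
        using n that by blast
      show False
      proof (cases "t \<le> s")
        case True
        show False using non_overlapping_alignment[OF no st(3,1,2) True o i] ne by blast
      next
        case False
        have "snd b' = snd b"
          by (rule non_overlapping_alignment[OF non_overlapping_sym[OF no] st(3)[symmetric] st(2,1)])
            (use False o[symmetric] i[symmetric] in simp_all)
        then show False using ne by simp
      qed
    qed
    then show ?thesis
    proof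
      assume ?O
      then obtain s t where st: "Suc s < length (snd b)" "Suc t < length (snd b')"
        "snd b ! s = snd b' ! t" "snd b ! Suc s \<noteq> snd b' ! Suc t" by blast
      have ne': "snd b ! Suc s \<noteq> snd b ! s" "snd b' ! Suc t \<noteq> snd b' ! t"
        using blocksD(2) b(1,2) st(1,2) by (simp_all add: nth_eq_iff_index_eq)
      \<comment> \<open>The edge of \<open>b'\<close> after the common label starts at the vertex
        being moved. Its label differs from both changed labels, so it still shows the old
        value.\<close>
      have "real d * (\<Sum>y\<in>S. (cmod (u y))\<^sup>2) \<le> nrm u"
      proof (rule invariant_spread[OF b(1) u st(1), where g = "\<lambda>y. fst (snd (y (snd b' ! Suc t)))"])
        fix y c assume "y \<in> S"
        then have y: "good b y" "good b' y" by (simp_all add: S_def)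
        show "(\<lambda>y. fst (snd (y (snd b' ! Suc t)))) (y(snd b ! s := (fst (y (snd b ! s)), fst (snd (y (snd b ! s))), c),
          snd b ! Suc s := (fst (y (snd b ! Suc s)), c, snd (snd (y (snd b ! Suc s)))))) = snd (snd (y (snd b ! s)))"
          using meet[OF y(1) st(1)] meet[OF y(2) st(2)] st ne' by simp
      qed (auto simp: S_def)
      moreover
      have "real d * (\<Sum>y\<in>S. (cmod (v y))\<^sup>2) \<le> nrm v"
      proof (rule invariant_spread[OF b(2) v st(2), where g = "\<lambda>y. fst (snd (y (snd b ! Suc s)))"])
        fix y c assume "y \<in> S"
        then have y: "good b y" "good b' y" by (simp_all add: S_def)
        show "(\<lambda>y. fst (snd (y (snd b ! Suc s)))) (y(snd b' ! t := (fst (y (snd b' ! t)), fst (snd (y (snd b' ! t))), c),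
          snd b' ! Suc t := (fst (y (snd b' ! Suc t)), c, snd (snd (y (snd b' ! Suc t)))))) = snd (snd (y (snd b' ! t)))"
          using meet[OF y(1) st(1)] meet[OF y(2) st(2)] st ne' by simp
      qed (auto simp: S_def)
      ultimately show ?thesis ..
    next
      assume ?I
      then obtain s t where st: "Suc s < length (snd b)" "Suc t < length (snd b')"
        "snd b ! Suc s = snd b' ! Suc t" "snd b ! s \<noteq> snd b' ! t" by blast
      have ne': "snd b ! Suc s \<noteq> snd b ! s" "snd b' ! Suc t \<noteq> snd b' ! t"
        using blocksD(2) b(1,2) st(1,2) by (simp_all add: nth_eq_iff_index_eq)
      \<comment> \<open>The mirror image: the edge of \<open>b'\<close> before the common label ends
        at the vertex being moved and is itself left alone.\<close>
      have "real d * (\<Sum>y\<in>S. (cmod (u y))\<^sup>2) \<le> nrm u"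
      proof (rule invariant_spread[OF b(1) u st(1), where g = "\<lambda>y. snd (snd (y (snd b' ! t)))"])
        fix y c assume "y \<in> S"
        then have y: "good b y" "good b' y" by (simp_all add: S_def)
        show "(\<lambda>y. snd (snd (y (snd b' ! t)))) (y(snd b ! s := (fst (y (snd b ! s)), fst (snd (y (snd b ! s))), c),
          snd b ! Suc s := (fst (y (snd b ! Suc s)), c, snd (snd (y (snd b ! Suc s)))))) = snd (snd (y (snd b ! s)))"
          using meet[OF y(1) st(1)] meet[OF y(2) st(2)] st ne' by simp
      qed (auto simp: S_def)
      moreover
      have "real d * (\<Sum>y\<in>S. (cmod (v y))\<^sup>2) \<le> nrm v"
      proof (rule invariant_spread[OF b(2) v st(2), where g = "\<lambda>y. snd (snd (y (snd b ! s)))"])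
        fix y c assume "y \<in> S"
        then have y: "good b y" "good b' y" by (simp_all add: S_def)
        show "(\<lambda>y. snd (snd (y (snd b ! s)))) (y(snd b' ! t := (fst (y (snd b' ! t)), fst (snd (y (snd b' ! t))), c),
          snd b' ! Suc t := (fst (y (snd b' ! Suc t)), c, snd (snd (y (snd b' ! Suc t)))))) = snd (snd (y (snd b' ! t)))"
          using meet[OF y(1) st(1)] meet[OF y(2) st(2)] st ne' by simp
      qed (auto simp: S_def)
      ultimately show ?thesis ..
    qed
  qed (simp add: nrm_nonneg)
  have "ip u v = (\<Sum>y\<in>S. cnj (u y) * v y)"
    unfolding ip_def using invariantD(1)[OF u] invariantD(1)[OF v]
    by (intro sum.mono_neutral_right finite_Y SY) (auto simp: S_def)
  then have "cmod (ip u v) \<le> (\<Sum>y\<in>S. cmod (u y) * cmod (v y))"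
    by (simp add: sum_norm_le norm_mult)
  then have "2 * cmod (ip u v) \<le> (\<Sum>y\<in>S. 2 * (cmod (u y) * cmod (v y)))"
    by (simp add: sum_distrib_left[symmetric])
  also have "\<dots> \<le> (\<Sum>y\<in>S. (cmod (u y))\<^sup>2 + (cmod (v y))\<^sup>2)"
    by (intro sum_mono) (use sum_squares_bound in \<open>simp add: mult.assoc\<close>)
  finally have "real d * (2 * cmod (ip u v)) \<le> real d * ((\<Sum>y\<in>S. (cmod (u y))\<^sup>2) + (\<Sum>y\<in>S. (cmod (v y))\<^sup>2))"
    by (intro mult_left_mono) (auto simp: sum.distrib)
  then show ?thesis using key by (simp add: distrib_left mult_ac)
qed

end

section \<open>From cochains to functions of blocks and labellings\<close>

definition labels :: "block list \<Rightarrow> nat set" where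
  "labels \<beta> = (\<Union>b\<in>set \<beta>. set (snd b))"

lemma labels_simps: "labels [] = {}" "labels (b # \<beta>) = set (snd b) \<union> labels \<beta>"
  "labels (\<beta> @ \<gamma>) = labels \<beta> \<union> labels \<gamma>"
  by (auto simp: labels_def)

lemma labels_del: "i < length \<beta> \<Longrightarrow> labels \<beta> = set (snd (\<beta> ! i)) \<union> labels (del i \<beta>)"
  unfolding labels_def by (subst set_del) auto

lemma map_del: "map f (del i xs) = del i (map f xs)"
  by (simp add: del_def take_map drop_map)

text \<open>Applied to the labels outside all blocks, this is the monomial of the coefficient; the
  order of the labels is lost.\<close>

definition restmon :: "(nat \<Rightarrow> 'a) \<Rightarrow> nat set \<Rightarrow> 'a \<Rightarrow>\<^sub>0 nat" where
  "restmon y S = (\<Sum>l\<in>S. single (y l) 1)"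

lemma restmon_remove: "finite R \<Longrightarrow> l \<in> R \<Longrightarrow> restmon y R = single (y l) 1 + restmon y (R - {l})"
  unfolding restmon_def by (rule sum.remove)

lemma lookup_restmon: "finite R \<Longrightarrow> lookup (restmon y R) v = card {l \<in> R. y l = v}"
  unfolding restmon_def lookup_sum
  by (simp add: lookup_single when_def sum.If_cases Int_def conj_commute)

text \<open>A variable that occurs c times in a monomial contributes a factor c to the quotient of
  the factorials, and exactly c labels carry it. So each of these labels accounts for one copy of
  the smaller coefficient.\<close>

lemma dcoeff_var_mult:
  assumes R: "finite R"
  shows "dcoeff (single (single v 1) 1 * g) (restmon y R) =
    (\<Sum>l\<in>R. if y l = v then dcoeff g (restmon y (R - {l})) else 0)"
proof (cases "\<exists>l\<in>R. y l = v")
  case False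
  then have "{l \<in> R. y l = v} = {}" by auto
  then have "lookup (restmon y R) v = 0" unfolding lookup_restmon[OF R] by (simp only: card.empty)
  moreover have "lookup (single v 1 + \<kappa>) v \<noteq> (0::nat)" for \<kappa> :: "'a \<Rightarrow>\<^sub>0 nat"
    by (simp add: lookup_add)
  ultimately have "restmon y R \<noteq> single v 1 + \<kappa>" for \<kappa> by metis
  then have "lookup (single (single v 1) 1 * g) (restmon y R) = 0" by (rule lookup_single_mult_eq_0)
  then show ?thesis using False by (auto simp: dcoeff_def)
next
  case True
  then obtain l where l: "l \<in> R" "y l = v" by blast
  define \<kappa> where "\<kappa> = restmon y (R - {l})"
  have eq: "restmon y R = single v 1 + \<kappa>" using restmon_remove[OF R l(1), of y] l(2) by (simp add: \<kappa>_def)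
  have k: "restmon y (R - {i}) = \<kappa>" if "i \<in> R" "y i = v" for i
    using restmon_remove[OF R that(1), of y] that(2) eq by simp
  have "Suc (lookup \<kappa> v) = lookup (restmon y R) v" by (simp add: eq lookup_add)
  then have c: "card {l \<in> R. y l = v} = Suc (lookup \<kappa> v)" using lookup_restmon[OF R] by metis
  have "(\<Sum>l\<in>R. if y l = v then dcoeff g (restmon y (R - {l})) else 0) = (\<Sum>l\<in>R. if y l = v then dcoeff g \<kappa> else 0)"
    using k by (intro sum.cong refl) auto
  also have "\<dots> = (\<Sum>l\<in>{l \<in> R. y l = v}. dcoeff g \<kappa>)"
    by (rule sum.inter_filter[OF R, symmetric])
  also have "\<dots> = of_nat (Suc (lookup \<kappa> v)) * dcoeff g \<kappa>" by (simp only: sum_constant c)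
  also have "\<dots> = dcoeff (single (single v 1) 1 * g) (restmon y R)"
    by (simp only: dcoeff_def eq lookup_single_mult monfact_add_single mult_1_left mult.left_commute)
  finally show ?thesis ..
qed

lemma dlists_Suc:
  "{L. distinct L \<and> set L \<subseteq> R \<and> length L = Suc k} =
    (\<lambda>(l, L). l # L) ` (SIGMA l:R. {L. distinct L \<and> set L \<subseteq> R - {l} \<and> length L = k})"
proof (intro equalityI subsetI)
  fix L assume "L \<in> {L. distinct L \<and> set L \<subseteq> R \<and> length L = Suc k}"
  then show "L \<in> (\<lambda>(l, L). l # L) ` (SIGMA l:R. {L. distinct L \<and> set L \<subseteq> R - {l} \<and> length L = k})"
    by (cases L) (auto intro!: rev_image_eqI)
qed auto

lemma finite_dlists: "finite R \<Longrightarrow> finite {L. distinct L \<and> set L \<subseteq> R \<and> length L = k}"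
  by (rule finite_subset[OF _ finite_lists_length_eq[of R k]]) auto

text \<open>Each factor of the path picks its own label, in order and without repetition; this is
  where lists of distinct labels, hence blocks, come from.\<close>

lemma dcoeff_mon_mult:
  assumes "finite R"
  shows "dcoeff (single (mon_of es) 1 * g) (restmon y R) =
    (\<Sum>L | distinct L \<and> set L \<subseteq> R \<and> length L = length es.
      if map y L = es then dcoeff g (restmon y (R - set L)) else 0)"
  using assms
proof (induction es arbitrary: R)
  case Nil
  have "{L. distinct L \<and> set L \<subseteq> R \<and> length L = 0} = {[]}" by auto
  then show ?case by (simp add: mon_simps)
next
  case (Cons v es)
  let ?D = "\<lambda>R. {L. distinct L \<and> set L \<subseteq> R \<and> length L = length es}"
  have "single (mon_of (v # es)) 1 * g = single (single v 1) 1 * (single (mon_of es) 1 * g)"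
    by (simp add: mult.assoc[symmetric] mult_single mon_simps)
  then have "dcoeff (single (mon_of (v # es)) 1 * g) (restmon y R) =
    (\<Sum>l\<in>R. if y l = v then dcoeff (single (mon_of es) 1 * g) (restmon y (R - {l})) else 0)"
    using dcoeff_var_mult[OF Cons.prems] by simp
  also have "\<dots> = (\<Sum>l\<in>R. \<Sum>L\<in>?D (R - {l}). if y l = v \<and> map y L = es then dcoeff g (restmon y (R - {l} - set L)) else 0)"
    using Cons.prems by (intro sum.cong refl) (simp add: Cons.IH)
  also have "\<dots> = (\<Sum>(l, L)\<in>(SIGMA l:R. ?D (R - {l})).
      if y l = v \<and> map y L = es then dcoeff g (restmon y (R - {l} - set L)) else 0)"
    using Cons.prems by (intro sum.Sigma ballI finite_dlists) auto
  also have "\<dots> = (\<Sum>L\<in>(\<lambda>(l, L). l # L) ` (SIGMA l:R. ?D (R - {l})).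
      if map y L = v # es then dcoeff g (restmon y (R - set L)) else 0)"
  proof -
    have inj: "inj_on (\<lambda>(l, L). l # L) S" for S :: "(nat \<times> nat list) set" by (auto simp: inj_on_def)
    have "R - set (l # L) = R - {l} - set L" for l L by auto
    then show ?thesis
      unfolding sum.reindex[OF inj] o_def case_prod_beta by (simp only: list.map list.inject)
  qed
  finally show ?case unfolding length_Cons dlists_Suc .
qed

lemma dcoeff_sign: "dcoeff ((- 1) ^ i * g) \<mu> = (- 1) ^ i * dcoeff g \<mu>"
  by (cases "even i") (simp_all add: dcoeff_simps)

definition word_relations :: "nat \<Rightarrow> (nat \<Rightarrow> nat list) \<Rightarrow> nat \<Rightarrow> ncpoly" where
  "word_relations p w = (\<lambda>j. if j < p then single (w j) 1 else 0)"

lemma entry_word_relations: "j < p \<Longrightarrow> entry (word_relations p w) d (j, a, b) = word_poly d (w j) a b"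
  by (simp add: entry_def word_relations_def)

context words
begin

fun valid :: "block list \<Rightarrow> bool" where
  "valid [] \<longleftrightarrow> True"
| "valid (b # \<beta>) \<longleftrightarrow> b \<in> blocks \<and> set (snd b) \<inter> labels \<beta> = {} \<and> valid \<beta>"

text \<open>The passage from cochains to functions of labellings. Within a block only the ends of
  the path matter. The default 0 for overlapping blocks, and for labellings that do not spell the
  words, lets sums run over all blocks.\<close>

definition Z :: "(idx list \<Rightarrow> coord_poly) \<Rightarrow> block list \<Rightarrow> (nat \<Rightarrow> idx) \<Rightarrow> complex" where
  "Z F \<beta> y = (if valid \<beta> \<and> (\<forall>b\<in>set \<beta>. good b y)
     then dcoeff (F (map (ends y) \<beta>)) (restmon y ({..<q} - labels \<beta>)) else 0)"

lemma valid_blocks: "valid \<beta> \<Longrightarrow> set \<beta> \<subseteq> blocks"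
  by (induction \<beta>) auto

lemma valid_swap: "valid (u @ x # z # v) \<longleftrightarrow> valid (u @ z # x # v)"
  by (induction u) (auto simp: labels_simps)

lemma valid_del: "i < length \<beta> \<Longrightarrow> valid \<beta> \<longleftrightarrow> valid (\<beta> ! i # del i \<beta>)"
proof (induction i arbitrary: \<beta>)
  case 0
  then show ?case by (cases \<beta>) (auto simp: del_Cons)
next
  case (Suc i)
  then obtain b \<gamma> where \<beta>: "\<beta> = b # \<gamma>" by (cases \<beta>) auto
  with Suc have i: "i < length \<gamma>" by simp
  show ?case
    using Suc.IH[OF i] labels_del[OF i] by (auto simp: \<beta> del_Cons labels_simps)
qed

lemma alternating_Z: "alternating F \<Longrightarrow> alternating (\<lambda>\<beta>. Z F \<beta> y)"
  unfolding alternating_def[of "\<lambda>\<beta>. Z F \<beta> y"]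
proof (intro allI)
  fix u x z v assume F: "alternating F"
  have 1: "labels (u @ x # z # v) = labels (u @ z # x # v)" by (auto simp: labels_simps)
  have 2: "set (u @ x # z # v) = set (u @ z # x # v)" by auto
  have 3: "F (map (ends y) (u @ x # z # v)) = - F (map (ends y) (u @ z # x # v))"
    using alternatingD[OF F, of "map (ends y) u" "ends y x" "ends y z" "map (ends y) v"] by simp
  show "Z F (u @ x # z # v) y = - Z F (u @ z # x # v) y"
    unfolding Z_def valid_swap[of u x z v] 1 2 3 dcoeff_simps by simp
qed

lemma Z_add: "Z (F + G) \<beta> y = Z F \<beta> y + Z G \<beta> y"
  by (simp add: Z_def dcoeff_simps)

lemma Z_invalid: "\<not> valid \<beta> \<Longrightarrow> Z F \<beta> y = 0"
  by (simp add: Z_def)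

lemma ends_in_idxs:
  assumes "b \<in> blocks" "y \<in> Y"
  shows "ends y b \<in> idxs p d"
proof -
  have "hd (snd b) \<in> {..<q}" "last (snd b) \<in> {..<q}"
    using blocksD[OF assms(1)] hd_in_set last_in_set by blast+
  then have "y (hd (snd b)) \<in> idxs n d" "y (last (snd b)) \<in> idxs n d" using assms(2) by (auto simp: Y_def)
  then show ?thesis using blocksD(1)[OF assms(1)] by (auto simp: ends_def idxs_def)
qed

text \<open>Every path in an entry of a relation takes up a list of free labels. Multiplying by the
  entries and summing over the indices therefore puts one more block in front of \<beta> in all
  possible ways, and blocks that meet \<beta> contribute 0.\<close>

lemma Z_kos_d:
  assumes \<beta>: "valid \<beta>" and y: "y \<in> Y"
  shows "Z (kos_d p d (word_relations p w) F) \<beta> y = (\<Sum>b\<in>blocks. Z F (b # \<beta>) y)"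
proof (cases "\<forall>b\<in>set \<beta>. good b y")
  case False
  then have "Z F (b # \<beta>) y = 0" "Z G \<beta> y = 0" for b G by (auto simp: Z_def)
  then show ?thesis by (simp del: valid.simps)
next
  case True
  define R where "R = {..<q} - labels \<beta>"
  have R: "finite R" by (simp add: R_def)
  let ?as = "map (ends y) \<beta>"
  define G where "G j s t L = dcoeff (F ((j, s, t) # ?as)) (restmon y (R - set L))" for j s t L
  let ?D = "\<lambda>R j. {L. distinct L \<and> set L \<subseteq> R \<and> length L = length (w j)}"
  have one: "dcoeff (word_poly d (w j) s t * F ((j, s, t) # ?as)) (restmon y R) =
      (\<Sum>L\<in>?D R j. if map y L \<in> paths d (w j) s t then G j s t L else 0)" for j s t
  proof -
    have "dcoeff (word_poly d (w j) s t * F ((j, s, t) # ?as)) (restmon y R) =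
        (\<Sum>es\<in>paths d (w j) s t. \<Sum>L\<in>?D R j. if map y L = es then G j s t L else 0)"
      unfolding word_poly_def sum_distrib_right dcoeff_simps G_def
      by (intro sum.cong refl) (simp add: dcoeff_mon_mult[OF R] path_length)
    also have "\<dots> = (\<Sum>L\<in>?D R j. \<Sum>es\<in>paths d (w j) s t. if map y L = es then G j s t L else 0)"
      by (rule sum.swap)
    finally show ?thesis by (simp add: finite_paths)
  qed
  \<comment> \<open>A labelled list is a path for at most one pair of ends, so the sum over the ends
    has at most one term.\<close>
  have two: "(\<Sum>s<d. \<Sum>t<d. if map y L \<in> paths d (w j) s t then G j s t L else 0) = Z F ((j, L) # \<beta>) y"
    if j: "j < p" and L: "L \<in> ?D R j" for j L
  proof -
    have b: "(j, L) \<in> blocks" using L j by (auto simp: blocks_def R_def)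
    have v: "valid ((j, L) # \<beta>)" using b \<beta> L by (auto simp: R_def)
    have S: "{..<q} - labels ((j, L) # \<beta>) = R - set L" by (auto simp: R_def labels_simps)
    show ?thesis
    proof (cases "good (j, L) y")
      case False
      then show ?thesis by (auto simp: Z_def good_def)
    next
      case g: True
      then obtain s0 t0 where st: "map y L \<in> paths d (w j) s0 t0" by (auto simp: good_def)
      have e: "ends y (j, L) = (j, s0, t0)" using good_ends[OF b] st by simp
      have lt: "s0 < d" "t0 < d" using ends_in_idxs[OF b y] e by (auto simp: idxs_def)
      have iff: "map y L \<in> paths d (w j) s t \<longleftrightarrow> s = s0 \<and> t = t0" for s t
        using good_ends[OF b, of y s t] e st by auto
      have "(\<Sum>s<d. \<Sum>t<d. if map y L \<in> paths d (w j) s t then G j s t L else 0) =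
          (\<Sum>s<d. \<Sum>t<d. if t = t0 then if s = s0 then G j s0 t0 L else 0 else 0)"
        unfolding iff by (intro sum.cong refl) auto
      also have "\<dots> = G j s0 t0 L" using lt by simp
      also have "\<dots> = Z F ((j, L) # \<beta>) y" using v g True e by (simp add: Z_def S G_def)
      finally show ?thesis .
    qed
  qed
  have "Z (kos_d p d (word_relations p w) F) \<beta> y =
      dcoeff (kos_d p d (word_relations p w) F ?as) (restmon y R)"
    using \<beta> True by (simp add: Z_def R_def)
  also have "\<dots> = (\<Sum>(j, s, t)\<in>idxs p d. dcoeff (word_poly d (w j) s t * F ((j, s, t) # ?as)) (restmon y R))"
    unfolding kos_d_def dcoeff_simps
    by (intro sum.cong refl) (auto simp: entry_word_relations idxs_def)
  also have "\<dots> = (\<Sum>j<p. \<Sum>s<d. \<Sum>t<d. dcoeff (word_poly d (w j) s t * F ((j, s, t) # ?as)) (restmon y R))"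
    unfolding idxs_def by (simp add: sum.cartesian_product)
  also have "\<dots> = (\<Sum>j<p. \<Sum>s<d. \<Sum>L\<in>?D R j. \<Sum>t<d. if map y L \<in> paths d (w j) s t then G j s t L else 0)"
    unfolding one by (intro sum.cong refl) (rule sum.swap)
  also have "\<dots> = (\<Sum>j<p. \<Sum>L\<in>?D R j. \<Sum>s<d. \<Sum>t<d. if map y L \<in> paths d (w j) s t then G j s t L else 0)"
    by (intro sum.cong refl) (rule sum.swap)
  also have "\<dots> = (\<Sum>j<p. \<Sum>L\<in>?D R j. Z F ((j, L) # \<beta>) y)"
    by (intro sum.cong refl two) auto
  also have "\<dots> = (\<Sum>j<p. \<Sum>L\<in>?D {..<q} j. Z F ((j, L) # \<beta>) y)"
    by (intro sum.cong refl sum.mono_neutral_left finite_dlists) (auto simp: R_def Z_def)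
  also have "\<dots> = (\<Sum>b\<in>blocks. Z F (b # \<beta>) y)"
    unfolding blocks_def by (subst sum.Sigma) (auto simp: finite_dlists)
  finally show ?thesis .
qed

text \<open>Removing a block returns its labels to the coefficient, where the new edges
  \<open>es\<close> appear as factors. The other blocks are disjoint from it and do not notice the
  change.\<close>

lemma Z_upd:
  assumes \<beta>: "valid \<beta>" and i: "i < length \<beta>" and es: "es \<in> cls (\<beta> ! i) y"
  shows "Z F (del i \<beta>) (upd y (snd (\<beta> ! i)) es) = (if \<forall>b\<in>set (del i \<beta>). good b y
    then dcoeff (F (del i (map (ends y) \<beta>))) (restmon y ({..<q} - labels \<beta>) + mon_of es) else 0)"
proof -
  let ?b = "\<beta> ! i"
  let ?y = "upd y (snd ?b) es"
  have v: "valid (?b # del i \<beta>)" using valid_del[OF i] \<beta> by blast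
  then have b: "?b \<in> blocks" and disj: "set (snd ?b) \<inter> labels (del i \<beta>) = {}" by auto
  have same: "?y l = y l" if "l \<in> labels (del i \<beta>)" for l
    using that disj by (intro upd_notin) auto
  have c: "map ?y (snd c) = map y (snd c) \<and> ends ?y c = ends y c" if "c \<in> set (del i \<beta>)" for c
  proof -
    have sub: "set (snd c) \<subseteq> labels (del i \<beta>)" using that by (auto simp: labels_def)
    have "c \<in> blocks" using valid_blocks[of "?b # del i \<beta>"] v that by auto
    then have "hd (snd c) \<in> set (snd c)" "last (snd c) \<in> set (snd c)" using blocksD(6) by auto
    then show ?thesis using same sub by (auto simp: ends_def)
  qed
  then have g: "(\<forall>c\<in>set (del i \<beta>). good c ?y) \<longleftrightarrow> (\<forall>c\<in>set (del i \<beta>). good c y)"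
    unfolding good_def by metis
  have m: "map (ends ?y) (del i \<beta>) = del i (map (ends y) \<beta>)"
    unfolding map_del[symmetric] using c by simp
  have S: "{..<q} - labels (del i \<beta>) = ({..<q} - labels \<beta>) \<union> set (snd ?b)"
    using labels_del[OF i] disj blocksD(3)[OF b] by auto
  have "restmon ?y ({..<q} - labels (del i \<beta>)) = restmon ?y ({..<q} - labels \<beta>) + restmon ?y (set (snd ?b))"
    unfolding S restmon_def using labels_del[OF i] by (intro sum.union_disjoint) auto
  also have "restmon ?y ({..<q} - labels \<beta>) = restmon y ({..<q} - labels \<beta>)"
    unfolding restmon_def using labels_del[OF i] by (intro sum.cong refl) (simp add: upd_notin)
  also have "restmon ?y (set (snd ?b)) = mon_of (map ?y (snd ?b))"
    using sum_list_distinct_conv_sum_set[OF blocksD(2)[OF b], of "\<lambda>l. single (?y l) (1::nat)"]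
    by (simp add: restmon_def mon_of_def o_def)
  also have "map ?y (snd ?b) = es" using map_upd blocksD(2)[OF b] cls_length[OF b es] by blast
  finally show ?thesis using g m v by (simp add: Z_def)
qed

lemma dcoeff_contract:
  "dcoeff (contract d w (j, s, t) g) \<mu> =
    1 / of_nat (card (paths d (w j) s t)) * (\<Sum>es\<in>paths d (w j) s t. dcoeff g (\<mu> + mon_of es))"
  by (simp add: contract_def dcoeff_simps dcoeff_mdiff)

text \<open>Differentiating along a path shifts the normalised coefficient by that path, which is
  also the effect of removing a block and relabelling its edges. The reciprocal of the number of
  paths in \<open>contract\<close> turns the sum into an average.\<close>

lemma Z_kos_h:
  assumes \<beta>: "valid \<beta>" and y: "y \<in> Y"
  shows "Z (kos_h p d w F) \<beta> y = (\<Sum>i<length \<beta>. (- 1) ^ i * avg (\<beta> ! i) (Z F (del i \<beta>)) y)"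
proof -
  let ?as = "map (ends y) \<beta>"
  let ?\<mu> = "restmon y ({..<q} - labels \<beta>)"
  have avg0: "avg (\<beta> ! i) (Z F (del i \<beta>)) y = (if \<forall>b\<in>set \<beta>. good b y
      then dcoeff (contract d w (?as ! i) (F (del i ?as))) ?\<mu> else 0)" if i: "i < length \<beta>" for i
  proof (cases "good (\<beta> ! i) y")
    case True
    have b: "\<beta> ! i \<in> blocks" using valid_blocks[OF \<beta>] i by auto
    have all: "(\<forall>b\<in>set (del i \<beta>). good b y) \<longleftrightarrow> (\<forall>b\<in>set \<beta>. good b y)"
      using True unfolding set_del[OF i] by auto
    obtain s t where e: "ends y (\<beta> ! i) = (fst (\<beta> ! i), s, t)" by (simp add: ends_def)
    then have cls: "cls (\<beta> ! i) y = paths d (w (fst (\<beta> ! i))) s t" using True by (simp add: cls_def)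
    show ?thesis
    proof (cases "\<forall>b\<in>set \<beta>. good b y")
      case True
      then show ?thesis
        unfolding avg_def using i
        by (simp add: Z_upd[OF \<beta> i] all cls e dcoeff_contract)
    next
      case False
      have "Z F (del i \<beta>) (upd y (snd (\<beta> ! i)) es) = 0" if "es \<in> cls (\<beta> ! i) y" for es
        unfolding Z_upd[OF \<beta> i that] all by (rule if_not_P[OF False])
      then show ?thesis unfolding avg_def if_not_P[OF False] by simp
    qed
  next
    case False
    then show ?thesis using i by (auto simp: avg_def cls_def)
  qed
  have sub: "set ?as \<subseteq> idxs p d" using valid_blocks[OF \<beta>] ends_in_idxs[OF _ y] by auto
  show ?thesis
  proof (cases "\<forall>b\<in>set \<beta>. good b y")
    case True
    then have "Z (kos_h p d w F) \<beta> y = dcoeff (skew (\<lambda>\<alpha> \<gamma>. contract d w \<alpha> (F \<gamma>)) ?as) ?\<mu>"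
      using \<beta> sub by (simp add: Z_def kos_h_def)
    also have "\<dots> = (\<Sum>i<length \<beta>. (- 1) ^ i * dcoeff (contract d w (?as ! i) (F (del i ?as))) ?\<mu>)"
      by (simp add: skew_eq_sum dcoeff_simps dcoeff_sign)
    finally show ?thesis using True by (simp add: avg0)
  next
    case False
    then have "Z (kos_h p d w F) \<beta> y = 0" by (auto simp: Z_def)
    then show ?thesis using avg0 False by simp
  qed
qed

text \<open>The path inside a block is seen only through its ends, and these are common to the whole
  class.\<close>

lemma invariant_Z:
  assumes b: "b \<in> set \<beta>"
  shows "invariant b (Z F \<beta>)"
  unfolding invariant_def
proof (intro ballI conjI impI)
  fix y assume "\<not> good b y"
  then show "Z F \<beta> y = 0" using b by (auto simp: Z_def)
next
  fix y es assume es: "es \<in> cls b y"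
  show "Z F \<beta> (upd y (snd b) es) = Z F \<beta> y"
  proof (cases "valid \<beta>")
    case True
    obtain i where i: "i < length \<beta>" "\<beta> ! i = b" using b by (metis in_set_conv_nth)
    let ?y = "upd y (snd b) es"
    have v: "valid (b # del i \<beta>)" using valid_del[OF i(1)] True i(2) by simp
    then have bb: "b \<in> blocks" and disj: "set (snd b) \<inter> labels (del i \<beta>) = {}" by auto
    have c: "good c ?y = good c y \<and> ends ?y c = ends y c" if "c \<in> set \<beta>" for c
    proof (cases "c = b")
      case True
      have "good b y" using es by (auto simp: cls_def split: if_splits)
      then show ?thesis using cls_upd[OF bb es] True by simp
    next
      case False
      then have "c \<in> set (del i \<beta>)" using that set_del[OF i(1)] i(2) by auto
      then have sub: "set (snd c) \<subseteq> labels (del i \<beta>)" by (auto simp: labels_def)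
      have same: "?y l = y l" if "l \<in> set (snd c)" for l
        using that disj sub by (intro upd_notin) auto
      have "c \<in> blocks" using valid_blocks[OF True] that by auto
      then have "hd (snd c) \<in> set (snd c)" "last (snd c) \<in> set (snd c)" using blocksD(6) by auto
      moreover have "map ?y (snd c) = map y (snd c)" using same by simp
      then have "good c ?y = good c y" unfolding good_def by metis
      ultimately show ?thesis using same by (simp add: ends_def)
    qed
    have m: "map (ends ?y) \<beta> = map (ends y) \<beta>" using c by simp
    have "set (snd b) \<subseteq> labels \<beta>" using b by (auto simp: labels_def)
    then have "restmon ?y ({..<q} - labels \<beta>) = restmon y ({..<q} - labels \<beta>)"
      unfolding restmon_def by (intro sum.cong refl arg_cong2[where f = single] upd_notin) auto
    moreover have "(\<forall>c\<in>set \<beta>. good c ?y) \<longleftrightarrow> (\<forall>c\<in>set \<beta>. good c y)" using c by blast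
    ultimately show ?thesis unfolding Z_def m by (simp only:)
  qed (simp add: Z_invalid)
qed

end

lemma paths_nonempty: "w \<noteq> [] \<Longrightarrow> t < d \<Longrightarrow> paths d w s t \<noteq> {}"
proof (induction w arbitrary: s)
  case (Cons i w)
  show ?case
  proof (cases "w = []")
    case True
    then show ?thesis using Cons.prems by (auto simp: paths_Cons paths_Nil)
  next
    case False
    then show ?thesis using Cons by (auto simp: paths_Cons)
  qed
qed simp

lemma ex_mon_of: "\<exists>vs. mon_of vs = \<mu>"
proof (induction "\<Sum>v\<in>keys \<mu>. lookup \<mu> v" arbitrary: \<mu> rule: less_induct)
  case less
  show ?case
  proof (cases "\<mu> = 0")
    case True
    then show ?thesis by (metis mon_simps(1))
  next
    case False
    then have "keys \<mu> \<noteq> {}" by simp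
    then obtain v where v: "v \<in> keys \<mu>" by blast
    then have pos: "lookup \<mu> v > 0" by (simp add: in_keys_iff)
    define \<nu> where "\<nu> = \<mu> - single v 1"
    have eq: "\<mu> = single v 1 + \<nu>"
      using pos by (intro poly_mapping_eqI) (auto simp: \<nu>_def lookup_add lookup_minus lookup_single when_def)
    have s: "(\<Sum>u\<in>keys \<mu>. lookup \<nu> u) = (\<Sum>u\<in>keys \<nu>. lookup \<nu> u)"
      using eq by (intro sum.mono_neutral_right) (auto simp: keys_add_nat in_keys_iff)
    have "(\<Sum>u\<in>keys \<mu>. lookup \<mu> u) = (\<Sum>u\<in>keys \<mu>. lookup (single v (1::nat)) u) + (\<Sum>u\<in>keys \<mu>. lookup \<nu> u)"
      unfolding sum.distrib[symmetric] by (simp add: eq lookup_add)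
    moreover have "(\<Sum>u\<in>keys \<mu>. lookup (single v (1::nat)) u) = 1"
      using v by (simp add: lookup_single when_def)
    ultimately obtain vs where "mon_of vs = \<nu>" using less[of \<nu>] s by auto
    then have "mon_of (v # vs) = \<mu>" using eq by (simp add: mon_simps)
    then show ?thesis by blast
  qed
qed

context words
begin

section \<open>Positivity of the Laplacian for the words\<close>

lemma avg_sum: "avg b (\<lambda>y. \<Sum>i\<in>I. v i y) y = (\<Sum>i\<in>I. avg b (v i) y)"
  unfolding avg_def sum_distrib_left[symmetric] by (subst sum.swap) simp

lemma avg_mult: "avg b (\<lambda>y. c * v y) y = c * avg b v y"
  unfolding avg_def sum_distrib_left[symmetric] by simp

lemma avg_cong:
  assumes "b \<in> blocks" "y \<in> Y" "\<And>z. z \<in> Y \<Longrightarrow> v z = v' z"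
  shows "avg b v y = avg b v' y"
  unfolding avg_def using upd_in_Y[OF assms(1,2)] assms(3) by (simp cong: sum.cong)

lemma ip_sum_right: "ip u (\<lambda>y. \<Sum>i\<in>I. v i y) = (\<Sum>i\<in>I. ip u (v i))"
  unfolding ip_def sum_distrib_left by (rule sum.swap)

lemma ip_add_right: "ip u (\<lambda>y. v y + v' y) = ip u v + ip u v'"
  unfolding ip_def by (simp add: distrib_left sum.distrib)

text \<open>In \<open>dh\<close> a block b is added and an old block contracted; \<open>hd\<close>
  does the same with the opposite sign. These terms cancel when b is disjoint from \<beta>. What
  remains is the contraction of the added block itself and, for b meeting \<beta>, the terms of
  \<open>hd\<close> in which b takes the place of an old block.\<close>

lemma Z_laplace:
  assumes F: "alternating F" and \<beta>: "valid \<beta>" and y: "y \<in> Y"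
  shows "Z (laplace p d w (word_relations p w) F) \<beta> y =
    (\<Sum>b\<in>{b \<in> blocks. valid (b # \<beta>)}. avg b (Z F \<beta>) y) +
    (\<Sum>i<length \<beta>. \<Sum>b\<in>{b \<in> blocks. \<not> valid (b # \<beta>)}. avg (\<beta> ! i) (Z F (\<beta>[i := b])) y)"
proof -
  let ?e = "word_relations p w"
  \<comment> \<open>The cross terms shared by \<open>dh\<close> and \<open>hd\<close>: the block b
    is put in front and the block at position i is contracted.\<close>
  define T where "T i b = (- 1) ^ i * avg (\<beta> ! i) (Z F (b # del i \<beta>)) y" for i b
  have T: "T i b = avg (\<beta> ! i) (Z F (\<beta>[i := b])) y" if i: "i < length \<beta>" for i b
  proof -
    have "Z F (b # del i \<beta>) z = (- 1) ^ i * Z F (\<beta>[i := b]) z" for z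
      by (rule alternating_del[OF alternating_Z[OF F] i])
    then have "Z F (b # del i \<beta>) = (\<lambda>z. (- 1) ^ i * Z F (\<beta>[i := b]) z)" by (rule ext)
    then have "T i b = ((- 1) ^ i * (- 1) ^ i) * avg (\<beta> ! i) (Z F (\<beta>[i := b])) y"
      unfolding T_def by (simp add: avg_mult)
    then show ?thesis by (simp flip: power_mult_distrib)
  qed
  \<comment> \<open>Contraction at position 0 undoes the insertion of b and leaves its average. All
    other positions are shifted by one, hence the minus sign.\<close>
  have h: "Z (kos_h p d w F) (b # \<beta>) y = (if valid (b # \<beta>) then avg b (Z F \<beta>) y - (\<Sum>i<length \<beta>. T i b) else 0)" for b
  proof (cases "valid (b # \<beta>)")
    case True
    show ?thesis
      unfolding Z_kos_h[OF True y] T_def using True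
      by (simp add: sum.lessThan_Suc_shift del_Cons sum_negf del: sum.lessThan_Suc valid.simps)
  qed (simp add: Z_invalid del: valid.simps)
  have d: "avg (\<beta> ! i) (Z (kos_d p d ?e F) (del i \<beta>)) y = (\<Sum>b\<in>blocks. avg (\<beta> ! i) (Z F (b # del i \<beta>)) y)"
    if i: "i < length \<beta>" for i
  proof -
    have "\<beta> ! i \<in> blocks" using valid_blocks[OF \<beta>] i by auto
    moreover have "valid (del i \<beta>)" using \<beta> valid_del[OF i] by simp
    ultimately show ?thesis unfolding avg_sum[symmetric] by (intro avg_cong y Z_kos_d)
  qed
  let ?V = "{b \<in> blocks. valid (b # \<beta>)}" and ?W = "{b \<in> blocks. \<not> valid (b # \<beta>)}"
  have split: "(\<Sum>b\<in>blocks. f b) = (\<Sum>b\<in>?V. f b) + (\<Sum>b\<in>?W. f b)" for f :: "block \<Rightarrow> complex"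
  proof -
    have "blocks = ?V \<union> ?W" by blast
    then show ?thesis using finite_blocks by (metis (no_types, lifting) disjoint_iff finite_Un mem_Collect_eq sum.union_disjoint)
  qed
  have "Z (kos_d p d ?e (kos_h p d w F)) \<beta> y = (\<Sum>b\<in>?V. avg b (Z F \<beta>) y - (\<Sum>i<length \<beta>. T i b))"
    unfolding Z_kos_d[OF \<beta> y] h by (rule sum.inter_filter[OF finite_blocks, symmetric])
  moreover have "Z (kos_h p d w (kos_d p d ?e F)) \<beta> y = (\<Sum>i<length \<beta>. (\<Sum>b\<in>?V. T i b) + (\<Sum>b\<in>?W. T i b))"
  proof -
    have "(- 1) ^ i * avg (\<beta> ! i) (Z (kos_d p d ?e F) (del i \<beta>)) y = (\<Sum>b\<in>blocks. T i b)"
      if "i \<in> {..<length \<beta>}" for i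
      using that unfolding T_def sum_distrib_left[symmetric] by (simp only: d lessThan_iff)
    then show ?thesis
      unfolding Z_kos_h[OF \<beta> y] split[symmetric] by (rule sum.cong[OF refl])
  qed
  moreover have "(\<Sum>b\<in>?V. \<Sum>i<length \<beta>. T i b) = (\<Sum>i<length \<beta>. \<Sum>b\<in>?V. T i b)" by (rule sum.swap)
  ultimately have "Z (laplace p d w ?e F) \<beta> y = (\<Sum>b\<in>?V. avg b (Z F \<beta>) y) + (\<Sum>i<length \<beta>. \<Sum>b\<in>?W. T i b)"
    unfolding laplace_def Z_add by (simp only: sum_subtractf sum.distrib) simp
  then show ?thesis using T by simp
qed

text \<open>The Laplacian is paired with \<open>Z F \<beta>\<close>. Added blocks contribute
  nonnegative terms; replacing a block by itself contributes the whole squared norm, once per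
  position; every other replacement is controlled by \<open>conflict_bound\<close>. Summation over
  all lists of k blocks gives d k S \<le> B k S, with S the total of the squared norms and B the
  number of blocks, so S = 0 once d exceeds B.\<close>

lemma Z_vanishes:
  assumes F: "alternating F" and L: "laplace p d w (word_relations p w) F = 0"
    and d: "card blocks < d" and \<beta>: "length \<beta> > 0" and y: "y \<in> Y"
  shows "Z F \<beta> y = 0"
proof -
  define k where "k = length \<beta>"
  define B where "B = card blocks"
  define lists where "lists = {\<beta>. set \<beta> \<subseteq> blocks \<and> length \<beta> = k}"
  define N where "N \<beta> = nrm (Z F \<beta>)" for \<beta>
  have fin: "finite lists" unfolding lists_def by (rule finite_lists_length_eq[OF finite_blocks])
  have N0: "N \<beta> \<ge> 0" for \<beta> by (simp add: N_def nrm_nonneg)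
  have main: "2 * real d * (real k * N \<beta>) \<le> (\<Sum>i<k. \<Sum>b\<in>blocks. N \<beta> + N (\<beta>[i := b]))" if \<beta>: "\<beta> \<in> lists" for \<beta>
  proof (cases "valid \<beta>")
    case True
    have len: "length \<beta> = k" using \<beta> by (simp add: lists_def)
    let ?V = "{b \<in> blocks. valid (b # \<beta>)}" and ?W = "{b \<in> blocks. \<not> valid (b # \<beta>)}"
    let ?u = "Z F \<beta>"
    have Zz: "Z 0 \<beta> y = 0" for y by (simp add: Z_def dcoeff_simps)
    have "0 = ip ?u (\<lambda>y. Z (laplace p d w (word_relations p w) F) \<beta> y)"
      by (simp add: L Zz ip_def)
    also have "\<dots> = ip ?u (\<lambda>y. (\<Sum>b\<in>?V. avg b ?u y) + (\<Sum>i<k. \<Sum>b\<in>?W. avg (\<beta> ! i) (Z F (\<beta>[i := b])) y))"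
      using Z_laplace[OF F True] len by (intro ip_cong) auto
    also have "\<dots> = (\<Sum>b\<in>?V. ip ?u (avg b ?u)) + (\<Sum>i<k. \<Sum>b\<in>?W. ip ?u (avg (\<beta> ! i) (Z F (\<beta>[i := b]))))"
      by (simp only: ip_add_right ip_sum_right)
    also have "(\<Sum>i<k. \<Sum>b\<in>?W. ip ?u (avg (\<beta> ! i) (Z F (\<beta>[i := b])))) = (\<Sum>i<k. \<Sum>b\<in>?W. ip ?u (Z F (\<beta>[i := b])))"
    proof (intro sum.cong refl ip_avg_invariant invariant_Z)
      fix i assume "i \<in> {..<k}"
      then show "\<beta> ! i \<in> set \<beta>" using len by simp
      then show "\<beta> ! i \<in> blocks" using \<beta> by (auto simp: lists_def)
    qed
    finally have "0 = Re (\<Sum>b\<in>?V. ip ?u (avg b ?u)) + Re (\<Sum>i<k. \<Sum>b\<in>?W. ip ?u (Z F (\<beta>[i := b])))"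
      by (metis plus_complex.sel(1) zero_complex.sel(1))
    moreover have "Re (\<Sum>b\<in>?V. ip ?u (avg b ?u)) \<ge> 0"
      unfolding Re_sum by (intro sum_nonneg ip_avg_nonneg) auto
    ultimately have le: "(\<Sum>i<k. \<Sum>b\<in>?W. Re (ip ?u (Z F (\<beta>[i := b])))) \<le> 0" by (simp add: Re_sum)
    have step: "2 * real d * N \<beta> \<le> 2 * real d * (\<Sum>b\<in>?W. Re (ip ?u (Z F (\<beta>[i := b])))) +
        (\<Sum>b\<in>blocks. N \<beta> + N (\<beta>[i := b]))" if i: "i < k" for i
    proof -
      have i': "i < length \<beta>" using i len by simp
      have bi: "\<beta> ! i \<in> blocks" using \<beta> i' by (auto simp: lists_def)
      \<comment> \<open>A block meets itself, so its replacement by itself is among the overlapping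
        ones; this is the diagonal term.\<close>
      then have W: "\<beta> ! i \<in> ?W" using blocksD(6)[OF bi] labels_del[OF i'] by auto
      have fW: "finite ?W" using finite_blocks by simp
      have each: "- (N \<beta> + N (\<beta>[i := b])) \<le> 2 * real d * Re (ip ?u (Z F (\<beta>[i := b])))"
        if b: "b \<in> ?W - {\<beta> ! i}" for b
      proof (cases "valid (\<beta>[i := b])")
        case v: True
        have il: "i < length (\<beta>[i := b])" using i' by simp
        \<comment> \<open>A valid replacement avoids all the other blocks, so its overlap with
          \<beta> lies in the block that it replaces.\<close>
        have "valid (b # del i \<beta>)" using valid_del[OF il] v i' by (simp add: del_def)
        then have "set (snd b) \<inter> labels (del i \<beta>) = {}" by simp
        moreover have "set (snd b) \<inter> labels \<beta> \<noteq> {}" using b True by auto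
        ultimately have "set (snd (\<beta> ! i)) \<inter> set (snd b) \<noteq> {}" using labels_del[OF i'] by auto
        then have "2 * real d * cmod (ip ?u (Z F (\<beta>[i := b]))) \<le> N \<beta> + N (\<beta>[i := b])"
          unfolding N_def using b bi i'
          by (intro conflict_bound[of "\<beta> ! i" b] invariant_Z) (auto simp: set_update_memI)
        moreover have "- (2 * real d * cmod z) \<le> 2 * real d * Re z" for z
          using abs_Re_le_cmod[of z] mult_left_mono[of "- cmod z" "Re z" "2 * real d"] by simp
        ultimately show ?thesis by (meson neg_le_iff_le order_trans)
      next
        case False
        then have "Z F (\<beta>[i := b]) = (\<lambda>y. 0)" by (intro ext Z_invalid)
        then show ?thesis using N0[of \<beta>] N0[of "\<beta>[i := b]"] by (simp add: ip_def)
      qed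
      have "(\<Sum>b\<in>?W - {\<beta> ! i}. - (N \<beta> + N (\<beta>[i := b]))) \<le> (\<Sum>b\<in>?W - {\<beta> ! i}. 2 * real d * Re (ip ?u (Z F (\<beta>[i := b]))))"
        by (intro sum_mono each)
      moreover have "(\<Sum>b\<in>?W - {\<beta> ! i}. N \<beta> + N (\<beta>[i := b])) \<le> (\<Sum>b\<in>blocks. N \<beta> + N (\<beta>[i := b]))"
        using N0 finite_blocks by (intro sum_mono2) (auto intro: add_nonneg_nonneg)
      moreover have "(\<Sum>b\<in>?W. 2 * real d * Re (ip ?u (Z F (\<beta>[i := b])))) =
          2 * real d * N \<beta> + (\<Sum>b\<in>?W - {\<beta> ! i}. 2 * real d * Re (ip ?u (Z F (\<beta>[i := b]))))"
        by (subst sum.remove[OF fW W]) (simp add: ip_self N_def)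
      ultimately show ?thesis unfolding sum_distrib_left sum_negf by linarith
    qed
    have "2 * real d * (real k * N \<beta>) = (\<Sum>i<k. 2 * real d * N \<beta>)" by simp
    also have "\<dots> \<le> (\<Sum>i<k. 2 * real d * (\<Sum>b\<in>?W. Re (ip ?u (Z F (\<beta>[i := b])))) + (\<Sum>b\<in>blocks. N \<beta> + N (\<beta>[i := b])))"
      by (intro sum_mono step) auto
    also have "\<dots> = 2 * real d * (\<Sum>i<k. \<Sum>b\<in>?W. Re (ip ?u (Z F (\<beta>[i := b])))) + (\<Sum>i<k. \<Sum>b\<in>blocks. N \<beta> + N (\<beta>[i := b]))"
      by (simp only: sum.distrib sum_distrib_left)
    also have "\<dots> \<le> (\<Sum>i<k. \<Sum>b\<in>blocks. N \<beta> + N (\<beta>[i := b]))"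
      using le by (simp add: mult_nonneg_nonpos)
    finally show ?thesis .
  next
    case False
    then have "N \<beta> = 0" by (simp add: N_def nrm_def Z_invalid)
    then show ?thesis using N0 by (simp add: sum_nonneg)
  qed
  define S where "S = (\<Sum>\<beta>\<in>lists. N \<beta>)"
  have swap: "(\<Sum>\<beta>\<in>lists. \<Sum>b\<in>blocks. N (\<beta>[i := b])) \<le> real B * S" if i: "i < k" for i
  proof -
    \<comment> \<open>Remembering the replaced block makes the replacement an involution, so each
      list is reached at most once per block.\<close>
    let ?h = "\<lambda>(\<beta>, b). (\<beta>[i := b], \<beta> ! i)"
    have len: "i < length \<beta>" if "\<beta> \<in> lists" for \<beta> using i that by (simp add: lists_def)
    have inj: "inj_on ?h (lists \<times> blocks)"
      by (rule inj_on_inverseI[where g = ?h]) (use len in auto)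
    have sub: "?h ` (lists \<times> blocks) \<subseteq> lists \<times> blocks"
    proof
      fix z assume "z \<in> ?h ` (lists \<times> blocks)"
      then obtain \<beta> b where z: "z = (\<beta>[i := b], \<beta> ! i)" and a: "\<beta> \<in> lists" "b \<in> blocks" by auto
      have "set (\<beta>[i := b]) \<subseteq> blocks"
        using set_update_subset_insert[of \<beta> i b] a by (auto simp: lists_def)
      moreover have "\<beta> ! i \<in> set \<beta>" using len[OF a(1)] by simp
      ultimately show "z \<in> lists \<times> blocks" using a z by (auto simp: lists_def)
    qed
    have "(\<Sum>\<beta>\<in>lists. \<Sum>b\<in>blocks. N (\<beta>[i := b])) = (\<Sum>z\<in>lists \<times> blocks. N (fst (?h z)))"
      by (simp add: sum.cartesian_product case_prod_beta)
    also have "\<dots> = (\<Sum>z\<in>?h ` (lists \<times> blocks). N (fst z))" by (simp only: sum.reindex[OF inj] o_def)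
    also have "\<dots> \<le> (\<Sum>z\<in>lists \<times> blocks. N (fst z))"
      using N0 fin finite_blocks by (intro sum_mono2 sub) auto
    also have "\<dots> = (\<Sum>\<beta>\<in>lists. \<Sum>b\<in>blocks. N \<beta>)"
      unfolding sum.cartesian_product case_prod_beta ..
    also have "\<dots> = real B * S" by (simp add: S_def B_def sum_distrib_left)
    finally show ?thesis .
  qed
  have "2 * real d * (real k * S) = (\<Sum>\<beta>\<in>lists. 2 * real d * (real k * N \<beta>))"
    by (simp add: S_def sum_distrib_left)
  also have "\<dots> \<le> (\<Sum>\<beta>\<in>lists. \<Sum>i<k. \<Sum>b\<in>blocks. N \<beta> + N (\<beta>[i := b]))" by (intro sum_mono main)
  also have "\<dots> = (\<Sum>i<k. \<Sum>\<beta>\<in>lists. \<Sum>b\<in>blocks. N \<beta> + N (\<beta>[i := b]))" by (rule sum.swap)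
  also have "\<dots> \<le> (\<Sum>i<k. 2 * real B * S)"
  proof (intro sum_mono)
    fix i assume "i \<in> {..<k}"
    then have "(\<Sum>\<beta>\<in>lists. \<Sum>b\<in>blocks. N (\<beta>[i := b])) \<le> real B * S" by (intro swap) simp
    moreover have "(\<Sum>\<beta>\<in>lists. \<Sum>b\<in>blocks. N \<beta>) = real B * S" by (simp add: S_def B_def sum_distrib_left)
    ultimately show "(\<Sum>\<beta>\<in>lists. \<Sum>b\<in>blocks. N \<beta> + N (\<beta>[i := b])) \<le> 2 * real B * S"
      unfolding sum.distrib by linarith
  qed
  finally have "real k * ((real d - real B) * S) \<le> 0" by (simp add: algebra_simps)
  moreover have "real k > 0" "real d - real B > 0" using \<beta> d by (simp_all add: k_def B_def)
  ultimately have "S \<le> 0" by (simp add: mult_le_0_iff)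
  moreover have "S \<ge> 0" unfolding S_def using N0 by (intro sum_nonneg)
  ultimately have "S = 0" by simp
  then have zero: "N \<gamma> = 0" if "\<gamma> \<in> lists" for \<gamma>
    using that N0 fin unfolding S_def by (simp add: sum_nonneg_eq_0_iff)
  show ?thesis
  proof (cases "valid \<beta>")
    case True
    then have "N \<beta> = 0" using valid_blocks by (intro zero) (simp add: lists_def k_def)
    then show ?thesis using y finite_Y unfolding N_def nrm_def by (simp add: sum_nonneg_eq_0_iff)
  qed (simp add: Z_invalid)
qed

text \<open>The blocks are laid side by side from \<open>q0\<close> on, each with a chosen path
  between the required ends; \<open>zs\<close> lists the edges of all of them.\<close>

lemma blocks_exist:
  assumes "set as \<subseteq> idxs p d" "q0 + sum_list (map (\<lambda>\<alpha>. length (w (fst \<alpha>))) as) \<le> q"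
  shows "\<exists>\<beta> zs. length zs = sum_list (map (\<lambda>\<alpha>. length (w (fst \<alpha>))) as) \<and> set zs \<subseteq> idxs n d \<and>
    valid \<beta> \<and> labels \<beta> = {q0..<q0 + length zs} \<and>
    (\<forall>y. (\<forall>i<length zs. y (q0 + i) = zs ! i) \<longrightarrow> (\<forall>b\<in>set \<beta>. good b y) \<and> map (ends y) \<beta> = as)"
  using assms
proof (induction as arbitrary: q0)
  case Nil
  show ?case by (intro exI[of _ "[]"]) (simp add: labels_simps)
next
  case (Cons \<alpha> as)
  obtain j s t where \<alpha>: "\<alpha> = (j, s, t)" by (cases \<alpha>)
  have j: "j < p" "s < d" "t < d" using Cons.prems(1) by (auto simp: \<alpha> idxs_def)
  obtain es where es: "es \<in> paths d (w j) s t" using paths_nonempty[OF w_nonempty[OF j(1)] j(3)] by blast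
  let ?k = "length (w j)"
  have les: "length es = ?k" using path_length[OF es] .
  obtain \<beta> zs where IH: "length zs = sum_list (map (\<lambda>\<alpha>. length (w (fst \<alpha>))) as)" "set zs \<subseteq> idxs n d"
    "valid \<beta>" "labels \<beta> = {q0 + ?k..<q0 + ?k + length zs}"
    "\<And>y. (\<forall>i<length zs. y (q0 + ?k + i) = zs ! i) \<Longrightarrow> (\<forall>b\<in>set \<beta>. good b y) \<and> map (ends y) \<beta> = as"
    using Cons.IH[of "q0 + ?k"] Cons.prems by (auto simp: \<alpha>)
  let ?b = "(j, [q0..<q0 + ?k])"
  have b: "?b \<in> blocks" using Cons.prems(2) j(1) by (auto simp: blocks_def \<alpha>)
  have v: "valid (?b # \<beta>)" using b IH(3,4) by auto
  have l: "labels (?b # \<beta>) = {q0..<q0 + length (es @ zs)}" using IH(4) les by (auto simp: labels_simps)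
  have y: "(\<forall>c\<in>set (?b # \<beta>). good c y) \<and> map (ends y) (?b # \<beta>) = \<alpha> # as"
    if y: "\<forall>i<length (es @ zs). y (q0 + i) = (es @ zs) ! i" for y
  proof -
    have "\<forall>i<length zs. y (q0 + ?k + i) = zs ! i"
    proof (intro allI impI)
      fix i assume "i < length zs"
      then show "y (q0 + ?k + i) = zs ! i"
        using y[rule_format, of "?k + i"] les by (simp add: nth_append add.assoc)
    qed
    then have 1: "(\<forall>b\<in>set \<beta>. good b y) \<and> map (ends y) \<beta> = as" by (rule IH(5))
    have "map y [q0..<q0 + ?k] = es"
      using y les by (intro nth_equalityI) (auto simp: nth_append)
    then have "good ?b y" "ends y ?b = \<alpha>"
      using es good_ends[OF b, of y s t] by (auto simp: good_def \<alpha>)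
    then show ?thesis using 1 by simp
  qed
  have "set es \<subseteq> idxs n d" using path_vertices[OF es j(2)] w_set[OF j(1)] by (auto simp: idxs_def)
  then show ?case
    using IH(1,2) les v l y by (intro exI[of _ "?b # \<beta>"] exI[of _ "es @ zs"]) (simp add: \<alpha>)
qed

text \<open>Here \<open>q\<close> is the number of edges in the generators and in the coefficient
  together. Some labelling then realises any prescribed coefficient, so that \<open>F\<close> can be
  recovered from the functions \<open>Z F\<close>.\<close>

lemma Z_detects:
  assumes as: "set as \<subseteq> idxs p d" and vs: "set vs \<subseteq> idxs n d"
    and q: "q = sum_list (map (\<lambda>\<alpha>. length (w (fst \<alpha>))) as) + length vs"
  obtains \<beta> y where "length \<beta> = length as" "y \<in> Y" "Z F \<beta> y = dcoeff (F as) (mon_of vs)"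
proof -
  obtain \<beta> zs where z: "length zs = sum_list (map (\<lambda>\<alpha>. length (w (fst \<alpha>))) as)" "set zs \<subseteq> idxs n d"
    "valid \<beta>" "labels \<beta> = {0..<0 + length zs}"
    "\<And>y. (\<forall>i<length zs. y (0 + i) = zs ! i) \<Longrightarrow> (\<forall>b\<in>set \<beta>. good b y) \<and> map (ends y) \<beta> = as"
    using blocks_exist[OF as, of 0] q by auto
  define y where "y l = (if l < q then (zs @ vs) ! l else undefined)" for l
  have lq: "length (zs @ vs) = q" using z(1) q by simp
  have y: "y \<in> Y"
    unfolding Y_def
  proof (rule PiE_I)
    fix l assume l: "l \<in> {..<q}"
    then have "(zs @ vs) ! l \<in> set (zs @ vs)" using lq by (intro nth_mem) auto
    then show "y l \<in> idxs n d" using z(2) vs l by (auto simp: y_def)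
  qed (simp add: y_def)
  have g: "(\<forall>b\<in>set \<beta>. good b y) \<and> map (ends y) \<beta> = as"
    by (intro z(5)) (use lq in \<open>auto simp: y_def nth_append\<close>)
  have "restmon y ({..<q} - labels \<beta>) = (\<Sum>i\<in>{length zs..<length zs + length vs}. single (y i) 1)"
    unfolding restmon_def z(4) using lq by (intro sum.cong) auto
  also have "\<dots> = (\<Sum>i\<in>{0..<length vs}. single (vs ! i) 1)"
    using sum.shift_bounds_nat_ivl[of "\<lambda>i. single (y i) (1::nat)" 0 "length zs" "length vs"] lq
    by (simp add: y_def nth_append add.commute)
  also have "\<dots> = mon_of vs"
    unfolding mon_of_def by (simp add: sum_list_sum_nth)
  finally have "Z F \<beta> y = dcoeff (F as) (mon_of vs)" using g z(3) by (simp add: Z_def)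
  moreover have "length \<beta> = length as" using g by (metis length_map)
  ultimately show ?thesis using that y by blast
qed

end

lemma length_le_word_degree:
  assumes m: "\<And>i. i < n \<Longrightarrow> m i > 0" and "set u \<subseteq> {..<n}"
  shows "length u \<le> word_degree m u"
  using assms(2)
proof (induction u)
  case (Cons i u)
  then have "m i \<ge> 1" using m[of i] by simp
  then show ?case using Cons by (simp add: word_degree_def)
qed (simp add: word_degree_def)

text \<open>Each coefficient is tested with its own number \<open>q\<close> of edges. Positive
  degrees force \<open>q \<le> R\<close>, which is why \<open>d\<close> has to exceed the number of
  blocks for every such \<open>q\<close>.\<close>

lemma laplace_injective:
  assumes w: "\<And>j. j < p \<Longrightarrow> set (w j) \<subseteq> {..<n}" "inj_on w {..<p}"
      "\<And>i j. i < p \<Longrightarrow> j < p \<Longrightarrow> non_overlapping (w i) (w j)"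
    and m: "\<And>i. i < n \<Longrightarrow> m i > 0" and r: "\<And>j. j < p \<Longrightarrow> word_degree m (w j) = r j"
    and d: "\<And>q. q \<le> R \<Longrightarrow> card (words.blocks p q w) < d"
    and F: "F \<in> cochains n m p r d k R" and k: "k > 0"
    and L: "laplace p d w (word_relations p w) F = 0"
  shows "F = 0"
proof (rule ccontr)
  assume "F \<noteq> 0"
  then obtain as where as: "F as \<noteq> 0" by (auto simp: fun_eq_iff)
  then have "keys (F as) \<noteq> {}" by simp
  then obtain \<mu> where \<mu>: "\<mu> \<in> keys (F as)" by blast
  obtain vs where vs: "mon_of vs = \<mu>" using ex_mon_of by blast
  define q where "q = sum_list (map (\<lambda>\<alpha>. length (w (fst \<alpha>))) as) + length vs"
  interpret words n p d q w using w by unfold_locales auto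
  have asx: "set as \<subseteq> idxs p d" "length as = k" using cochainsD[OF F] as by blast+
  have vsx: "set vs \<subseteq> idxs n d" using cochainsD(4)[OF F \<mu>] vs by (metis keys_mon)
  have len: "length u \<le> word_degree m u" if "set u \<subseteq> {..<n}" for u
    by (rule length_le_word_degree[OF _ that]) (rule m)
  have "length (w (fst \<alpha>)) \<le> r (fst \<alpha>)" if "\<alpha> \<in> set as" for \<alpha>
  proof -
    have "fst \<alpha> < p" using that asx(1) by (auto simp: idxs_def)
    then show ?thesis using len[OF w(1)] r by metis
  qed
  then have "sum_list (map (\<lambda>\<alpha>. length (w (fst \<alpha>))) as) \<le> sum_list (map (r \<circ> fst) as)"
    by (intro sum_list_mono) simp
  moreover have "length vs \<le> wt m \<mu>"
  proof -
    have "length (map fst vs) \<le> word_degree m (map fst vs)" using vsx by (intro len) (auto simp: idxs_def)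
    then show ?thesis using wt_mon[of m vs] vs by (simp add: word_degree_def)
  qed
  ultimately have "q \<le> R" using cochainsD(5)[OF F \<mu>] by (simp add: q_def)
  then have "card blocks < d" by (rule d)
  obtain \<beta> y where "length \<beta> = length as" "y \<in> Y" "Z F \<beta> y = dcoeff (F as) (mon_of vs)"
    using Z_detects[OF asx(1) vsx q_def] by blast
  moreover from this have "Z F \<beta> y = 0"
    using asx(2) k by (intro Z_vanishes[OF cochainsD(1)[OF F] L \<open>card blocks < d\<close>]) simp_all
  ultimately have "dcoeff (F as) \<mu> = 0" using vs by simp
  then show False using \<mu> by (simp add: dcoeff_def monfact_nonzero in_keys_iff)
qed

section \<open>Linear extension and polynomial functions\<close>

definition lin :: "('a \<Rightarrow> 'r) \<Rightarrow> ('a \<Rightarrow>\<^sub>0 'r::semiring_0) \<Rightarrow> 'r" where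
  "lin h g = (\<Sum>x\<in>keys g. lookup g x * h x)"

lemma lin_superset: "finite S \<Longrightarrow> keys g \<subseteq> S \<Longrightarrow> lin h g = (\<Sum>x\<in>S. lookup g x * h x)"
  unfolding lin_def by (intro sum.mono_neutral_left) (auto simp: in_keys_iff)

lemma lin_0: "lin h 0 = 0" by (simp add: lin_def)

lemma lin_add: "lin h (f + g) = lin h f + lin h g"
proof -
  let ?S = "keys f \<union> keys g"
  have "keys (f + g) \<subseteq> ?S" by (rule keys_add)
  then show ?thesis
    using lin_superset[of ?S "f + g" h] lin_superset[of ?S f h] lin_superset[of ?S g h]
    by (simp add: lookup_add distrib_right sum.distrib)
qed

lemma lin_uminus: "lin h (- f) = - lin h f" for f :: "'a \<Rightarrow>\<^sub>0 'r::ring"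
  by (simp add: lin_def sum_negf)

lemma lin_diff: "lin h (f - g) = lin h f - lin h g" for f :: "'a \<Rightarrow>\<^sub>0 'r::ring"
  using lin_add[of h f "- g"] by (simp add: lin_uminus)

lemma lin_sum: "lin h (sum f S) = (\<Sum>x\<in>S. lin h (f x))"
  by (induction S rule: infinite_finite_induct) (simp_all add: lin_0 lin_add)

lemma lin_single: "lin h (single x c) = c * h x"
  by (simp add: lin_def)

lemma lin_const_mult: "lin h (const_poly c * g) = c * lin h g"
proof -
  have "keys (const_poly c * g) \<subseteq> keys g" using keys_const_multE by blast
  then have "lin h (const_poly c * g) = (\<Sum>x\<in>keys g. lookup (const_poly c * g) x * h x)"
    by (intro lin_superset) auto
  then show ?thesis by (simp add: lookup_const_mult lin_def sum_distrib_left mult.assoc)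
qed

lemma poly_mapping_expand: "g = (\<Sum>x\<in>keys g. single x (lookup g x))"
proof (rule poly_mapping_eqI)
  fix y
  have "(\<Sum>x\<in>keys g. lookup (single x (lookup g x)) y) = (\<Sum>x\<in>keys g. if x = y then lookup g y else 0)"
    by (intro sum.cong refl) (auto simp: lookup_single when_def)
  then show "lookup g y = lookup (\<Sum>x\<in>keys g. single x (lookup g x)) y"
    by (simp add: lookup_sum in_keys_iff)
qed

lemma lin_mult:
  fixes h :: "'a::monoid_add \<Rightarrow> 'r::comm_semiring_0"
  assumes h: "\<And>x y. h (x + y) = h x * h y"
  shows "lin h (f * g) = lin h f * lin h g"
proof -
  have "f * g = (\<Sum>x\<in>keys f. \<Sum>y\<in>keys g. single (x + y) (lookup f x * lookup g y))"
    by (subst (1) poly_mapping_expand[of f], subst (1) poly_mapping_expand[of g])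
      (simp add: sum_product mult_single)
  then show ?thesis
    by (simp add: lin_sum lin_single lin_def[of h f] lin_def[of h g] sum_product h mult_ac)
qed

section \<open>Polynomial functions of the relations\<close>

definition mono_value :: "('x \<Rightarrow> complex) \<Rightarrow> ('x \<Rightarrow>\<^sub>0 nat) \<Rightarrow> complex" where
  "mono_value x \<mu> = (\<Prod>v\<in>keys \<mu>. x v ^ lookup \<mu> v)"

lemma poly_value_lin: "poly_value x = lin (mono_value x)"
  by (simp add: fun_eq_iff poly_value_def lin_def mono_value_def)

lemma mono_value_superset: "finite S \<Longrightarrow> keys \<mu> \<subseteq> S \<Longrightarrow> mono_value x \<mu> = (\<Prod>v\<in>S. x v ^ lookup \<mu> v)"
  unfolding mono_value_def by (intro prod.mono_neutral_left) (auto simp: in_keys_iff)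

lemma mono_value_add: "mono_value x (\<mu> + \<nu>) = mono_value x \<mu> * mono_value x \<nu>"
proof -
  let ?S = "keys \<mu> \<union> keys \<nu>"
  show ?thesis
    using mono_value_superset[of ?S "\<mu> + \<nu>" x] mono_value_superset[of ?S \<mu> x] mono_value_superset[of ?S \<nu> x]
    by (simp add: keys_add_nat lookup_add power_add prod.distrib)
qed

lemma mono_value_0: "mono_value x 0 = 1" by (simp add: mono_value_def)

lemma mono_value_single: "mono_value x (single v 1) = x v" by (simp add: mono_value_def)

lemma poly_value_mult: "poly_value x (f * g) = poly_value x f * poly_value x g"
  unfolding poly_value_lin by (rule lin_mult) (rule mono_value_add)

text \<open>Agreement with a polynomial is asked on the relation space only: there homogeneity
  confines each relation to a fixed finite set of words.\<close>

definition polyfuns :: "nat \<Rightarrow> (nat \<Rightarrow> nat) \<Rightarrow> nat \<Rightarrow> (nat \<Rightarrow> nat) \<Rightarrow> ((nat \<Rightarrow> ncpoly) \<Rightarrow> complex) set" where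
  "polyfuns n m p r = {f. \<exists>g. \<forall>e\<in>relation_space n m p r. f e = poly_value (\<lambda>(j, w). lookup (e j) w) g}"

lemma polyfuns_const: "(\<lambda>_. c) \<in> polyfuns n m p r"
  unfolding polyfuns_def
  by (intro CollectI exI[of _ "const_poly c"]) (simp add: poly_value_lin lin_single mono_value_0)

lemma polyfuns_coord: "(\<lambda>e. lookup (e j) w) \<in> polyfuns n m p r"
  unfolding polyfuns_def
  by (intro CollectI exI[of _ "single (single (j, w) 1) 1"])
    (simp add: poly_value_lin lin_single mono_value_single del: One_nat_def)

lemma polyfuns_add: "f \<in> polyfuns n m p r \<Longrightarrow> g \<in> polyfuns n m p r \<Longrightarrow> (\<lambda>e. f e + g e) \<in> polyfuns n m p r"
  unfolding polyfuns_def mem_Collect_eq poly_value_lin by (metis lin_add)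

lemma polyfuns_mult: "f \<in> polyfuns n m p r \<Longrightarrow> g \<in> polyfuns n m p r \<Longrightarrow> (\<lambda>e. f e * g e) \<in> polyfuns n m p r"
  unfolding polyfuns_def mem_Collect_eq by (metis poly_value_mult)

lemma polyfuns_sum: "(\<And>i. i \<in> I \<Longrightarrow> f i \<in> polyfuns n m p r) \<Longrightarrow> (\<lambda>e. \<Sum>i\<in>I. f i e) \<in> polyfuns n m p r"
  by (induction I rule: infinite_finite_induct) (simp_all add: polyfuns_const polyfuns_add)

lemma polyfuns_cong:
  "f \<in> polyfuns n m p r \<Longrightarrow> (\<And>e. e \<in> relation_space n m p r \<Longrightarrow> f e = g e) \<Longrightarrow> g \<in> polyfuns n m p r"
  unfolding polyfuns_def mem_Collect_eq by metis

lemma zariski_open_polyfun: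
  assumes "f \<in> polyfuns n m p r"
  shows "zariski_open n m p r {e \<in> relation_space n m p r. f e \<noteq> 0}"
proof -
  obtain g where "\<forall>e\<in>relation_space n m p r. f e = poly_value (\<lambda>(j, w). lookup (e j) w) g"
    using assms by (auto simp: polyfuns_def)
  then show ?thesis unfolding zariski_open_def by (intro exI[of _ "{g}"]) auto
qed

lemma finite_words:
  assumes m: "\<And>i. i < n \<Longrightarrow> m i > 0"
  shows "finite {w. set w \<subseteq> {..<n} \<and> word_degree m w = t}"
proof (rule finite_subset)
  show "{w. set w \<subseteq> {..<n} \<and> word_degree m w = t} \<subseteq> {w. set w \<subseteq> {..<n} \<and> length w \<le> t}"
    using length_le_word_degree[OF m] by auto
qed (simp add: finite_lists_length_le)

lemma finite_monomials:
  assumes m: "\<And>i. i < n \<Longrightarrow> m i > 0"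
  shows "finite {\<mu>. keys \<mu> \<subseteq> idxs n d \<and> wt m \<mu> \<le> R}"
proof (rule finite_subset)
  show "{\<mu>. keys \<mu> \<subseteq> idxs n d \<and> wt m \<mu> \<le> R} \<subseteq> mon_of ` {vs. set vs \<subseteq> idxs n d \<and> length vs \<le> R}"
  proof
    fix \<mu> assume \<mu>: "\<mu> \<in> {\<mu>. keys \<mu> \<subseteq> idxs n d \<and> wt m \<mu> \<le> R}"
    obtain vs where vs: "mon_of vs = \<mu>" using ex_mon_of by blast
    have s: "set vs \<subseteq> idxs n d" using \<mu> keys_mon[of vs] vs by simp
    then have "length (map fst vs) \<le> word_degree m (map fst vs)"
      by (intro length_le_word_degree[OF m]) (auto simp: idxs_def)
    then have "length vs \<le> R" using wt_mon[of m vs] vs \<mu> by (simp add: word_degree_def)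
    then show "\<mu> \<in> mon_of ` {vs. set vs \<subseteq> idxs n d \<and> length vs \<le> R}" using vs s by blast
  qed
qed (simp add: finite_lists_length_le finite_idxs)

section \<open>Exactness for generic relations\<close>

lemma sum_fun_apply: "(\<Sum>i\<in>I. f i) x = (\<Sum>i\<in>I. f i x)"
  by (induction I rule: infinite_finite_induct) simp_all

text \<open>These functions need not be alternating; they serve to place the cochains in the span of
  a finite set.\<close>

definition basis_cochain :: "idx list \<times> (idx \<Rightarrow>\<^sub>0 nat) \<Rightarrow> idx list \<Rightarrow> coord_poly" where
  "basis_cochain \<omega> = (\<lambda>as. if as = fst \<omega> then single (snd \<omega>) 1 else 0)"

definition support :: "nat \<Rightarrow> (nat \<Rightarrow> nat) \<Rightarrow> nat \<Rightarrow> nat \<Rightarrow> nat \<Rightarrow> nat \<Rightarrow> (idx list \<times> (idx \<Rightarrow>\<^sub>0 nat)) set" where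
  "support n m p d k R = {as. set as \<subseteq> idxs p d \<and> length as = k} \<times> {\<mu>. keys \<mu> \<subseteq> idxs n d \<and> wt m \<mu> \<le> R}"

lemma finite_support: "(\<And>i. i < n \<Longrightarrow> m i > 0) \<Longrightarrow> finite (support n m p d k R)"
  unfolding support_def by (simp add: finite_monomials finite_lists_length_eq finite_idxs)

lemma in_support:
  assumes "F \<in> cochains n m p r d k R" "lookup (F as) \<mu> \<noteq> 0"
  shows "(as, \<mu>) \<in> support n m p d k R"
proof -
  have "\<mu> \<in> keys (F as)" "F as \<noteq> 0" using assms(2) by (auto simp: in_keys_iff)
  then show ?thesis using cochainsD(2-5)[OF assms(1)] unfolding support_def by fastforce
qed

lemma cochain_expand:
  assumes m: "\<And>i. i < n \<Longrightarrow> m i > 0" and F: "F \<in> cochains n m p r d k R"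
  shows "F = (\<Sum>\<omega>\<in>support n m p d k R. fscale (lookup (F (fst \<omega>)) (snd \<omega>)) (basis_cochain \<omega>))"
proof (intro ext poly_mapping_eqI)
  fix as \<mu>
  have "(\<Sum>\<omega>\<in>support n m p d k R. lookup (fscale (lookup (F (fst \<omega>)) (snd \<omega>)) (basis_cochain \<omega>) as) \<mu>)
      = (\<Sum>\<omega>\<in>support n m p d k R. if \<omega> = (as, \<mu>) then lookup (F as) \<mu> else 0)"
    by (intro sum.cong refl)
      (auto simp: fscale_def basis_cochain_def lookup_const_mult lookup_single when_def prod_eq_iff)
  also have "\<dots> = lookup (F as) \<mu>"
    using in_support[OF F, of as \<mu>] finite_support[OF m] by auto
  finally show "lookup (F as) \<mu> =
      lookup ((\<Sum>\<omega>\<in>support n m p d k R. fscale (lookup (F (fst \<omega>)) (snd \<omega>)) (basis_cochain \<omega>)) as) \<mu>"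
    by (simp add: sum_fun_apply lookup_sum)
qed

lemma alternating_add: "alternating F \<Longrightarrow> alternating G \<Longrightarrow> alternating (F + G)"
  for F :: "'a list \<Rightarrow> 'c::ab_group_add"
proof -
  assume a: "alternating F" "alternating G"
  show ?thesis unfolding alternating_def[of "F + G"]
    by (intro allI) (simp only: plus_fun_apply minus_add_distrib alternatingD[OF a(1), symmetric]
        alternatingD[OF a(2), symmetric] minus_minus add.commute)
qed

lemma cochains_subspace: "fscale.subspace (cochains n m p r d k R)"
proof (rule fscale.subspaceI)
  show "0 \<in> cochains n m p r d k R"
    by (rule cochainsI) (auto simp: alternating_def)
next
  fix F G assume F: "F \<in> cochains n m p r d k R" and G: "G \<in> cochains n m p r d k R"
  show "F + G \<in> cochains n m p r d k R"
  proof (rule cochainsI)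
    show "alternating (F + G)" using F G cochainsD(1) alternating_add by blast
    fix as assume "(F + G) as \<noteq> 0"
    then have "F as \<noteq> 0 \<or> G as \<noteq> 0" by auto
    then show "length as = k \<and> set as \<subseteq> idxs p d" using cochainsD(2,3)[OF F] cochainsD(2,3)[OF G] by blast
  next
    fix as \<mu> assume "\<mu> \<in> keys ((F + G) as)"
    then have "\<mu> \<in> keys (F as) \<or> \<mu> \<in> keys (G as)" using keys_add[of "F as" "G as"] by auto
    then show "keys \<mu> \<subseteq> idxs n d \<and> wt m \<mu> + sum_list (map (r \<circ> fst) as) \<le> R"
      using cochainsD(4,5)[OF F] cochainsD(4,5)[OF G] by blast
  qed
next
  fix c F assume F: "F \<in> cochains n m p r d k R"
  show "fscale c F \<in> cochains n m p r d k R"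
  proof (rule cochainsI)
    show "alternating (fscale c F)"
      unfolding alternating_def fscale_def
      by (intro allI) (simp only: alternatingD[OF cochainsD(1)[OF F], symmetric] mult_minus_right[symmetric] minus_minus)
    fix as assume "fscale c F as \<noteq> 0"
    then have "F as \<noteq> 0" by (auto simp: fscale_def)
    then show "length as = k \<and> set as \<subseteq> idxs p d" using cochainsD(2,3)[OF F] by blast
  next
    fix as \<mu> assume "\<mu> \<in> keys (fscale c F as)"
    then have "\<mu> \<in> keys (F as)" unfolding fscale_def by (rule keys_const_multE)
    then show "keys \<mu> \<subseteq> idxs n d \<and> wt m \<mu> + sum_list (map (r \<circ> fst) as) \<le> R"
      using cochainsD(4,5)[OF F] by blast
  qed
qed

text \<open>The sum over the support of a relation, which varies with \<open>e\<close>, is replaced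
  by a sum over all words of the right degree.\<close>

lemma polyfuns_entry_mult:
  assumes m: "\<And>i. i < n \<Longrightarrow> m i > 0" and \<alpha>: "\<alpha> \<in> idxs p d"
  shows "(\<lambda>e. lookup (entry e d \<alpha> * g) \<mu>) \<in> polyfuns n m p r"
proof -
  obtain j a b where jab: "\<alpha> = (j, a, b)" "j < p" using \<alpha> by (auto simp: idxs_def)
  let ?W = "{w. set w \<subseteq> {..<n} \<and> word_degree m w = r j}"
  have "(\<Sum>w\<in>?W. lookup (e j) w * lookup (word_poly d w a b * g) \<mu>) = lookup (entry e d \<alpha> * g) \<mu>"
    if e: "e \<in> relation_space n m p r" for e
  proof -
    have "keys (e j) \<subseteq> ?W" using e jab(2) by (auto simp: relation_space_def TV_component_def TV_def)
    then have "(\<Sum>w\<in>?W. lookup (e j) w * lookup (word_poly d w a b * g) \<mu>) =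
        (\<Sum>w\<in>keys (e j). lookup (e j) w * lookup (word_poly d w a b * g) \<mu>)"
      by (intro sum.mono_neutral_right finite_words m) (auto simp: in_keys_iff)
    then show ?thesis
      by (simp add: jab(1) entry_def sum_distrib_right lookup_sum lookup_const_mult mult.assoc)
  qed
  moreover have "(\<lambda>e. \<Sum>w\<in>?W. lookup (e j) w * lookup (word_poly d w a b * g) \<mu>) \<in> polyfuns n m p r"
    by (intro polyfuns_sum polyfuns_mult polyfuns_coord polyfuns_const)
  ultimately show ?thesis by (rule polyfuns_cong[rotated])
qed

lemma polyfuns_kos_d:
  assumes m: "\<And>i. i < n \<Longrightarrow> m i > 0"
  shows "(\<lambda>e. lookup (kos_d p d e F as) \<mu>) \<in> polyfuns n m p r"
  unfolding kos_d_def lookup_sum by (intro polyfuns_sum polyfuns_entry_mult[OF m])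

lemma polyfuns_contract:
  assumes "\<And>\<mu>. (\<lambda>e. lookup (T e) \<mu>) \<in> polyfuns n m p r"
  shows "(\<lambda>e. lookup (contract d w \<alpha> (T e)) \<mu>) \<in> polyfuns n m p r"
  unfolding contract_def case_prod_beta lookup_const_mult lookup_sum lookup_mdiff dcoeff_def divide_inverse
  by (intro polyfuns_mult polyfuns_const polyfuns_sum assms)

lemma lookup_sign: "lookup ((- 1) ^ i * g) \<mu> = (- 1) ^ i * lookup g \<mu>" for g :: coord_poly
  by (cases "even i") simp_all

lemma polyfuns_laplace:
  assumes m: "\<And>i. i < n \<Longrightarrow> m i > 0"
  shows "(\<lambda>e. lookup (laplace p d w e F as) \<mu>) \<in> polyfuns n m p r"
proof -
  have "(\<lambda>e. lookup (kos_h p d w (kos_d p d e F) as) \<mu>) \<in> polyfuns n m p r"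
  proof (cases "set as \<subseteq> idxs p d")
    case True
    then show ?thesis
      by (simp add: kos_h_def skew_eq_sum lookup_sum lookup_sign)
        (intro polyfuns_sum polyfuns_mult polyfuns_const polyfuns_contract polyfuns_kos_d m)
  qed (simp add: kos_h_def polyfuns_const)
  then show ?thesis
    unfolding laplace_def plus_fun_apply lookup_add by (intro polyfuns_add polyfuns_kos_d m)
qed

definition koszul_exact :: "nat \<Rightarrow> (nat \<Rightarrow> nat) \<Rightarrow> nat \<Rightarrow> (nat \<Rightarrow> nat) \<Rightarrow> (nat \<Rightarrow> ncpoly) \<Rightarrow> nat \<Rightarrow> nat \<Rightarrow> nat \<Rightarrow> bool" where
  "koszul_exact n m p r e d k R \<longleftrightarrow> (\<forall>F\<in>cochains n m p r d k R. kos_d p d e F = 0 \<longrightarrow>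
     (\<exists>G\<in>cochains n m p r d (Suc k) R. kos_d p d e G = F))"

lemma word_relations_in_space:
  assumes "\<And>j. j < p \<Longrightarrow> set (w j) \<subseteq> {..<n}" "\<And>j. j < p \<Longrightarrow> word_degree m (w j) = r j"
  shows "word_relations p w \<in> relation_space n m p r"
  using assms by (auto simp: word_relations_def relation_space_def TV_component_def TV_def)

lemma kos_h_0: "kos_h p d w 0 = 0"
  using kos_h_scale[of p d w 0 0] by simp

lemma kos_d_0: "kos_d p d e 0 = 0"
  by (simp add: kos_d_def fun_eq_iff)

lemma generic_koszul_exact:
  assumes w: "\<And>j. j < p \<Longrightarrow> set (w j) \<subseteq> {..<n}" "inj_on w {..<p}"
      "\<And>i j. i < p \<Longrightarrow> j < p \<Longrightarrow> non_overlapping (w i) (w j)"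
    and m: "\<And>i. i < n \<Longrightarrow> m i > 0" and r: "\<And>j. j < p \<Longrightarrow> word_degree m (w j) = r j"
    and d: "\<And>q. q \<le> R \<Longrightarrow> card (words.blocks p q w) < d" and k: "k > 0"
  shows "\<exists>f\<in>polyfuns n m p r. f (word_relations p w) \<noteq> 0 \<and>
    (\<forall>e\<in>relation_space n m p r. f e \<noteq> 0 \<longrightarrow> koszul_exact n m p r e d k R)"
proof -
  let ?U = "cochains n m p r d k R" and ?\<Omega> = "support n m p d k R" and ?e0 = "word_relations p w"
  obtain k' where k': "k = Suc k'" using k by (cases k) auto
  have e0: "?e0 \<in> relation_space n m p r" using w(1) r by (rule word_relations_in_space)
  have UU: "laplace p d w e ` ?U \<subseteq> ?U" if e: "e \<in> relation_space n m p r" for e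
  proof clarify
    fix F assume F: "F \<in> ?U"
    have "kos_d p d e (kos_h p d w F) \<in> ?U" by (intro kos_d_cochains e kos_h_cochains r F)
    moreover have "kos_h p d w (kos_d p d e F) \<in> ?U"
      using F unfolding k' by (intro kos_h_cochains r kos_d_cochains e)
    ultimately show "laplace p d w e F \<in> ?U"
      unfolding laplace_def by (rule fscale.subspace_add[OF cochains_subspace])
  qed
  have fW: "finite (basis_cochain ` ?\<Omega>)" using finite_support[of n m, OF m] by blast
  have span: "?U \<subseteq> fscale.span (basis_cochain ` ?\<Omega>)"
  proof
    fix F assume F: "F \<in> ?U"
    have "(\<Sum>\<omega>\<in>?\<Omega>. fscale (lookup (F (fst \<omega>)) (snd \<omega>)) (basis_cochain \<omega>)) \<in> fscale.span (basis_cochain ` ?\<Omega>)"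
      by (intro fscale.span_sum fscale.span_scale fscale.span_base imageI)
    then show "F \<in> fscale.span (basis_cochain ` ?\<Omega>)" using cochain_expand[of n m, OF m F] by simp
  qed
  have "\<exists>f\<in>polyfuns n m p r. f ?e0 \<noteq> 0 \<and> (\<forall>e. f e \<noteq> 0 \<longrightarrow> (\<forall>F\<in>?U. laplace p d w e F = 0 \<longrightarrow> F = 0))"
  proof (rule injectivity_is_open[where M = "laplace p d w" and co = "\<lambda>\<omega> F. lookup (F (fst \<omega>)) (snd \<omega>)" and \<Omega> = ?\<Omega>])
    show "vector_space fscale" by (rule fscale.vector_space_axioms)
    show "finite (basis_cochain ` ?\<Omega>)" by (rule fW)
    show "fscale.subspace ?U" by (rule cochains_subspace)
    show "?U \<subseteq> fscale.span (basis_cochain ` ?\<Omega>)" by (rule span)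
    show "Vector_Spaces.linear fscale fscale (laplace p d w e)" for e by (rule laplace_linear)
    show "laplace p d w ?e0 ` ?U \<subseteq> ?U" by (rule UU[OF e0])
    show "Vector_Spaces.linear fscale (*) (\<lambda>F. lookup (F (fst \<omega>)) (snd \<omega>))" for \<omega> :: "idx list \<times> (idx \<Rightarrow>\<^sub>0 nat)"
    proof -
      have "Modules.module ((*) :: complex \<Rightarrow> complex \<Rightarrow> complex)"
        by unfold_locales (simp_all add: distrib_left distrib_right)
      then show ?thesis
        by (intro module_hom_iff_linear[THEN iffD1] module_hom.intro fscale.module_axioms module_hom_axioms.intro)
          (simp_all add: fscale_def lookup_const_mult lookup_add)
    qed
    show "F = 0" if F: "F \<in> ?U" and z: "\<And>\<omega>. \<omega> \<in> ?\<Omega> \<Longrightarrow> lookup (F (fst \<omega>)) (snd \<omega>) = 0" for F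
      by (subst cochain_expand[of n m, OF m F]) (simp_all add: z fscale_def fun_eq_iff sum_fun_apply)
    show "finite ?\<Omega>" by (rule finite_support[of n m, OF m])
    show "(\<lambda>e. lookup (laplace p d w e F (fst \<omega>)) (snd \<omega>)) \<in> polyfuns n m p r" for F \<omega>
      by (rule polyfuns_laplace) (rule m)
    show "F = 0" if "F \<in> ?U" "laplace p d w ?e0 F = 0" for F
      by (rule laplace_injective[of p w n m, OF w m r d that(1) k that(2)])
  qed (simp_all add: polyfuns_const polyfuns_add polyfuns_mult)
  then obtain f where f: "f \<in> polyfuns n m p r" "f ?e0 \<noteq> 0"
    "\<And>e F. f e \<noteq> 0 \<Longrightarrow> F \<in> ?U \<Longrightarrow> laplace p d w e F = 0 \<Longrightarrow> F = 0" by blast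
  have "koszul_exact n m p r e d k R" if e: "e \<in> relation_space n m p r" "f e \<noteq> 0" for e
    unfolding koszul_exact_def
  proof (intro ballI impI)
    fix F assume F: "F \<in> ?U" "kos_d p d e F = 0"
    \<comment> \<open>Surjectivity is used on the cycles and not on all cochains: the preimage
      \<open>G\<close> is then a cycle itself, the term \<open>hd\<close> vanishes on it, and
      \<open>kos_h p d w G\<close> bounds \<open>F\<close>.\<close>
    let ?Z = "{F \<in> ?U. kos_d p d e F = 0}"
    have lap: "laplace p d w e G = kos_d p d e (kos_h p d w G)" if "G \<in> ?Z" for G
      using that by (simp add: laplace_def kos_h_0)
    have "?Z \<subseteq> laplace p d w e ` ?Z"
    proof (rule fscale.inj_endo_surj[OF fW])
      show "fscale.subspace ?Z"
        using cochains_subspace[of n m p r d k R]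
        by (auto simp: fscale.subspace_def kos_d_add kos_d_scale kos_d_0)
      show "?Z \<subseteq> fscale.span (basis_cochain ` ?\<Omega>)" using span by auto
      show "laplace p d w e ` ?Z \<subseteq> ?Z"
      proof clarify
        fix G assume G: "G \<in> ?U" "kos_d p d e G = 0"
        have "alternating (kos_h p d w G)" by (rule alternating_kos_h[OF cochainsD(1)[OF G(1)]])
        then have "kos_d p d e (laplace p d w e G) = 0" using lap[of G] G by (simp add: kos_d_squared)
        then show "laplace p d w e G \<in> ?U \<and> kos_d p d e (laplace p d w e G) = 0" using UU[OF e(1)] G(1) by blast
      qed
    qed (use laplace_linear f(3)[OF e(2)] in auto)
    then obtain G where G: "G \<in> ?Z" "F = laplace p d w e G" using F by blast
    then have "F = kos_d p d e (kos_h p d w G)" using lap by simp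
    moreover have "kos_h p d w G \<in> cochains n m p r d (Suc k) R" using G(1) by (intro kos_h_cochains r) auto
    ultimately show "\<exists>G\<in>cochains n m p r d (Suc k) R. kos_d p d e G = F" by blast
  qed
  then show ?thesis using f by blast
qed

section \<open>Generic relations are independent modulo commutators\<close>

definition independent_mod_commutators :: "nat \<Rightarrow> nat \<Rightarrow> (nat \<Rightarrow> ncpoly) \<Rightarrow> bool" where
  "independent_mod_commutators n p e \<longleftrightarrow>
     (\<forall>c. (\<Sum>j<p. const_poly (c j) * e j) \<in> commutator_span n \<longrightarrow> (\<forall>j<p. c j = 0))"

text \<open>The sum of the coefficients over all rotations of \<open>u\<close>, each word counted
  once: a linear functional with the trace property.\<close>

definition cyclic_coeff :: "nat list \<Rightarrow> ncpoly \<Rightarrow> complex" where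
  "cyclic_coeff u = lin (\<lambda>w. if \<exists>k. w = rotate k u then 1 else 0)"

lemma rotation_append: "(\<exists>k. a @ b = rotate k u) \<Longrightarrow> \<exists>k. b @ a = rotate k u"
  by (metis rotate_append rotate_rotate)

lemma cyclic_coeff_commutator: "cyclic_coeff u (a * b - b * a) = 0"
proof -
  let ?h = "\<lambda>w. if \<exists>k. w = rotate k u then 1 else (0::complex)"
  have h: "?h (x + y) = ?h (y + x)" for x y
    using rotation_append[of x y u] rotation_append[of y x u] by (auto simp: plus_list_def)
  have prod: "lin ?h (a * b) = (\<Sum>x\<in>keys a. \<Sum>y\<in>keys b. lookup a x * lookup b y * ?h (x + y))" for a b :: ncpoly
  proof -
    have "a * b = (\<Sum>x\<in>keys a. \<Sum>y\<in>keys b. single (x + y) (lookup a x * lookup b y))"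
      by (subst (1) poly_mapping_expand[of a], subst (1) poly_mapping_expand[of b])
        (simp add: sum_product mult_single)
    then show ?thesis by (simp only: lin_sum lin_single)
  qed
  have "lin ?h (b * a) = (\<Sum>x\<in>keys a. \<Sum>y\<in>keys b. lookup b y * lookup a x * ?h (y + x))"
    unfolding prod by (rule sum.swap)
  also have "\<dots> = lin ?h (a * b)"
    unfolding prod h by (simp only: mult.commute)
  finally show ?thesis unfolding cyclic_coeff_def lin_diff by simp
qed

lemma cyclic_coeff_commutator_span: "x \<in> commutator_span n \<Longrightarrow> cyclic_coeff u x = 0"
  unfolding commutator_span_def
proof (induction rule: finite_sums.induct)
  case zero
  show ?case by (simp add: cyclic_coeff_def lin_0)
next
  case (add x y)
  then have "cyclic_coeff u x = 0" using cyclic_coeff_commutator by blast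
  then show ?case using add.IH by (simp add: cyclic_coeff_def lin_add)
qed

lemma polyfuns_prod: "(\<And>i. i \<in> I \<Longrightarrow> f i \<in> polyfuns n m p r) \<Longrightarrow> (\<lambda>e. \<Prod>i\<in>I. f i e) \<in> polyfuns n m p r"
  by (induction I rule: infinite_finite_induct) (simp_all add: polyfuns_const polyfuns_mult)

lemma polyfuns_cyclic_coeff:
  assumes m: "\<And>i. i < n \<Longrightarrow> m i > 0" and j: "j < p"
  shows "(\<lambda>e. cyclic_coeff u (e j)) \<in> polyfuns n m p r"
proof -
  let ?W = "{w. set w \<subseteq> {..<n} \<and> word_degree m w = r j}"
  let ?h = "\<lambda>w. if \<exists>k. w = rotate k u then 1 else (0::complex)"
  have fin: "finite ?W" by (rule finite_words) (rule m)
  have "(\<lambda>e. \<Sum>w\<in>?W. lookup (e j) w * ?h w) \<in> polyfuns n m p r"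
    by (intro polyfuns_sum polyfuns_mult polyfuns_coord polyfuns_const)
  then show ?thesis
  proof (rule polyfuns_cong)
    fix e assume "e \<in> relation_space n m p r"
    then have "keys (e j) \<subseteq> ?W" using j by (auto simp: relation_space_def TV_component_def TV_def)
    then show "(\<Sum>w\<in>?W. lookup (e j) w * ?h w) = cyclic_coeff u (e j)"
      unfolding cyclic_coeff_def by (rule lin_superset[OF fin, symmetric])
  qed
qed

text \<open>Two different conjugate words overlap, so the matrix of cyclic coefficients is the identity for
  the relations \<open>w j\<close>.\<close>

lemma non_overlapping_not_conjugate:
  assumes "non_overlapping u v" "v = rotate k u"
  shows "v = u"
proof (rule ccontr)
  assume ne: "v \<noteq> u"
  let ?k = "k mod length u"
  let ?a = "take ?k u" and ?b = "drop ?k u"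
  have v: "v = ?b @ ?a" using assms(2) by (simp add: rotate_drop_take)
  have u: "u = ?a @ ?b" by simp
  have "?a \<noteq> []"
  proof
    assume a: "?a = []"
    have "v = ?b" using v unfolding a by simp
    moreover have "u = ?b" using u unfolding a by simp
    ultimately show False using ne by simp
  qed
  moreover have "prefix ?a u" by (rule take_is_prefix)
  moreover have "suffix ?a v" using v by (metis suffixI)
  ultimately show False using assms(1) ne unfolding non_overlapping_def by blast
qed

text \<open>If a combination of relations is a sum of commutators, its coefficients form a kernel
  vector of the matrix of cyclic coefficients. The determinant of this matrix is the required
  polynomial.\<close>

lemma generic_independent:
  assumes w: "\<And>j. j < p \<Longrightarrow> set (w j) \<subseteq> {..<n}" "inj_on w {..<p}"
      "\<And>i j. i < p \<Longrightarrow> j < p \<Longrightarrow> non_overlapping (w i) (w j)"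
    and m: "\<And>i. i < n \<Longrightarrow> m i > 0"
  shows "\<exists>f\<in>polyfuns n m p r. f (word_relations p w) \<noteq> 0 \<and>
    (\<forall>e. f e \<noteq> 0 \<longrightarrow> independent_mod_commutators n p e)"
proof -
  define G where "G e = mat p p (\<lambda>(i, j). cyclic_coeff (w i) (e j))" for e
  have "(\<lambda>e. det (G e)) = (\<lambda>e. \<Sum>\<pi> | \<pi> permutes {0..<p}. signof \<pi> * (\<Prod>i = 0..<p. cyclic_coeff (w i) (e (\<pi> i))))"
    unfolding det_def G_def by (intro ext) (auto intro!: sum.cong prod.cong simp: permutes_in_image)
  also have "\<dots> \<in> polyfuns n m p r"
  proof (intro polyfuns_sum polyfuns_mult polyfuns_const polyfuns_prod polyfuns_cyclic_coeff m)
    fix \<pi> i assume "\<pi> \<in> {\<pi>. \<pi> permutes {0..<p}}" "i \<in> {0..<p}"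
    then show "\<pi> i < p" using permutes_in_image[of \<pi> "{0..<p}" i] by simp
  qed
  finally have poly: "(\<lambda>e. det (G e)) \<in> polyfuns n m p r" .
  have "G (word_relations p w) = 1\<^sub>m p"
  proof (rule eq_matI)
    fix i j assume "i < dim_row (1\<^sub>m p :: complex mat)" "j < dim_col (1\<^sub>m p :: complex mat)"
    then have ij: "i < p" "j < p" by auto
    have "(\<exists>k. w j = rotate k (w i)) \<longleftrightarrow> i = j"
    proof
      assume "\<exists>k. w j = rotate k (w i)"
      then have "w j = w i" using non_overlapping_not_conjugate[OF w(3)[OF ij]] by blast
      then show "i = j" using w(2) ij by (auto dest: inj_onD)
    next
      assume "i = j"
      then show "\<exists>k. w j = rotate k (w i)" by (intro exI[of _ 0]) simp
    qed
    then show "G (word_relations p w) $$ (i, j) = 1\<^sub>m p $$ (i, j)"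
      using ij by (simp add: G_def cyclic_coeff_def word_relations_def lin_single)
  qed (simp_all add: G_def)
  then have "det (G (word_relations p w)) \<noteq> 0" by simp
  moreover have "independent_mod_commutators n p e" if e: "det (G e) \<noteq> 0" for e
    unfolding independent_mod_commutators_def
  proof (intro allI impI)
    fix c j assume c: "(\<Sum>j<p. const_poly (c j) * e j) \<in> commutator_span n" and j: "j < p"
    have Gc: "G e \<in> carrier_mat p p" by (simp add: G_def)
    have "G e *\<^sub>v vec p c = 0\<^sub>v p"
    proof (rule eq_vecI)
      fix i assume "i < dim_vec (0\<^sub>v p :: complex vec)"
      then have i: "i < p" by simp
      have "(G e *\<^sub>v vec p c) $ i = (\<Sum>j<p. c j * cyclic_coeff (w i) (e j))"
        using i by (simp add: G_def scalar_prod_def lessThan_atLeast0 mult.commute)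
      also have "\<dots> = cyclic_coeff (w i) (\<Sum>j<p. const_poly (c j) * e j)"
        by (simp add: cyclic_coeff_def lin_sum lin_const_mult)
      also have "\<dots> = 0" using c by (rule cyclic_coeff_commutator_span)
      finally show "(G e *\<^sub>v vec p c) $ i = 0\<^sub>v p $ i" using i by simp
    qed (simp add: G_def)
    then have "vec p c = 0\<^sub>v p" using det_0_iff_vec_prod_zero[OF Gc] e vec_carrier by blast
    then show "c j = 0" using j by (metis index_vec index_zero_vec(1))
  qed
  ultimately show ?thesis using poly by (intro bexI[of _ "\<lambda>e. det (G e)"] conjI allI impI)
qed

text \<open>The value of \<open>d\<close> depends on \<open>R\<close> and \<open>N\<close> but not
  on \<open>k\<close>. All the resulting open sets contain the tuple of words, so none of them is
  empty.\<close>

lemma generic_exactness: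
  assumes "admissible n m p r"
  shows "weil_generic n m p r (\<lambda>e. independent_mod_commutators n p e \<and>
    (\<forall>R N. \<exists>d>N. \<forall>k>0. koszul_exact n m p r e d k R))"
proof -
  obtain w :: "nat \<Rightarrow> nat list" where m: "\<And>i. i < n \<Longrightarrow> m i > 0"
    and w: "\<And>j. j < p \<Longrightarrow> set (w j) \<subseteq> {..<n}" "inj_on w {..<p}"
      "\<And>i j. i < p \<Longrightarrow> j < p \<Longrightarrow> non_overlapping (w i) (w j)"
    and r: "\<And>j. j < p \<Longrightarrow> word_degree m (w j) = r j"
    using assms unfolding admissible_def by blast
  let ?e0 = "word_relations p w"
  \<comment> \<open>A number above \<open>N\<close> that also exceeds each of the block counts for
    \<open>q \<le> R\<close>, since their sum does.\<close>
  define D where "D R N = Suc (N + (\<Sum>q\<le>R. card (words.blocks p q w)))" for R N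
  have D: "card (words.blocks p q w) < D R N" if "q \<le> R" for q R N
    using member_le_sum[of q "{..R}" "\<lambda>q. card (words.blocks p q w)"] that by (simp add: D_def)
  obtain f0 where f0: "f0 \<in> polyfuns n m p r" "f0 ?e0 \<noteq> 0"
    "\<And>e. f0 e \<noteq> 0 \<Longrightarrow> independent_mod_commutators n p e"
    using generic_independent[of p w n m r, OF w m] by blast
  have "\<exists>f\<in>polyfuns n m p r. f ?e0 \<noteq> 0 \<and>
      (\<forall>e\<in>relation_space n m p r. f e \<noteq> 0 \<longrightarrow> koszul_exact n m p r e (D R N) (Suc k) R)" for R N k
    by (rule generic_koszul_exact[of p w n m, OF w m r D]) auto
  then obtain f where f: "\<And>R N k. f R N k \<in> polyfuns n m p r" "\<And>R N k. f R N k ?e0 \<noteq> 0"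
    "\<And>R N k e. e \<in> relation_space n m p r \<Longrightarrow> f R N k e \<noteq> 0 \<Longrightarrow> koszul_exact n m p r e (D R N) (Suc k) R"
    by metis
  define U where "U g = {e \<in> relation_space n m p r. g e \<noteq> 0}" for g :: "(nat \<Rightarrow> ncpoly) \<Rightarrow> complex"
  have e0: "?e0 \<in> relation_space n m p r" using w(1) r by (rule word_relations_in_space)
  let ?\<U> = "insert (U f0) (range (\<lambda>(R, N, k). U (f R N k)))"
  show ?thesis
    unfolding weil_generic_def
  proof (intro exI[of _ ?\<U>] conjI ballI)
    show "countable ?\<U>" by simp
  next
    fix V assume "V \<in> ?\<U>"
    then obtain g where g: "V = U g" "g \<in> polyfuns n m p r" "g ?e0 \<noteq> 0" using f f0 by auto
    then show "zariski_open n m p r V" "V \<noteq> {}" using zariski_open_polyfun e0 by (auto simp: U_def)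
  next
    fix e assume e: "e \<in> relation_space n m p r \<inter> \<Inter> ?\<U>"
    then have "f0 e \<noteq> 0" by (auto simp: U_def)
    then show "independent_mod_commutators n p e" by (rule f0(3))
  next
    fix e assume e: "e \<in> relation_space n m p r \<inter> \<Inter> ?\<U>"
    have nz: "f R N k e \<noteq> 0" for R N k
    proof -
      have "U (f R N k) \<in> ?\<U>" by (auto intro: rev_image_eqI[of "(R, N, k)"])
      then show ?thesis using e by (auto simp: U_def)
    qed
    show "\<forall>R N. \<exists>d>N. \<forall>k>0. koszul_exact n m p r e d k R"
    proof (intro allI)
      fix R N
      have "koszul_exact n m p r e (D R N) k R" if "k > 0" for k
        using f(3)[of e R N "k - 1"] e nz that by simp
      moreover have "D R N > N" by (simp add: D_def)
      ultimately show "\<exists>d>N. \<forall>k>0. koszul_exact n m p r e d k R" by blast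
    qed
  qed
qed

section \<open>The dual basis and the pullback\<close>

lemma single_Nil: "single [] c = const_poly c"
  by (simp add: zero_list_def)

lemma lin_one: "lin h 1 = h 0" for h :: "'a::zero \<Rightarrow> 'r::semiring_1"
  using lin_single[of h 0 1] by simp

text \<open>Distinct monomials are distinct characters of a monoid of points, hence linearly independent.\<close>

lemma poly_value_eq_0:
  assumes "\<And>x. lin (mono_value x) g = 0"
  shows "g = 0"
  using assms
proof (induction "card (keys g)" arbitrary: g rule: less_induct)
  case less
  show ?case
  proof (rule ccontr)
    assume "g \<noteq> 0"
    then have "keys g \<noteq> {}" by simp
    then obtain \<mu> where \<mu>: "\<mu> \<in> keys g" by blast
    show False
    proof (cases "keys g = {\<mu>}")
      case True
      have "lin (mono_value (\<lambda>_. 1)) g = lookup g \<mu>" by (simp add: lin_def True mono_value_def)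
      then show False using less.prems \<mu> by (simp add: in_keys_iff)
    next
      case False
      then obtain \<nu> where \<nu>: "\<nu> \<in> keys g" "\<nu> \<noteq> \<mu>" using \<mu> by blast
      then obtain v where v: "lookup \<nu> v \<noteq> lookup \<mu> v" by (metis poly_mapping_eqI)
      \<comment> \<open>At this point the monomials \<nu> and \<mu> take different values, namely
        powers of 2 with different exponents.\<close>
      define y where "y u = (if u = v then 2 else (1::complex))" for u
      have my: "mono_value y \<kappa> = 2 ^ lookup \<kappa> v" for \<kappa>
      proof -
        have "mono_value y \<kappa> = (\<Prod>u\<in>insert v (keys \<kappa>). y u ^ lookup \<kappa> u)"
          by (intro mono_value_superset) auto
        also have "\<dots> = (\<Prod>u\<in>insert v (keys \<kappa>). if u = v then 2 ^ lookup \<kappa> v else 1)"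
          by (intro prod.cong) (auto simp: y_def)
        finally show ?thesis by simp
      qed
      have mult: "mono_value (\<lambda>u. x u * y u) \<kappa> = mono_value x \<kappa> * mono_value y \<kappa>" for x \<kappa>
        by (simp add: mono_value_def power_mult_distrib prod.distrib)
      \<comment> \<open>The value of \<open>h\<close> at x is g(x y) minus the value of \<mu> at y
        times g(x). The term \<mu> drops out and the term \<nu> survives.\<close>
      define h where "h = (\<Sum>\<kappa>\<in>keys g. single \<kappa> (lookup g \<kappa> * (mono_value y \<kappa> - mono_value y \<mu>)))"
      have hl: "lookup h \<kappa> = lookup g \<kappa> * (mono_value y \<kappa> - mono_value y \<mu>)" for \<kappa>
      proof -
        have "lookup h \<kappa> = (\<Sum>\<kappa>'\<in>keys g. if \<kappa>' = \<kappa> then lookup g \<kappa> * (mono_value y \<kappa> - mono_value y \<mu>) else 0)"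
          unfolding h_def lookup_sum by (intro sum.cong refl) (auto simp: lookup_single when_def)
        then show ?thesis by (simp add: in_keys_iff)
      qed
      have "lin (mono_value x) h = 0" for x
      proof -
        have "lin (mono_value x) h = (\<Sum>\<kappa>\<in>keys g. lookup h \<kappa> * mono_value x \<kappa>)"
          by (intro lin_superset) (auto simp: in_keys_iff hl)
        also have "\<dots> = lin (mono_value (\<lambda>u. x u * y u)) g - mono_value y \<mu> * lin (mono_value x) g"
          by (simp add: hl lin_def mult sum_distrib_left sum_subtractf algebra_simps)
        finally show ?thesis using less.prems by simp
      qed
      moreover have "keys h \<subset> keys g"
        using \<mu> by (auto simp: in_keys_iff hl psubset_eq)
      then have "card (keys h) < card (keys g)" by (simp add: psubset_card_mono)
      ultimately have "h = 0" by (intro less.hyps) auto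
      then have "lookup g \<nu> * (mono_value y \<nu> - mono_value y \<mu>) = 0" using hl[of \<nu>] by simp
      moreover have "(2::complex) ^ lookup \<nu> v \<noteq> 2 ^ lookup \<mu> v"
      proof
        assume "(2::complex) ^ lookup \<nu> v = 2 ^ lookup \<mu> v"
        then have "cmod (2 ^ lookup \<nu> v) = cmod (2 ^ lookup \<mu> v)" by simp
        then have "(2::real) ^ lookup \<nu> v = 2 ^ lookup \<mu> v" by (simp add: norm_power)
        then show False using v by simp
      qed
      ultimately show False using \<nu>(1) my by (simp add: in_keys_iff)
    qed
  qed
qed

lemma mono_value_cong: "(\<And>v. v \<in> keys \<mu> \<Longrightarrow> x v = y v) \<Longrightarrow> mono_value x \<mu> = mono_value y \<mu>"
  by (simp add: mono_value_def)

lemma coord_value_lin: "coord_value \<rho> = lin (mono_value (\<lambda>(i, a, b). \<rho> i $$ (a, b)))"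
  by (simp add: coord_value_def poly_value_lin)

lemma coord_ring_iff: "g \<in> coord_ring n d \<longleftrightarrow> (\<forall>\<mu>\<in>keys g. keys \<mu> \<subseteq> idxs n d)"
  by (simp add: coord_ring_def idxs_def)

lemma coord_ring_add: "f \<in> coord_ring n d \<Longrightarrow> g \<in> coord_ring n d \<Longrightarrow> f + g \<in> coord_ring n d"
  unfolding coord_ring_iff
proof
  fix \<mu> assume fg: "\<forall>\<mu>\<in>keys f. keys \<mu> \<subseteq> idxs n d" "\<forall>\<mu>\<in>keys g. keys \<mu> \<subseteq> idxs n d" "\<mu> \<in> keys (f + g)"
  then have "\<mu> \<in> keys f \<or> \<mu> \<in> keys g" using keys_add[of f g] by blast
  then show "keys \<mu> \<subseteq> idxs n d" using fg(1,2) by metis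
qed

lemma coord_ring_uminus: "f \<in> coord_ring n d \<Longrightarrow> - f \<in> coord_ring n d"
  unfolding coord_ring_iff by simp

lemma coord_ring_mult: "f \<in> coord_ring n d \<Longrightarrow> g \<in> coord_ring n d \<Longrightarrow> f * g \<in> coord_ring n d"
  unfolding coord_ring_iff
proof
  fix \<mu> assume fg: "\<forall>\<mu>\<in>keys f. keys \<mu> \<subseteq> idxs n d" "\<forall>\<mu>\<in>keys g. keys \<mu> \<subseteq> idxs n d" "\<mu> \<in> keys (f * g)"
  obtain a b where "a \<in> keys f" "b \<in> keys g" "\<mu> = a + b" using fg(3) by (rule keys_multE)
  then show "keys \<mu> \<subseteq> idxs n d" using fg(1,2) by (simp add: keys_add_nat)
qed

lemma coord_ring_const: "const_poly c \<in> coord_ring n d"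
  unfolding coord_ring_iff by simp

lemma coord_ring_0: "0 \<in> coord_ring n d"
  unfolding coord_ring_iff by simp

lemma coord_ring_1: "1 \<in> coord_ring n d"
  unfolding coord_ring_iff by simp

lemma coord_ring_sum: "(\<And>i. i \<in> I \<Longrightarrow> f i \<in> coord_ring n d) \<Longrightarrow> (\<Sum>i\<in>I. f i) \<in> coord_ring n d"
  by (induction I rule: infinite_finite_induct) (simp_all add: coord_ring_0 coord_ring_add)

text \<open>This is the uniqueness that makes the definite description in \<open>pullback\<close>
  meaningful.\<close>

lemma coord_value_inject:
  assumes g: "g \<in> coord_ring n d" "h \<in> coord_ring n d"
    and eq: "\<And>\<rho>. \<rho> \<in> V_rep n d \<Longrightarrow> coord_value \<rho> g = coord_value \<rho> h"
  shows "g = h"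
proof -
  have "lin (mono_value x) (g - h) = 0" for x
  proof -
    define \<rho> where "\<rho> i = (if i < n then mat d d (\<lambda>(a, b). x (i, a, b)) else 0\<^sub>m d d)" for i
    have "\<rho> \<in> V_rep n d" by (simp add: V_rep_def \<rho>_def)
    then have "coord_value \<rho> (g - h) = 0" using eq by (simp add: coord_value_lin lin_diff)
    moreover have "g - h \<in> coord_ring n d"
      using coord_ring_add[OF g(1) coord_ring_uminus[OF g(2)]] by simp
    moreover have "mono_value (\<lambda>(i, a, b). \<rho> i $$ (a, b)) \<mu> = mono_value x \<mu>" if "\<mu> \<in> keys (g - h)" for \<mu>
    proof (intro mono_value_cong)
      fix v assume v: "v \<in> keys \<mu>"
      have "keys \<mu> \<subseteq> idxs n d" using \<open>g - h \<in> coord_ring n d\<close> that unfolding coord_ring_iff by metis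
      then have "v \<in> idxs n d" using v by blast
      then show "(\<lambda>(i, a, b). \<rho> i $$ (a, b)) v = x v" by (auto simp: idxs_def \<rho>_def)
    qed
    ultimately show ?thesis by (simp add: coord_value_lin lin_def)
  qed
  then have "g - h = 0" by (rule poly_value_eq_0)
  then show ?thesis by simp
qed

lemma word_value_carrier: "\<rho> \<in> V_rep n d \<Longrightarrow> word_value d \<rho> w \<in> carrier_mat d d"
proof (induction w)
  case (Cons i w)
  have "\<rho> i \<in> carrier_mat d d" using Cons.prems by (cases "i < n") (auto simp: V_rep_def)
  then show ?case using Cons by (simp add: word_value_def)
qed (simp add: word_value_def)

text \<open>Multiplying by a matrix on the left sums over the first vertex reached, which is also
  how the set of paths decomposes.\<close>

lemma coord_value_word_poly:
  assumes \<rho>: "\<rho> \<in> V_rep n d" and b: "b < d"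
  shows "a < d \<Longrightarrow> coord_value \<rho> (word_poly d w a b) = word_value d \<rho> w $$ (a, b)"
proof (induction w arbitrary: a)
  case Nil
  then show ?case using b
    by (simp add: word_poly_def paths_Nil word_value_def coord_value_lin lin_one lin_0 mon_simps mono_value_0)
next
  case (Cons i w)
  have c: "\<rho> i \<in> carrier_mat d d" using \<rho> by (cases "i < n") (auto simp: V_rep_def)
  let ?x = "\<lambda>(i, a, b). \<rho> i $$ (a, b)"
  have disj: "c \<noteq> c' \<Longrightarrow> (#) (i, a, c) ` S \<inter> (#) (i, a, c') ` S' = {}" for c c' S S' by auto
  have "coord_value \<rho> (word_poly d (i # w) a b) = (\<Sum>es\<in>paths d (i # w) a b. mono_value ?x (mon_of es))"
    by (simp add: word_poly_def coord_value_lin lin_sum lin_single)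
  also have "\<dots> = (\<Sum>c<d. \<Sum>es\<in>(#) (i, a, c) ` paths d w c b. mono_value ?x (mon_of es))"
    unfolding paths_Cons by (intro sum.UNION_disjoint) (auto simp: finite_paths)
  also have "\<dots> = (\<Sum>c<d. \<rho> i $$ (a, c) * coord_value \<rho> (word_poly d w c b))"
  proof (intro sum.cong refl)
    fix c
    have "(\<Sum>es\<in>(#) (i, a, c) ` paths d w c b. mono_value ?x (mon_of es)) =
        (\<Sum>es\<in>paths d w c b. mono_value ?x (mon_of ((i, a, c) # es)))"
      by (subst sum.reindex) auto
    also have "\<dots> = (\<Sum>es\<in>paths d w c b. \<rho> i $$ (a, c) * mono_value ?x (mon_of es))"
      by (intro sum.cong refl) (simp only: mon_simps mono_value_add mono_value_single prod.case)
    also have "\<dots> = \<rho> i $$ (a, c) * coord_value \<rho> (word_poly d w c b)"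
      by (simp add: word_poly_def coord_value_lin lin_sum lin_single sum_distrib_left)
    finally show "(\<Sum>es\<in>(#) (i, a, c) ` paths d w c b. mono_value ?x (mon_of es)) =
        \<rho> i $$ (a, c) * coord_value \<rho> (word_poly d w c b)" .
  qed
  also have "\<dots> = (\<Sum>c<d. \<rho> i $$ (a, c) * word_value d \<rho> w $$ (c, b))"
    by (intro sum.cong refl) (simp add: Cons.IH)
  also have "\<dots> = word_value d \<rho> (i # w) $$ (a, b)"
    using c word_value_carrier[OF \<rho>, of w] Cons.prems b
    by (simp add: word_value_def scalar_prod_def lessThan_atLeast0)
  finally show ?case .
qed

lemma TV_value_index: "a < d \<Longrightarrow> b < d \<Longrightarrow> TV_value d \<rho> x $$ (a, b) = lin (\<lambda>w. word_value d \<rho> w $$ (a, b)) x"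
  by (simp add: TV_value_def lin_def)

lemma TV_value_dim: "dim_row (TV_value d \<rho> x) = d" "dim_col (TV_value d \<rho> x) = d"
  by (simp_all add: TV_value_def)

lemma TV_value_carrier: "TV_value d \<rho> x \<in> carrier_mat d d"
  by (simp add: TV_value_def)

lemma TV_value_add: "TV_value d \<rho> (x + y) = TV_value d \<rho> x + TV_value d \<rho> y"
  by (rule eq_matI) (simp_all add: TV_value_dim TV_value_index lin_add)

lemma TV_value_scale: "TV_value d \<rho> (const_poly c * x) = c \<cdot>\<^sub>m TV_value d \<rho> x"
  by (rule eq_matI) (simp_all add: TV_value_dim TV_value_index lin_const_mult)

lemma coord_value_entry:
  assumes \<rho>: "\<rho> \<in> V_rep n d" and ab: "a < d" "b < d"
  shows "coord_value \<rho> (entry e d (j, a, b)) = TV_value d \<rho> (e j) $$ (a, b)"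
proof -
  have "coord_value \<rho> (entry e d (j, a, b)) =
      (\<Sum>w\<in>keys (e j). lookup (e j) w * coord_value \<rho> (word_poly d w a b))"
    by (simp add: entry_def coord_value_lin lin_sum lin_const_mult)
  then show ?thesis using coord_value_word_poly[OF \<rho> ab(2,1)] ab by (simp add: TV_value_index lin_def)
qed

section \<open>Coordinates on the relation span and on its matrix maps\<close>

locale relations =
  fixes n p d :: nat and m r :: "nat \<Rightarrow> nat" and e :: "nat \<Rightarrow> ncpoly"
  assumes e: "e \<in> relation_space n m p r"
    and independent: "independent_mod_commutators n p e"
begin

definition comb :: "(nat \<Rightarrow> complex) \<Rightarrow> ncpoly" where
  "comb c = (\<Sum>j<p. const_poly (c j) * e j)"

lemma L_span_comb: "L_span p e = range comb"
  by (auto simp: L_span_def comb_def single_Nil)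

lemma comb_add: "comb c + comb c' = comb (\<lambda>j. c j + c' j)"
  by (simp add: comb_def single_add distrib_right sum.distrib)

lemma comb_scale: "const_poly z * comb c = comb (\<lambda>j. z * c j)"
  by (simp add: comb_def sum_distrib_left const_poly_mult mult.assoc)

lemma L_span_add: "x \<in> L_span p e \<Longrightarrow> y \<in> L_span p e \<Longrightarrow> x + y \<in> L_span p e"
  unfolding L_span_comb by (auto simp: comb_add)

lemma L_span_scale: "x \<in> L_span p e \<Longrightarrow> const_poly z * x \<in> L_span p e"
  unfolding L_span_comb by (auto simp: comb_scale)

lemma comb_independent: "comb c \<in> commutator_span n \<Longrightarrow> j < p \<Longrightarrow> c j = 0"
  using independent unfolding independent_mod_commutators_def comb_def by (elim allE[of _ c]) simp

text \<open>Zero is a sum of commutators, so independence modulo commutators contains linear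
  independence.\<close>

lemma comb_inject:
  assumes "comb c = comb c'" "j < p"
  shows "c j = c' j"
proof -
  have "comb (\<lambda>j. c j - c' j) = comb c - comb c'"
    by (simp add: comb_def single_diff left_diff_distrib sum_subtractf)
  then have "comb (\<lambda>j. c j - c' j) \<in> commutator_span n"
    using assms(1) by (simp add: commutator_span_def finite_sums.zero)
  from comb_independent[OF this assms(2)] show ?thesis by simp
qed

text \<open>Coordinates with respect to the relations. The choice is determined only at indices
  below \<open>p\<close>, and only these enter \<open>comb\<close>.\<close>

definition coeff_of :: "ncpoly \<Rightarrow> nat \<Rightarrow> complex" where
  "coeff_of x = (SOME c. x = comb c)"

lemma coeff_of_comb: "j < p \<Longrightarrow> coeff_of (comb c) j = c j"
  unfolding coeff_of_def by (rule comb_inject[symmetric]) (rule someI[of "\<lambda>c'. comb c = comb c'"], rule refl)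

lemma e_comb: "j < p \<Longrightarrow> e j = comb (\<lambda>i. if i = j then 1 else 0)"
proof -
  assume j: "j < p"
  have "comb (\<lambda>i. if i = j then 1 else 0) = (\<Sum>i<p. if i = j then e j else 0)"
    unfolding comb_def by (intro sum.cong refl) auto
  then show ?thesis using j by simp
qed

lemma e_in_L_span: "j < p \<Longrightarrow> e j \<in> L_span p e"
  using e_comb L_span_comb by (metis rangeI)

lemma zero_comb: "0 = comb (\<lambda>_. 0)"
  by (simp add: comb_def)

lemma zero_in_L_span: "0 \<in> L_span p e"
  using zero_comb L_span_comb by (metis rangeI)

lemma L_circ_zero: "x \<in> L_circ n p e \<Longrightarrow> x = 0"
proof -
  assume x: "x \<in> L_circ n p e"
  then obtain c where c: "x = comb c" by (auto simp: L_circ_def L_span_comb)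
  then have "\<forall>j<p. c j = 0" using x comb_independent by (auto simp: L_circ_def)
  then show "x = 0" using c by (simp add: comb_def)
qed

definition coord_map :: "(idx \<Rightarrow> complex) \<Rightarrow> matrix_map" where
  "coord_map g = (\<lambda>x. if x \<in> L_span p e
     then mat d d (\<lambda>(a, b). \<Sum>j<p. g (j, a, b) * coeff_of x j) else 0\<^sub>m d d)"

lemma coord_map_comb: "coord_map g (comb c) = mat d d (\<lambda>(a, b). \<Sum>j<p. g (j, a, b) * c j)"
  unfolding coord_map_def by (auto simp: L_span_comb coeff_of_comb intro!: eq_matI)

lemma coord_map_e: "j < p \<Longrightarrow> coord_map g (e j) = mat d d (\<lambda>(a, b). g (j, a, b))"
  by (subst e_comb) (auto simp: coord_map_comb if_distrib[of "(*) _"] cong: if_cong)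

text \<open>The trace conditions are imposed on \<open>L_circ\<close>, which contains nothing but 0,
  and there they follow from linearity.\<close>

lemma in_L_sharpI:
  assumes "\<phi> \<in> L_rep p e d"
  shows "\<phi> \<in> L_sharp n p e d"
proof -
  have "mat_tr (\<phi> x) = 0" if x: "x \<in> L_circ n p e" for x
  proof -
    have x0: "x = 0" by (rule L_circ_zero[OF x])
    have car: "\<phi> 0 \<in> carrier_mat d d" using assms zero_in_L_span by (simp add: L_rep_def)
    have "\<phi> (single [] 0 * 0) = 0 \<cdot>\<^sub>m \<phi> 0" using assms zero_in_L_span unfolding L_rep_def by blast
    then have "\<phi> 0 = 0 \<cdot>\<^sub>m \<phi> 0" by simp
    then have "\<phi> 0 $$ (i, i) = 0" if "i < d" for i using car that by (metis carrier_matD index_smult_mat(1) mult_zero_left)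
    then show ?thesis using car by (simp add: mat_tr_def x0)
  qed
  then show ?thesis using assms by (simp add: L_sharp_def)
qed

lemma coord_map_in_L_sharp: "coord_map g \<in> L_sharp n p e d"
proof (rule in_L_sharpI, unfold L_rep_def, intro CollectI conjI ballI allI impI)
  fix x y assume "x \<in> L_span p e" "y \<in> L_span p e"
  then obtain c c' where xy: "x = comb c" "y = comb c'" by (auto simp: L_span_comb)
  show "coord_map g (x + y) = coord_map g x + coord_map g y"
    unfolding xy comb_add coord_map_comb
    by (auto intro!: eq_matI simp: distrib_left sum.distrib)
next
  fix c x assume "x \<in> L_span p e"
  then obtain c' where x: "x = comb c'" by (auto simp: L_span_comb)
  show "coord_map g (single [] c * x) = c \<cdot>\<^sub>m coord_map g x"
    unfolding x single_Nil comb_scale coord_map_comb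
    by (auto intro!: eq_matI simp: sum_distrib_left mult.left_commute)
qed (simp_all add: coord_map_def)

lemma L_sharp_expand:
  assumes "\<phi> \<in> L_sharp n p e d"
  shows "\<phi> = coord_map (\<lambda>(j, a, b). \<phi> (e j) $$ (a, b))"
proof
  have \<phi>: "\<phi> \<in> L_rep p e d" using assms by (simp add: L_sharp_def)
  have car: "\<phi> x \<in> carrier_mat d d" if "x \<in> L_span p e" for x using \<phi> that by (simp add: L_rep_def)
  have add: "\<phi> (x + y) = \<phi> x + \<phi> y" if "x \<in> L_span p e" "y \<in> L_span p e" for x y
    using \<phi> that by (simp add: L_rep_def)
  have scale: "\<phi> (const_poly c * x) = c \<cdot>\<^sub>m \<phi> x" if "x \<in> L_span p e" for x c
    using \<phi> that by (simp add: L_rep_def single_Nil)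
  have part: "(\<Sum>j\<in>J. const_poly (c j) * e j) \<in> L_span p e \<and>
      \<phi> (\<Sum>j\<in>J. const_poly (c j) * e j) = mat d d (\<lambda>(a, b). \<Sum>j\<in>J. \<phi> (e j) $$ (a, b) * c j)"
    if "finite J" "J \<subseteq> {..<p}" for J c
    using that
  proof (induction J)
    case empty
    have "\<phi> (const_poly 0 * 0) = 0 \<cdot>\<^sub>m \<phi> 0" using scale[OF zero_in_L_span] .
    then have "\<phi> 0 = 0 \<cdot>\<^sub>m \<phi> 0" by simp
    also have "\<dots> = 0\<^sub>m d d" using car[OF zero_in_L_span] by (intro eq_matI) auto
    finally show ?case using zero_in_L_span by (auto intro!: eq_matI)
  next
    case (insert j J)
    let ?s = "\<Sum>j\<in>J. const_poly (c j) * e j"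
    have IH: "?s \<in> L_span p e" "\<phi> ?s = mat d d (\<lambda>(a, b). \<Sum>j\<in>J. \<phi> (e j) $$ (a, b) * c j)"
      using insert by auto
    have j: "e j \<in> L_span p e" using insert.prems by (intro e_in_L_span) auto
    have cj: "const_poly (c j) * e j \<in> L_span p e"
      using j by (rule L_span_scale)
    have "const_poly (c j) * e j + ?s \<in> L_span p e"
      using cj IH(1) by (rule L_span_add)
    moreover have "\<phi> (const_poly (c j) * e j + ?s) = c j \<cdot>\<^sub>m \<phi> (e j) + \<phi> ?s"
      using add[OF cj IH(1)] scale[OF j] by simp
    ultimately show ?case
      using insert.hyps car[OF j] by (auto intro!: eq_matI simp: IH(2) mult.commute)
  qed
  fix x
  show "\<phi> x = coord_map (\<lambda>(j, a, b). \<phi> (e j) $$ (a, b)) x"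
  proof (cases "x \<in> L_span p e")
    case True
    then obtain c where x: "x = comb c" by (auto simp: L_span_comb)
    show ?thesis using part[of "{..<p}" c] unfolding x coord_map_comb by (simp add: comb_def)
  next
    case False
    then have "\<phi> x = 0\<^sub>m d d" using \<phi> by (simp add: L_rep_def)
    then show ?thesis using False by (simp add: coord_map_def)
  qed
qed

text \<open>The basis of \<open>L_sharp\<close> dual to the entry functionals
  \<open>eps\<close>.\<close>

definition delta :: "idx \<Rightarrow> matrix_map" where
  "delta \<alpha> = coord_map (\<lambda>\<beta>. if \<beta> = \<alpha> then 1 else 0)"

definition eps :: "idx \<Rightarrow> functional" where
  "eps = (\<lambda>(j, a, b) \<phi>. if \<phi> \<in> L_sharp n p e d then \<phi> (e j) $$ (a, b) else 0)"

lemma coord_map_add: "coord_map (\<lambda>\<alpha>. g \<alpha> + h \<alpha>) = (\<lambda>x. coord_map g x + coord_map h x)"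
  unfolding coord_map_def by (auto intro!: ext eq_matI simp: distrib_right sum.distrib)

lemma coord_map_scale: "coord_map (\<lambda>\<alpha>. c * g \<alpha>) = (\<lambda>x. c \<cdot>\<^sub>m coord_map g x)"
  unfolding coord_map_def by (auto intro!: ext eq_matI simp: sum_distrib_left mult.assoc)

lemma L_sharp_dualD:
  assumes "f \<in> L_sharp_dual n p e d"
  shows "f (coord_map (\<lambda>\<alpha>. g \<alpha> + h \<alpha>)) = f (coord_map g) + f (coord_map h)"
    "f (coord_map (\<lambda>\<alpha>. c * g \<alpha>)) = c * f (coord_map g)"
  using assms coord_map_in_L_sharp unfolding coord_map_add coord_map_scale L_sharp_dual_def by blast+

lemma dual_coord_map:
  assumes f: "f \<in> L_sharp_dual n p e d"
  shows "f (coord_map g) = (\<Sum>\<alpha>\<in>idxs p d. g \<alpha> * f (delta \<alpha>))"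
proof -
  have part: "f (coord_map (\<lambda>\<alpha>. if \<alpha> \<in> A then g \<alpha> else 0)) = (\<Sum>\<alpha>\<in>A. g \<alpha> * f (delta \<alpha>))"
    if "finite A" for A
    using that
  proof (induction A)
    case empty
    show ?case using L_sharp_dualD(2)[OF f, of 0 "\<lambda>_. 0"] by simp
  next
    case (insert \<beta> A)
    have "(\<lambda>\<alpha>. if \<alpha> \<in> insert \<beta> A then g \<alpha> else 0) =
        (\<lambda>\<alpha>. g \<beta> * (if \<alpha> = \<beta> then 1 else 0) + (if \<alpha> \<in> A then g \<alpha> else 0))"
      using insert.hyps by auto
    then have "f (coord_map (\<lambda>\<alpha>. if \<alpha> \<in> insert \<beta> A then g \<alpha> else 0)) =
        g \<beta> * f (delta \<beta>) + f (coord_map (\<lambda>\<alpha>. if \<alpha> \<in> A then g \<alpha> else 0))"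
      by (simp only: L_sharp_dualD[OF f] delta_def)
    then show ?case using insert by simp
  qed
  have "coord_map g = coord_map (\<lambda>\<alpha>. if \<alpha> \<in> idxs p d then g \<alpha> else 0)"
    unfolding coord_map_def by (intro ext) (auto intro!: eq_matI sum.cong simp: idxs_def)
  then show ?thesis using part[OF finite_idxs] by metis
qed

lemma eps_coord_map: "\<alpha> \<in> idxs p d \<Longrightarrow> eps \<alpha> (coord_map g) = g \<alpha>"
  by (auto simp: eps_def coord_map_in_L_sharp coord_map_e idxs_def)

lemma eps_delta: "\<alpha> \<in> idxs p d \<Longrightarrow> eps \<alpha> (delta \<beta>) = (if \<alpha> = \<beta> then 1 else 0)"
  unfolding delta_def by (simp add: eps_coord_map)

lemma dual_expand:
  assumes f: "f \<in> L_sharp_dual n p e d" and \<phi>: "\<phi> \<in> L_sharp n p e d"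
  shows "f \<phi> = (\<Sum>\<alpha>\<in>idxs p d. f (delta \<alpha>) * eps \<alpha> \<phi>)"
proof -
  have "f \<phi> = f (coord_map (\<lambda>(j, a, b). \<phi> (e j) $$ (a, b)))" using L_sharp_expand[OF \<phi>] by simp
  also have "\<dots> = (\<Sum>\<alpha>\<in>idxs p d. (case \<alpha> of (j, a, b) \<Rightarrow> \<phi> (e j) $$ (a, b)) * f (delta \<alpha>))"
    by (rule dual_coord_map[OF f])
  also have "\<dots> = (\<Sum>\<alpha>\<in>idxs p d. f (delta \<alpha>) * eps \<alpha> \<phi>)"
    using \<phi> by (intro sum.cong refl) (auto simp: eps_def)
  finally show ?thesis .
qed

lemma L_sharp_add: "\<phi> \<in> L_sharp n p e d \<Longrightarrow> \<psi> \<in> L_sharp n p e d \<Longrightarrow> (\<lambda>x. \<phi> x + \<psi> x) \<in> L_sharp n p e d"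
proof -
  assume "\<phi> \<in> L_sharp n p e d" "\<psi> \<in> L_sharp n p e d"
  then obtain g h where "\<phi> = coord_map g" "\<psi> = coord_map h" using L_sharp_expand by blast
  then have "(\<lambda>x. \<phi> x + \<psi> x) = coord_map (\<lambda>\<alpha>. g \<alpha> + h \<alpha>)" by (simp only: coord_map_add)
  then show ?thesis by (simp only: coord_map_in_L_sharp)
qed

lemma L_sharp_scale: "\<phi> \<in> L_sharp n p e d \<Longrightarrow> (\<lambda>x. c \<cdot>\<^sub>m \<phi> x) \<in> L_sharp n p e d"
proof -
  assume "\<phi> \<in> L_sharp n p e d"
  then obtain g where "\<phi> = coord_map g" using L_sharp_expand by blast
  then have "(\<lambda>x. c \<cdot>\<^sub>m \<phi> x) = coord_map (\<lambda>\<alpha>. c * g \<alpha>)" by (simp only: coord_map_scale)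
  then show ?thesis by (simp only: coord_map_in_L_sharp)
qed

lemma weight_sub_dual: "L_sharp_dual_weight n m p e d s \<subseteq> L_sharp_dual n p e d"
proof
  fix f assume "f \<in> L_sharp_dual_weight n m p e d s"
  then obtain l where f: "f = (\<lambda>\<phi>. if \<phi> \<in> L_sharp n p e d then \<Sum>a<d. \<Sum>b<d. \<phi> (l a b) $$ (a, b) else 0)"
    and l: "\<And>a b. l a b \<in> L_span p e"
    unfolding L_sharp_dual_weight_def by blast
  have car: "\<phi> (l a b) \<in> carrier_mat d d" if "\<phi> \<in> L_sharp n p e d" for \<phi> a b
    using that l by (simp add: L_sharp_def L_rep_def)
  show "f \<in> L_sharp_dual n p e d"
    unfolding L_sharp_dual_def
  proof (intro CollectI conjI ballI allI impI)
    fix \<phi> \<psi> assume a: "\<phi> \<in> L_sharp n p e d" "\<psi> \<in> L_sharp n p e d"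
    have "(\<phi> (l i k) + \<psi> (l i k)) $$ (i, k) = \<phi> (l i k) $$ (i, k) + \<psi> (l i k) $$ (i, k)"
      if "i < d" "k < d" for i k
      using car[OF a(1), of i k] car[OF a(2), of i k] that by auto
    then show "f (\<lambda>x. \<phi> x + \<psi> x) = f \<phi> + f \<psi>"
      using a L_sharp_add[OF a] by (simp add: f sum.distrib)
  next
    fix c \<phi> assume a: "\<phi> \<in> L_sharp n p e d"
    have "(c \<cdot>\<^sub>m \<phi> (l i k)) $$ (i, k) = c * \<phi> (l i k) $$ (i, k)" if "i < d" "k < d" for i k
      using car[OF a, of i k] that by auto
    then show "f (\<lambda>x. c \<cdot>\<^sub>m \<phi> x) = c * f \<phi>"
      using a L_sharp_scale[OF a] by (simp add: f sum_distrib_left)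
  qed (simp add: f)
qed

lemma eps_weight:
  assumes "\<alpha> \<in> idxs p d"
  shows "eps \<alpha> \<in> L_sharp_dual_weight n m p e d (r (fst \<alpha>))"
proof -
  obtain j a0 b0 where \<alpha>: "\<alpha> = (j, a0, b0)" "j < p" "a0 < d" "b0 < d" using assms by (auto simp: idxs_def)
  define l where "l a b = (if a = a0 \<and> b = b0 then e j else 0)" for a b
  have l: "l a b \<in> L_span p e \<inter> TV_component n m (r j)" for a b
    using e_in_L_span[OF \<alpha>(2)] zero_in_L_span e \<alpha>(2)
    by (auto simp: l_def relation_space_def TV_component_def TV_def)
  have "eps \<alpha> \<phi> = (if \<phi> \<in> L_sharp n p e d then \<Sum>a<d. \<Sum>b<d. \<phi> (l a b) $$ (a, b) else 0)" for \<phi>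
  proof (cases "\<phi> \<in> L_sharp n p e d")
    case True
    have "\<phi> 0 = coord_map (\<lambda>(j, a, b). \<phi> (e j) $$ (a, b)) (comb (\<lambda>_. 0))"
      using L_sharp_expand[OF True] zero_comb by metis
    then have z: "\<phi> 0 $$ (a, b) = 0" if "a < d" "b < d" for a b using that by (simp add: coord_map_comb)
    have "(\<Sum>a<d. \<Sum>b<d. \<phi> (l a b) $$ (a, b)) =
        (\<Sum>a<d. \<Sum>b<d. if b = b0 then if a = a0 then \<phi> (e j) $$ (a0, b0) else 0 else 0)"
      by (intro sum.cong refl) (auto simp: l_def z)
    also have "\<dots> = \<phi> (e j) $$ (a0, b0)" using \<alpha> by simp
    finally show ?thesis using True \<alpha>(1) by (simp add: eps_def)
  qed (simp add: eps_def \<alpha>(1))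
  then have "eps \<alpha> = (\<lambda>\<phi>. if \<phi> \<in> L_sharp n p e d then \<Sum>a<d. \<Sum>b<d. \<phi> (l a b) $$ (a, b) else 0)"
    by (rule ext)
  then show ?thesis unfolding L_sharp_dual_weight_def using l \<alpha>(1) by auto
qed

lemma eps_dual: "\<alpha> \<in> idxs p d \<Longrightarrow> eps \<alpha> \<in> L_sharp_dual n p e d"
  using eps_weight weight_sub_dual by blast

text \<open>A homogeneous combination of independent homogeneous relations involves only relations
  of its own degree, so a functional of weight s does not see the basis vectors of other
  weights.\<close>

lemma dual_weight_delta:
  assumes f: "f \<in> L_sharp_dual_weight n m p e d s" and \<alpha>: "\<alpha> \<in> idxs p d" and nz: "f (delta \<alpha>) \<noteq> 0"
  shows "r (fst \<alpha>) = s"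
proof (rule ccontr)
  assume ne: "r (fst \<alpha>) \<noteq> s"
  obtain j a0 b0 where jab: "\<alpha> = (j, a0, b0)" "j < p" using \<alpha> by (auto simp: idxs_def)
  obtain l where fl: "f = (\<lambda>\<phi>. if \<phi> \<in> L_sharp n p e d then \<Sum>a<d. \<Sum>b<d. \<phi> (l a b) $$ (a, b) else 0)"
    and l: "\<And>a b. l a b \<in> L_span p e" "\<And>a b. l a b \<in> TV_component n m s"
    using f unfolding L_sharp_dual_weight_def by blast
  have "delta \<alpha> (l a b) $$ (a, b) = 0" if ab: "a < d" "b < d" for a b
  proof -
    obtain c where c: "l a b = comb c" using l(1) by (auto simp: L_span_comb)
    \<comment> \<open>The contribution of the relations of degree other than s. It vanishes because
      the whole combination is homogeneous of degree s.\<close>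
    define c' where "c' i = (if r i = s then 0 else c i)" for i
    have "comb c' = 0"
    proof (rule poly_mapping_eqI)
      fix w
      have deg: "word_degree m w = r i" if "i < p" "lookup (e i) w \<noteq> 0" for i
        using e that by (auto simp: relation_space_def TV_component_def in_keys_iff)
      show "lookup (comb c') w = lookup 0 w"
      proof (cases "word_degree m w = s")
        case True
        have "c' i * lookup (e i) w = 0" if "i < p" for i
          using deg[OF that] True by (auto simp: c'_def)
        then have "(\<Sum>i<p. c' i * lookup (e i) w) = 0" by (intro sum.neutral) blast
        then show ?thesis by (simp add: comb_def lookup_sum lookup_const_mult)
      next
        case False
        have "c' i * lookup (e i) w = c i * lookup (e i) w" if "i < p" for i
          using deg[OF that] False by (auto simp: c'_def)
        then have "(\<Sum>i<p. c' i * lookup (e i) w) = (\<Sum>i<p. c i * lookup (e i) w)"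
          by (intro sum.cong) auto
        then have "lookup (comb c') w = lookup (l a b) w"
          unfolding c by (simp add: comb_def lookup_sum lookup_const_mult)
        also have "\<dots> = 0" using l(2)[of a b] False by (auto simp: TV_component_def in_keys_iff)
        finally show ?thesis by simp
      qed
    qed
    then have "c' j = 0" using comb_inject[of c' "\<lambda>_. 0" j] zero_comb jab(2) by simp
    then have "c j = 0" using ne jab(1) by (simp add: c'_def)
    then have "(\<Sum>i<p. (if (i, a, b) = \<alpha> then 1 else 0) * c i) = 0"
      by (intro sum.neutral) (auto simp: jab(1))
    then show ?thesis using ab unfolding c delta_def coord_map_comb by simp
  qed
  then have "(\<Sum>a<d. \<Sum>b<d. delta \<alpha> (l a b) $$ (a, b)) = 0" by (intro sum.neutral ballI) simp
  then show False using nz unfolding fl by (metis (lifting))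
qed

lemma rep_morphism_in_L_sharp: "rep_morphism p e d \<rho> \<in> L_sharp n p e d"
proof (rule in_L_sharpI, unfold L_rep_def, intro CollectI conjI ballI allI impI)
  fix x y assume x: "x \<in> L_span p e" and y: "y \<in> L_span p e"
  then have "x + y \<in> L_span p e" by (rule L_span_add)
  then show "rep_morphism p e d \<rho> (x + y) = rep_morphism p e d \<rho> x + rep_morphism p e d \<rho> y"
    using x y by (simp add: rep_morphism_def TV_value_add)
next
  fix c x assume x: "x \<in> L_span p e"
  then have "single [] c * x \<in> L_span p e"
    unfolding single_Nil by (rule L_span_scale)
  then show "rep_morphism p e d \<rho> (single [] c * x) = c \<cdot>\<^sub>m rep_morphism p e d \<rho> x"
    using x by (simp add: rep_morphism_def single_Nil TV_value_scale)
qed (simp_all add: rep_morphism_def TV_value_carrier)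

lemma entry_in_coord_ring: "\<alpha> \<in> idxs p d \<Longrightarrow> entry e d \<alpha> \<in> coord_ring n d"
  unfolding coord_ring_iff using keys_entry(1)[OF e] by blast

text \<open>The explicit polynomial has the required values at all representations, and a polynomial
  is determined by these values.\<close>

lemma pullback_eq:
  assumes f: "f \<in> L_sharp_dual n p e d"
  shows "pullback n p e d f = (\<Sum>\<alpha>\<in>idxs p d. const_poly (f (delta \<alpha>)) * entry e d \<alpha>)" (is "_ = ?g")
proof -
  have g: "?g \<in> coord_ring n d"
    by (intro coord_ring_sum coord_ring_mult coord_ring_const entry_in_coord_ring)
  have val: "coord_value \<rho> ?g = f (rep_morphism p e d \<rho>)" if \<rho>: "\<rho> \<in> V_rep n d" for \<rho>
  proof -
    have "coord_value \<rho> (entry e d \<alpha>) = eps \<alpha> (rep_morphism p e d \<rho>)" if "\<alpha> \<in> idxs p d" for \<alpha>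
      using that coord_value_entry[OF \<rho>] rep_morphism_in_L_sharp e_in_L_span
      by (auto simp: idxs_def eps_def rep_morphism_def)
    then have "coord_value \<rho> ?g = (\<Sum>\<alpha>\<in>idxs p d. f (delta \<alpha>) * eps \<alpha> (rep_morphism p e d \<rho>))"
      by (simp add: coord_value_lin lin_sum lin_const_mult)
    then show ?thesis using dual_expand[OF f rep_morphism_in_L_sharp] by simp
  qed
  show ?thesis
    unfolding pullback_def
  proof (rule the_equality)
    fix h assume h: "h \<in> coord_ring n d \<and> (\<forall>\<rho>\<in>V_rep n d. coord_value \<rho> h = f (rep_morphism p e d \<rho>))"
    then show "h = ?g" using val by (intro coord_value_inject[OF _ g]) auto
  qed (use g val in blast)
qed

end

section \<open>Comparison with the exterior algebra\<close>

lemma alternating_mult: "alternating G \<Longrightarrow> alternating (\<lambda>xs. c * G xs)" for c :: "'c::ring"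
proof -
  assume G: "alternating G"
  show ?thesis unfolding alternating_def
  proof (intro allI)
    fix u x y v
    show "c * G (u @ x # y # v) = - (c * G (u @ y # x # v))"
      unfolding alternatingD[OF G, of u x y v] by simp
  qed
qed

lemma skew_cong:
  fixes F :: "'a \<Rightarrow> 'a list \<Rightarrow> 'c::ring_1"
  assumes "\<And>i. i < length xs \<Longrightarrow> F (xs ! i) (del i xs) = G (xs ! i) (del i xs)"
  shows "skew F xs = skew G xs"
  unfolding skew_eq_sum using assms by simp

lemma skew_nonzeroE:
  fixes F :: "'a \<Rightarrow> 'a list \<Rightarrow> 'c::ring_1"
  assumes "skew F xs \<noteq> 0"
  obtains i where "i < length xs" "F (xs ! i) (del i xs) \<noteq> 0"
  using assms unfolding skew_eq_sum by (elim sum.not_neutral_contains_not_neutral) fastforce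

text \<open>This is the expansion along two equal rows of a determinant; the two orders of expanding
  cancel.\<close>

lemma skew_square:
  fixes a :: "'a \<Rightarrow> 'c::comm_ring_1"
  shows "skew (\<lambda>x ys. a x * skew (\<lambda>y zs. a y * G zs) ys) xs = 0"
proof (induction xs arbitrary: G)
  case (Cons x xs)
  have "skew (\<lambda>z ys. a z * skew (\<lambda>y zs. a y * G zs) (x # ys)) xs =
      skew (\<lambda>z ys. a x * (a z * G ys) + - (a z * skew (\<lambda>y zs. a y * G (x # zs)) ys)) xs"
    by (simp add: right_diff_distrib mult.left_commute)
  also have "\<dots> = a x * skew (\<lambda>z ys. a z * G ys) xs"
    unfolding skew_add skew_uminus skew_mult Cons.IH by simp
  finally show ?case by simp
qed simp

lemma single_sum: "single x (\<Sum>i\<in>I. f i) = (\<Sum>i\<in>I. single x (f i))"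
  by (induction I rule: infinite_finite_induct) (simp_all add: single_add)

lemma const_poly_commute: "const_poly c * y = y * const_poly c"
  for y :: "'a::monoid_add \<Rightarrow>\<^sub>0 'r::comm_semiring_0"
proof -
  have "const_poly c * (\<Sum>x\<in>keys y. single x (lookup y x)) = (\<Sum>x\<in>keys y. single x (lookup y x)) * const_poly c"
    by (simp add: sum_distrib_left sum_distrib_right mult_single mult.commute)
  then show ?thesis by (simp only: poly_mapping_expand[symmetric])
qed

lemma single_mult_word: "single u a * single v b = single (u @ v) (a * b)" for a :: "'r::semiring_0"
  by (simp add: mult_single plus_list_def)

lemma finite_sums_base: "x \<in> S \<Longrightarrow> x \<in> finite_sums S"
  using finite_sums.add[OF _ finite_sums.zero, of x S] by simp

lemma finite_sums_add: "x \<in> finite_sums S \<Longrightarrow> y \<in> finite_sums S \<Longrightarrow> x + y \<in> finite_sums S"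
  by (induction rule: finite_sums.induct) (simp_all add: add.assoc finite_sums.add)

lemma finite_sums_sum: "(\<And>i. i \<in> I \<Longrightarrow> f i \<in> finite_sums S) \<Longrightarrow> (\<Sum>i\<in>I. f i) \<in> finite_sums S"
  by (induction I rule: infinite_finite_induct) (simp_all add: finite_sums.zero finite_sums_add)

context relations
begin

definition val :: "functional \<Rightarrow> idx \<Rightarrow> coord_poly" where
  "val f \<alpha> = (if \<alpha> \<in> idxs p d then const_poly (f (delta \<alpha>)) else 0)"

text \<open>\<open>ev w\<close> is the determinant of the values of the functionals \<open>w\<close> on the dual basis, expanded along
  the first row.\<close>

primrec ev :: "functional list \<Rightarrow> idx list \<Rightarrow> coord_poly" where
  "ev [] = (\<lambda>as. if as = [] then 1 else 0)"
| "ev (f # fs) = skew (\<lambda>\<alpha> \<gamma>. val f \<alpha> * ev fs \<gamma>)"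

text \<open>The comparison map from tensors to the cochain model, linear over the coordinate ring.
  In each tensor degree its kernel turns out to be the exterior ideal.\<close>

definition Phi :: "koszul_elem \<Rightarrow> idx list \<Rightarrow> coord_poly" where
  "Phi z = (\<lambda>as. lin (\<lambda>w. ev w as) z)"

lemma alternating_ev: "alternating (ev w)"
proof (induction w)
  case Nil
  show ?case by (simp add: alternating_def)
next
  case (Cons f w)
  show ?case unfolding ev.simps by (intro alternating_skew alternating_mult Cons)
qed

lemma ev_nonzero: "ev w as \<noteq> 0 \<Longrightarrow> length as = length w \<and> set as \<subseteq> idxs p d"
proof (induction w arbitrary: as)
  case Nil
  then show ?case by (simp split: if_splits)
next
  case (Cons f w)
  then obtain i where i: "i < length as" "val f (as ! i) * ev w (del i as) \<noteq> 0"
    by (auto elim: skew_nonzeroE)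
  then have "val f (as ! i) \<noteq> 0" "ev w (del i as) \<noteq> 0" by auto
  then have "as ! i \<in> idxs p d" "length (del i as) = length w \<and> set (del i as) \<subseteq> idxs p d"
    using Cons.IH by (auto simp: val_def split: if_splits)
  then show ?case using set_del[OF i(1)] length_del[OF i(1)] i(1) by auto
qed

lemma ev_weight:
  "list_all2 (\<lambda>f t. f \<in> L_sharp_dual_weight n m p e d t) w ts \<Longrightarrow> ev w as \<noteq> 0 \<Longrightarrow>
    sum_list (map (r \<circ> fst) as) = sum_list ts"
proof (induction w ts arbitrary: as rule: list_all2_induct)
  case Nil
  then show ?case by (simp split: if_splits)
next
  case (Cons f w t ts)
  then obtain i where i: "i < length as" "val f (as ! i) * ev w (del i as) \<noteq> 0"
    by (auto elim: skew_nonzeroE)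
  then have nz: "val f (as ! i) \<noteq> 0" "ev w (del i as) \<noteq> 0" by auto
  then have "as ! i \<in> idxs p d" "f (delta (as ! i)) \<noteq> 0" by (auto simp: val_def split: if_splits)
  then have "r (fst (as ! i)) = t" using dual_weight_delta Cons.hyps(1) by blast
  then show ?case using Cons.IH[OF nz(2)] sum_list_del[OF i(1), of "r \<circ> fst"] by (simp add: o_def)
qed

text \<open>Functionals have scalar values on the dual basis, so multiplication by \<open>ev\<close>
  does not change the weight of a coefficient.\<close>

lemma ev_const: "\<exists>c. \<forall>as. ev w as = const_poly (c as)"
proof (induction w)
  case Nil
  show ?case by (intro exI[of _ "\<lambda>as. if as = [] then 1 else 0"]) simp
next
  case (Cons f w)
  then obtain c where c: "\<And>as. ev w as = const_poly (c as)" by blast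
  define v where "v \<alpha> = (if \<alpha> \<in> idxs p d then f (delta \<alpha>) else 0)" for \<alpha>
  have v: "val f \<alpha> = const_poly (v \<alpha>)" for \<alpha> by (simp add: val_def v_def)
  have "ev (f # w) as = const_poly (skew (\<lambda>\<alpha> \<gamma>. v \<alpha> * c \<gamma>) as)" for as
    unfolding skew_hom[of const_poly, OF single_diff] const_poly_mult ev.simps c v ..
  then show ?case by blast
qed

lemma ev_in_coord_ring: "ev w as \<in> coord_ring n d"
  using ev_const[of w] coord_ring_const by metis

lemma val_add: "val (\<lambda>\<phi>. f \<phi> + g \<phi>) \<alpha> = val f \<alpha> + val g \<alpha>"
  by (simp add: val_def single_add)

lemma val_scale: "val (\<lambda>\<phi>. c * f \<phi>) \<alpha> = const_poly c * val f \<alpha>"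
  by (simp add: val_def const_poly_mult)

lemma ev_add: "ev (u @ (\<lambda>\<phi>. f \<phi> + g \<phi>) # v) as = ev (u @ f # v) as + ev (u @ g # v) as"
  by (induction u arbitrary: as)
    (simp_all add: val_add distrib_right distrib_left skew_add)

lemma ev_scale: "ev (u @ (\<lambda>\<phi>. c * f \<phi>) # v) as = const_poly c * ev (u @ f # v) as"
proof (induction u arbitrary: as)
  case Nil
  show ?case by (simp add: val_scale mult.assoc skew_mult)
next
  case (Cons h u)
  show ?case by (simp add: Cons.IH mult.left_commute[of _ "const_poly c"] skew_mult)
qed

lemma ev_square: "ev (u @ f # f # v) as = 0"
proof (induction u arbitrary: as)
  case Nil
  show ?case by (simp add: skew_square)
next
  case (Cons h u)
  show ?case by (simp add: Cons.IH skew_eq_sum)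
qed

lemma Phi_add: "Phi (x + y) = Phi x + Phi y"
  by (simp add: Phi_def fun_eq_iff lin_add)

lemma Phi_relation:
  assumes "x \<in> exterior_relations n p e d"
  shows "lin (\<lambda>w. ev w as) (single u 1 * x * single v 1) = 0"
proof -
  let ?L = "lin (\<lambda>w. ev w as)"
  have s: "single u 1 * single w c * single v 1 = single (u @ w @ v) c" for w and c :: coord_poly
    by (simp add: single_mult_word)
  show ?thesis using assms unfolding exterior_relations_def
  proof (elim UnE)
    assume "x \<in> {single [\<lambda>\<phi>. f \<phi> + g \<phi>] 1 - single [f] 1 - single [g] 1
        | f g. f \<in> L_sharp_dual n p e d \<and> g \<in> L_sharp_dual n p e d}"
    then obtain f g where x: "x = single [\<lambda>\<phi>. f \<phi> + g \<phi>] 1 - single [f] 1 - single [g] 1" by blast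
    show ?thesis unfolding x right_diff_distrib left_diff_distrib s lin_diff lin_single
      by (simp add: ev_add)
  next
    assume "x \<in> {single [\<lambda>\<phi>. c * f \<phi>] 1 - single [f] (const_poly c) | c f. f \<in> L_sharp_dual n p e d}"
    then obtain c f where x: "x = single [\<lambda>\<phi>. c * f \<phi>] 1 - single [f] (const_poly c)" by blast
    show ?thesis unfolding x right_diff_distrib left_diff_distrib s lin_diff lin_single
      by (simp add: ev_scale)
  next
    assume "x \<in> {single [f, f] 1 | f. f \<in> L_sharp_dual n p e d}"
    then obtain f where x: "x = single [f, f] 1" by blast
    show ?thesis unfolding x s lin_single by (simp add: ev_square)
  qed
qed

lemma Phi_ideal:
  assumes "z \<in> exterior_ideal n p e d"
  shows "Phi z = 0"
  using assms unfolding exterior_ideal_def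
proof (induction rule: finite_sums.induct)
  case zero
  show ?case by (simp add: Phi_def lin_0 fun_eq_iff)
next
  case (add z y)
  obtain a x b where z: "z = a * x * b" and x: "x \<in> exterior_relations n p e d" using add.hyps(1) by blast
  have "lin (\<lambda>w. ev w as) (a * x * b) = 0" for as
  proof -
    \<comment> \<open>Coefficients are central and can be collected in front; then the relation is
      surrounded by words only.\<close>
    have s: "single u c = const_poly c * single u 1" "single u c = single u 1 * const_poly c"
      for u :: "functional list" and c :: coord_poly
      by (simp_all add: mult_single)
    have "a * x * b = (\<Sum>u\<in>keys a. \<Sum>v\<in>keys b. single u (lookup a u) * x * single v (lookup b v))"
      by (subst (1) poly_mapping_expand[of a], subst (1) poly_mapping_expand[of b])
        (simp only: sum_distrib_right[of _ _ x] sum_product)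
    also have "\<dots> = (\<Sum>u\<in>keys a. \<Sum>v\<in>keys b. const_poly (lookup a u * lookup b v) * (single u 1 * x * single v 1))"
    proof (intro sum.cong refl)
      fix u v
      have "single u (lookup a u) * x * single v (lookup b v) =
          const_poly (lookup a u) * (single u 1 * x * single v 1 * const_poly (lookup b v))"
        by (subst s(1), subst s(2)) (simp only: mult.assoc)
      also have "single u 1 * x * single v 1 * const_poly (lookup b v) =
          const_poly (lookup b v) * (single u 1 * x * single v 1)"
        by (rule const_poly_commute[symmetric])
      finally show "single u (lookup a u) * x * single v (lookup b v) =
          const_poly (lookup a u * lookup b v) * (single u 1 * x * single v 1)"
        by (simp only: const_poly_mult mult.assoc)
    qed
    finally show ?thesis by (simp add: lin_sum lin_const_mult Phi_relation[OF x])
  qed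
  then have "Phi z = 0" unfolding z Phi_def by (simp add: fun_eq_iff)
  then show ?case using add.IH by (simp add: Phi_add)
qed

lemma lin_ev_Cons:
  "lin (\<lambda>w. ev w as) (single [f] 1 * y) = skew (\<lambda>\<alpha> \<gamma>. val f \<alpha> * lin (\<lambda>w. ev w \<gamma>) y) as"
proof -
  have "single [f] 1 * y = (\<Sum>w\<in>keys y. single (f # w) (lookup y w))"
    by (subst poly_mapping_expand[of y]) (simp add: sum_distrib_left single_mult_word)
  then have "lin (\<lambda>w. ev w as) (single [f] 1 * y) = (\<Sum>w\<in>keys y. lookup y w * skew (\<lambda>\<alpha> \<gamma>. val f \<alpha> * ev w \<gamma>) as)"
    by (simp add: lin_sum lin_single)
  also have "\<dots> = skew (\<lambda>\<alpha> \<gamma>. \<Sum>w\<in>keys y. lookup y w * (val f \<alpha> * ev w \<gamma>)) as"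
    unfolding skew_sum skew_mult ..
  finally show ?thesis by (simp add: lin_def sum_distrib_left mult.left_commute)
qed

text \<open>Both sides obey the same recursion along the first functional: the minus sign of the odd
  derivation is the one with which \<open>skew\<close> passes its first entry.\<close>

lemma Phi_word_derivation:
  assumes "set w \<subseteq> L_sharp_dual n p e d"
  shows "lin (\<lambda>w. ev w as) (word_derivation (pullback n p e d) w) = (\<Sum>\<alpha>\<in>idxs p d. entry e d \<alpha> * ev w (\<alpha> # as))"
  using assms
proof (induction w arbitrary: as)
  case Nil
  show ?case by (simp add: lin_0)
next
  case (Cons f fs)
  have pf: "pullback n p e d f = (\<Sum>\<alpha>\<in>idxs p d. val f \<alpha> * entry e d \<alpha>)"
    using pullback_eq Cons.prems by (simp add: val_def)
  have IH: "lin (\<lambda>w. ev w \<gamma>) (word_derivation (pullback n p e d) fs) = (\<Sum>\<alpha>\<in>idxs p d. entry e d \<alpha> * ev fs (\<alpha> # \<gamma>))" for \<gamma>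
    using Cons.IH Cons.prems by simp
  have "lin (\<lambda>w. ev w as) (word_derivation (pullback n p e d) (f # fs)) =
      pullback n p e d f * ev fs as - skew (\<lambda>\<beta> \<gamma>. val f \<beta> * (\<Sum>\<alpha>\<in>idxs p d. entry e d \<alpha> * ev fs (\<alpha> # \<gamma>))) as"
    by (simp add: lin_diff lin_single lin_ev_Cons IH)
  also have "skew (\<lambda>\<beta> \<gamma>. val f \<beta> * (\<Sum>\<alpha>\<in>idxs p d. entry e d \<alpha> * ev fs (\<alpha> # \<gamma>))) as =
      (\<Sum>\<alpha>\<in>idxs p d. entry e d \<alpha> * skew (\<lambda>\<beta> \<gamma>. val f \<beta> * ev fs (\<alpha> # \<gamma>)) as)"
    unfolding sum_distrib_left mult.left_commute[of "val f _"] skew_sum skew_mult ..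
  also have "pullback n p e d f * ev fs as - \<dots> = (\<Sum>\<alpha>\<in>idxs p d. entry e d \<alpha> * ev (f # fs) (\<alpha> # as))"
    by (simp add: pf sum_distrib_right sum_subtractf right_diff_distrib) (simp add: sum_distrib_left mult_ac)
  finally show ?case .
qed

lemma Phi_koszul_d:
  assumes "z \<in> tensor_algebra n p e d"
  shows "Phi (koszul_d n p e d z) = kos_d p d e (Phi z)"
proof
  fix as
  have w: "set w \<subseteq> L_sharp_dual n p e d" if "w \<in> keys z" for w using assms that by (simp add: tensor_algebra_def)
  have "Phi (koszul_d n p e d z) as = (\<Sum>w\<in>keys z. lookup z w * (\<Sum>\<alpha>\<in>idxs p d. entry e d \<alpha> * ev w (\<alpha> # as)))"
    unfolding Phi_def koszul_d_def single_Nil lin_sum lin_const_mult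
    by (intro sum.cong refl) (simp add: Phi_word_derivation[OF w])
  also have "\<dots> = (\<Sum>\<alpha>\<in>idxs p d. \<Sum>w\<in>keys z. entry e d \<alpha> * (lookup z w * ev w (\<alpha> # as)))"
    unfolding sum_distrib_left mult.left_commute[of "lookup z _"] by (rule sum.swap)
  finally show "Phi (koszul_d n p e d z) as = kos_d p d e (Phi z) as"
    by (simp add: kos_d_def Phi_def lin_def sum_distrib_left)
qed

section \<open>Calculus modulo the exterior ideal\<close>

abbreviation "TA \<equiv> tensor_algebra n p e d"
abbreviation "I \<equiv> exterior_ideal n p e d"

lemma TA_single: "set w \<subseteq> L_sharp_dual n p e d \<Longrightarrow> c \<in> coord_ring n d \<Longrightarrow> single w c \<in> TA"
  by (simp add: tensor_algebra_def)

lemma TA_coeff: "z \<in> TA \<Longrightarrow> lookup z w \<in> coord_ring n d"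
  by (cases "w \<in> keys z") (auto simp: tensor_algebra_def in_keys_iff coord_ring_0)

lemma TA_add:
  assumes "x \<in> TA" "y \<in> TA"
  shows "x + y \<in> TA"
  unfolding tensor_algebra_def
proof (intro CollectI ballI conjI)
  fix w assume "w \<in> keys (x + y)"
  then have "w \<in> keys x \<or> w \<in> keys y" using keys_add[of x y] by blast
  then show "set w \<subseteq> L_sharp_dual n p e d" using assms unfolding tensor_algebra_def by blast
  show "lookup (x + y) w \<in> coord_ring n d"
    unfolding lookup_add by (intro coord_ring_add TA_coeff assms)
qed

lemma TA_sum: "(\<And>i. i \<in> J \<Longrightarrow> f i \<in> TA) \<Longrightarrow> (\<Sum>i\<in>J. f i) \<in> TA"
  by (induction J rule: infinite_finite_induct) (simp_all add: TA_add, simp_all add: tensor_algebra_def)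

lemma TA_mult:
  assumes x: "x \<in> TA" and y: "y \<in> TA"
  shows "x * y \<in> TA"
proof -
  have "x * y = (\<Sum>u\<in>keys x. \<Sum>v\<in>keys y. single (u @ v) (lookup x u * lookup y v))"
    by (subst (1) poly_mapping_expand[of x], subst (1) poly_mapping_expand[of y])
      (simp add: sum_product single_mult_word)
  also have "\<dots> \<in> TA"
    using x y by (intro TA_sum TA_single coord_ring_mult TA_coeff) (auto simp: tensor_algebra_def)
  finally show ?thesis .
qed

lemma TA_const: "c \<in> coord_ring n d \<Longrightarrow> const_poly c \<in> TA"
  unfolding single_Nil[symmetric] by (intro TA_single) auto

lemma TA_1: "1 \<in> TA"
  using TA_const[OF coord_ring_1] by simp

lemma I_0: "0 \<in> I"
  unfolding exterior_ideal_def by (rule finite_sums.zero)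

lemma I_add: "x \<in> I \<Longrightarrow> y \<in> I \<Longrightarrow> x + y \<in> I"
  unfolding exterior_ideal_def by (rule finite_sums_add)

lemma I_mult:
  assumes "x \<in> I" "a \<in> TA" "b \<in> TA"
  shows "a * x * b \<in> I"
  using assms(1) unfolding exterior_ideal_def
proof (induction rule: finite_sums.induct)
  case (add z y)
  obtain a' x b' where z: "z = a' * x * b'" "a' \<in> TA" "x \<in> exterior_relations n p e d" "b' \<in> TA"
    using add.hyps(1) by blast
  have "a * z * b = (a * a') * x * (b' * b)" by (simp only: z(1) mult.assoc)
  then have "a * z * b \<in> {a * x * b |a x b. a \<in> TA \<and> x \<in> exterior_relations n p e d \<and> b \<in> TA}"
    using z(2-4) assms(2,3) TA_mult by blast
  then show ?case using add.IH by (simp add: distrib_left distrib_right finite_sums.add)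
qed (simp add: finite_sums.zero)

lemma I_left: "a \<in> TA \<Longrightarrow> x \<in> I \<Longrightarrow> a * x \<in> I"
  using I_mult[OF _ _ TA_1] by simp

lemma I_right: "x \<in> I \<Longrightarrow> b \<in> TA \<Longrightarrow> x * b \<in> I"
  using I_mult[OF _ TA_1] by simp

lemma I_uminus: "x \<in> I \<Longrightarrow> - x \<in> I"
  using I_left[OF TA_const[OF coord_ring_uminus[OF coord_ring_1]]] by (simp add: single_uminus)

lemma I_diff: "x \<in> I \<Longrightarrow> y \<in> I \<Longrightarrow> x - y \<in> I"
  using I_add[OF _ I_uminus] by simp

lemma I_sum: "(\<And>i. i \<in> J \<Longrightarrow> f i \<in> I) \<Longrightarrow> (\<Sum>i\<in>J. f i) \<in> I"
  by (induction J rule: infinite_finite_induct) (simp_all add: I_0 I_add)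

lemma I_relation: "x \<in> exterior_relations n p e d \<Longrightarrow> x \<in> I"
proof -
  assume "x \<in> exterior_relations n p e d"
  then have "1 * x * 1 \<in> I"
    unfolding exterior_ideal_def using TA_1 by (intro finite_sums_base) blast
  then show ?thesis by simp
qed

lemma I_trans: "x - y \<in> I \<Longrightarrow> y - z \<in> I \<Longrightarrow> x - z \<in> I"
  using I_add[of "x - y" "y - z"] by simp

lemma dual_add: "f \<in> L_sharp_dual n p e d \<Longrightarrow> g \<in> L_sharp_dual n p e d \<Longrightarrow> (\<lambda>\<phi>. f \<phi> + g \<phi>) \<in> L_sharp_dual n p e d"
  by (simp add: L_sharp_dual_def distrib_left)

lemma dual_scale: "f \<in> L_sharp_dual n p e d \<Longrightarrow> (\<lambda>\<phi>. c * f \<phi>) \<in> L_sharp_dual n p e d"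
  by (simp add: L_sharp_dual_def distrib_left)

lemma dual_0: "(\<lambda>\<phi>. 0) \<in> L_sharp_dual n p e d"
  by (simp add: L_sharp_dual_def)

lemma rel_add:
  assumes "f \<in> L_sharp_dual n p e d" "g \<in> L_sharp_dual n p e d"
  shows "single [\<lambda>\<phi>. f \<phi> + g \<phi>] 1 - (single [f] 1 + single [g] 1) \<in> I"
proof -
  have "single [\<lambda>\<phi>. f \<phi> + g \<phi>] 1 - single [f] 1 - single [g] 1 \<in> I"
    by (rule I_relation) (use assms in \<open>unfold exterior_relations_def, blast\<close>)
  then show ?thesis by (simp add: diff_diff_eq)
qed

lemma rel_scale:
  assumes "f \<in> L_sharp_dual n p e d"
  shows "single [\<lambda>\<phi>. c * f \<phi>] 1 - single [f] (const_poly c) \<in> I"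
  by (rule I_relation) (use assms in \<open>unfold exterior_relations_def, blast\<close>)

lemma rel_square:
  assumes "f \<in> L_sharp_dual n p e d"
  shows "single [f, f] 1 \<in> I"
  by (rule I_relation) (use assms in \<open>unfold exterior_relations_def, blast\<close>)

text \<open>Polarisation of the squares. The letter f + g is the sum of the letters f and g only
  modulo the ideal, so its square is corrected by multiples of that relation.\<close>

lemma rel_swap:
  assumes f: "f \<in> L_sharp_dual n p e d" and g: "g \<in> L_sharp_dual n p e d"
  shows "single [f] 1 * single [g] 1 + single [g] 1 * single [f] 1 \<in> I"
proof -
  let ?F = "single [f] 1 :: koszul_elem" and ?G = "single [g] 1 :: koszul_elem"
  let ?H = "single [\<lambda>\<phi>. f \<phi> + g \<phi>] 1 :: koszul_elem"
  have TA: "?F \<in> TA" "?G \<in> TA" "?H \<in> TA" using f g dual_add by (auto intro!: TA_single coord_ring_1)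
  have "(?H - (?F + ?G)) * ?H \<in> I" by (intro I_right rel_add f g TA)
  moreover have "(?F + ?G) * (?H - (?F + ?G)) \<in> I" by (intro I_left rel_add f g TA_add TA)
  ultimately have "(?H - (?F + ?G)) * ?H + (?F + ?G) * (?H - (?F + ?G)) \<in> I" by (rule I_add)
  moreover have "?H * ?H \<in> I" "?F * ?F \<in> I" "?G * ?G \<in> I"
    using rel_square f g dual_add by (simp_all add: single_mult_word)
  ultimately have "?H * ?H - ((?H - (?F + ?G)) * ?H + (?F + ?G) * (?H - (?F + ?G))) - ?F * ?F - ?G * ?G \<in> I"
    by (intro I_diff)
  also have "?H * ?H - ((?H - (?F + ?G)) * ?H + (?F + ?G) * (?H - (?F + ?G))) - ?F * ?F - ?G * ?G =
      ?F * ?G + ?G * ?F"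
    by (simp only: left_diff_distrib right_diff_distrib distrib_left distrib_right) simp
  finally show ?thesis .
qed

text \<open>Letters are additive only modulo the ideal, so the expansion in the functionals
  \<open>eps\<close> is built up one summand at a time.\<close>

lemma rel_expand:
  assumes f: "f \<in> L_sharp_dual n p e d"
  shows "(\<Sum>\<alpha>\<in>idxs p d. single [eps \<alpha>] (val f \<alpha>)) - single [f] 1 \<in> I"
proof -
  define g where "g A = (\<lambda>\<phi>. \<Sum>\<alpha>\<in>A. f (delta \<alpha>) * eps \<alpha> \<phi>)" for A
  have part: "g A \<in> L_sharp_dual n p e d \<and> (\<Sum>\<alpha>\<in>A. single [eps \<alpha>] (const_poly (f (delta \<alpha>)))) - single [g A] 1 \<in> I"
    if "finite A" "A \<subseteq> idxs p d" for A
    using that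
  proof (induction A)
    case empty
    have "single [\<lambda>\<phi>. 0 * 0] 1 - single [\<lambda>\<phi>. 0] (const_poly 0) \<in> I" by (rule rel_scale[OF dual_0])
    then have "single [\<lambda>\<phi>. 0] 1 \<in> I" by simp
    then show ?case using I_uminus dual_0 by (auto simp: g_def)
  next
    case (insert \<beta> A)
    have \<beta>: "eps \<beta> \<in> L_sharp_dual n p e d" using insert.prems by (intro eps_dual) simp
    have gA: "g A \<in> L_sharp_dual n p e d"
      and IH: "(\<Sum>\<alpha>\<in>A. single [eps \<alpha>] (const_poly (f (delta \<alpha>)))) - single [g A] 1 \<in> I"
      using insert by auto
    have eq: "g (insert \<beta> A) = (\<lambda>\<phi>. f (delta \<beta>) * eps \<beta> \<phi> + g A \<phi>)"
      using insert.hyps by (simp add: g_def)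
    let ?c = "f (delta \<beta>)" and ?S = "\<Sum>\<alpha>\<in>A. single [eps \<alpha>] (const_poly (f (delta \<alpha>)))"
    have "?S - single [g A] 1 - (single [\<lambda>\<phi>. ?c * eps \<beta> \<phi>] 1 - single [eps \<beta>] (const_poly ?c)) -
        (single [g (insert \<beta> A)] 1 - (single [\<lambda>\<phi>. ?c * eps \<beta> \<phi>] 1 + single [g A] 1)) \<in> I"
      unfolding eq by (intro I_diff IH rel_scale rel_add dual_scale \<beta> gA)
    then have "single [eps \<beta>] (const_poly ?c) + ?S - single [g (insert \<beta> A)] 1 \<in> I"
      by (simp add: algebra_simps)
    then show ?case using insert.hyps eq dual_add[OF dual_scale[OF \<beta>] gA] by simp
  qed
  have "f = g (idxs p d)"
  proof
    fix \<phi>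
    show "f \<phi> = g (idxs p d) \<phi>"
    proof (cases "\<phi> \<in> L_sharp n p e d")
      case True
      then show ?thesis using dual_expand[OF f] by (simp add: g_def)
    next
      case False
      then have "f \<phi> = 0" using f by (simp add: L_sharp_dual_def)
      moreover have "eps \<alpha> \<phi> = 0" for \<alpha> using False by (simp add: eps_def split: prod.split)
      ultimately show ?thesis by (simp add: g_def)
    qed
  qed
  moreover have "(\<Sum>\<alpha>\<in>idxs p d. single [eps \<alpha>] (val f \<alpha>)) =
      (\<Sum>\<alpha>\<in>idxs p d. single [eps \<alpha>] (const_poly (f (delta \<alpha>))))"
    by (intro sum.cong) (auto simp: val_def)
  ultimately show ?thesis using part[OF finite_idxs subset_refl] by simp
qed

end

lemma of_nat_const_const: "(of_nat k :: 'a::monoid_add \<Rightarrow>\<^sub>0 ('b::monoid_add \<Rightarrow>\<^sub>0 complex)) =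
    const_poly (const_poly (of_nat k))"
  by (metis single_of_nat)

lemma of_nat_left_commute: "x * (of_nat j * y) = of_nat j * (x * y)" for x :: "'a::semiring_1"
proof -
  have "x * of_nat j = of_nat j * x" by (rule mult_of_nat_commute[symmetric])
  then show ?thesis by (simp only: mult.assoc[symmetric])
qed

context relations
begin

section \<open>Antisymmetrisation as an inverse up to factorials\<close>

definition idx_lists :: "nat \<Rightarrow> idx list set" where
  "idx_lists k = {as. set as \<subseteq> idxs p d \<and> length as = k}"

text \<open>The candidate inverse of \<open>Phi\<close>. Summing over all index lists, not just
  increasing ones, avoids an order on the indices and costs a factor \<open>k!\<close> in both
  compositions.\<close>

definition spread :: "nat \<Rightarrow> (idx list \<Rightarrow> coord_poly) \<Rightarrow> koszul_elem" where
  "spread k F = (\<Sum>as\<in>idx_lists k. single (map eps as) (F as))"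

lemma idx_lists_0: "idx_lists 0 = {[]}"
  by (auto simp: idx_lists_def)

lemma sum_idx_lists_Suc:
  "(\<Sum>as\<in>idx_lists (Suc k). f as) = (\<Sum>\<alpha>\<in>idxs p d. \<Sum>\<gamma>\<in>idx_lists k. f (\<alpha> # \<gamma>))"
proof -
  have eq: "idx_lists (Suc k) = (\<lambda>(\<alpha>, \<gamma>). \<alpha> # \<gamma>) ` (idxs p d \<times> idx_lists k)"
  proof (intro equalityI subsetI)
    fix as assume "as \<in> idx_lists (Suc k)"
    then show "as \<in> (\<lambda>(\<alpha>, \<gamma>). \<alpha> # \<gamma>) ` (idxs p d \<times> idx_lists k)"
      unfolding idx_lists_def by (cases as) (auto intro!: rev_image_eqI)
  qed (auto simp: idx_lists_def)
  have inj: "inj_on (\<lambda>(\<alpha>, \<gamma>). \<alpha> # \<gamma>) (idxs p d \<times> idx_lists k)" by (auto simp: inj_on_def)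
  show ?thesis
    unfolding eq sum.reindex[OF inj] o_def case_prod_beta sum.cartesian_product ..
qed

lemma eps_words: "as \<in> idx_lists k \<Longrightarrow> set (map eps as) \<subseteq> L_sharp_dual n p e d"
  using eps_dual by (auto simp: idx_lists_def)

lemma spread_TA: "(\<And>as. F as \<in> coord_ring n d) \<Longrightarrow> spread k F \<in> TA"
  unfolding spread_def using eps_words by (intro TA_sum TA_single) auto

lemma spread_Suc: "spread (Suc k) F = (\<Sum>\<alpha>\<in>idxs p d. single [eps \<alpha>] 1 * spread k (\<lambda>\<gamma>. F (\<alpha> # \<gamma>)))"
  unfolding spread_def sum_idx_lists_Suc by (simp add: sum_distrib_left single_mult_word)

lemma spread_diff: "spread k (\<lambda>as. F as - G as) = spread k F - spread k G"
  by (simp add: spread_def single_diff sum_subtractf)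

lemma spread_mult: "spread k (\<lambda>as. c * F as) = const_poly c * spread k F"
  by (simp add: spread_def sum_distrib_left mult_single)

text \<open>The functional f takes each of \<open>Suc k\<close> positions. Modulo the ideal it
  anticommutes with every letter \<open>eps \<alpha>\<close>, and the signs in \<open>skew\<close>
  make up for moving it to the front, so all positions contribute equally.\<close>

lemma spread_skew:
  assumes f: "f \<in> L_sharp_dual n p e d" and F: "\<And>as. F as \<in> coord_ring n d"
  shows "spread (Suc k) (skew (\<lambda>\<alpha> \<gamma>. val f \<alpha> * F \<gamma>)) - of_nat (Suc k) * (single [f] 1 * spread k F) \<in> I"
  using F
proof (induction k arbitrary: F)
  case (0 F)
  have "spread (Suc 0) (skew (\<lambda>\<alpha> \<gamma>. val f \<alpha> * F \<gamma>)) = (\<Sum>\<alpha>\<in>idxs p d. single [eps \<alpha>] (val f \<alpha>)) * spread 0 F"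
    by (simp add: spread_Suc sum_distrib_right spread_def[of 0] idx_lists_0 single_mult_word)
  moreover have "((\<Sum>\<alpha>\<in>idxs p d. single [eps \<alpha>] (val f \<alpha>)) - single [f] 1) * spread 0 F \<in> I"
    by (intro I_right rel_expand f spread_TA 0)
  ultimately show ?case by (simp add: left_diff_distrib)
next
  case (Suc k F)
  let ?f = "single [f] 1 :: koszul_elem" and ?e = "\<lambda>\<alpha>. single [eps \<alpha>] 1 :: koszul_elem"
  let ?F = "\<lambda>\<alpha> \<gamma>. F (\<alpha> # \<gamma>)" and ?N = "of_nat (Suc k) :: koszul_elem"
  let ?S = "\<lambda>\<alpha>. spread (Suc k) (skew (\<lambda>\<beta> \<gamma>. val f \<beta> * ?F \<alpha> \<gamma>))"
  have f1: "?f \<in> TA" using f by (intro TA_single coord_ring_1) simp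
  have e1: "?e \<alpha> \<in> TA" if "\<alpha> \<in> idxs p d" for \<alpha> using eps_dual[OF that] by (intro TA_single coord_ring_1) simp
  have N: "?N \<in> TA"
    unfolding of_nat_const_const by (intro TA_const coord_ring_const)
  have TS: "spread k (?F \<alpha>) \<in> TA" for \<alpha> by (intro spread_TA Suc.prems)
  have "spread (Suc (Suc k)) (skew (\<lambda>\<alpha> \<gamma>. val f \<alpha> * F \<gamma>)) =
      (\<Sum>\<alpha>\<in>idxs p d. ?e \<alpha> * (const_poly (val f \<alpha>) * spread (Suc k) F - ?S \<alpha>))"
    unfolding spread_Suc[of "Suc k"] skew.simps spread_diff spread_mult ..
  also have "\<dots> = (\<Sum>\<alpha>\<in>idxs p d. single [eps \<alpha>] (val f \<alpha>)) * spread (Suc k) F - (\<Sum>\<alpha>\<in>idxs p d. ?e \<alpha> * ?S \<alpha>)"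
    by (simp add: right_diff_distrib sum_subtractf sum_distrib_right mult.assoc[symmetric] mult_single)
  finally have A: "spread (Suc (Suc k)) (skew (\<lambda>\<alpha> \<gamma>. val f \<alpha> * F \<gamma>)) =
      (\<Sum>\<alpha>\<in>idxs p d. single [eps \<alpha>] (val f \<alpha>)) * spread (Suc k) F - (\<Sum>\<alpha>\<in>idxs p d. ?e \<alpha> * ?S \<alpha>)" .
  \<comment> \<open>\<open>B\<close> accounts for f in the first position, \<open>C\<close> applies
    the induction hypothesis to the other positions, and \<open>D\<close> moves f past the first
    letter.\<close>
  have B: "((\<Sum>\<alpha>\<in>idxs p d. single [eps \<alpha>] (val f \<alpha>)) - ?f) * spread (Suc k) F \<in> I"
    by (intro I_right rel_expand f spread_TA Suc.prems)
  have C: "(\<Sum>\<alpha>\<in>idxs p d. ?e \<alpha> * (?S \<alpha> - ?N * (?f * spread k (?F \<alpha>)))) \<in> I"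
    by (intro I_sum I_left e1 Suc.IH Suc.prems)
  have D: "(\<Sum>\<alpha>\<in>idxs p d. ?N * ((?e \<alpha> * ?f + ?f * ?e \<alpha>) * spread k (?F \<alpha>))) \<in> I"
    by (intro I_sum I_left N I_right rel_swap eps_dual f TS)
  have E: "(\<Sum>\<alpha>\<in>idxs p d. ?f * (?e \<alpha> * spread k (?F \<alpha>))) = ?f * spread (Suc k) F"
    by (simp add: spread_Suc sum_distrib_left)
  have D': "(\<Sum>\<alpha>\<in>idxs p d. ?N * ((?e \<alpha> * ?f + ?f * ?e \<alpha>) * spread k (?F \<alpha>))) =
      ?N * (\<Sum>\<alpha>\<in>idxs p d. ?e \<alpha> * (?f * spread k (?F \<alpha>))) + ?N * (?f * spread (Suc k) F)"
    unfolding E[symmetric] by (simp only: distrib_right distrib_left sum.distrib sum_distrib_left mult.assoc)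
  have C': "(\<Sum>\<alpha>\<in>idxs p d. ?e \<alpha> * (?S \<alpha> - ?N * (?f * spread k (?F \<alpha>)))) =
      (\<Sum>\<alpha>\<in>idxs p d. ?e \<alpha> * ?S \<alpha>) - ?N * (\<Sum>\<alpha>\<in>idxs p d. ?e \<alpha> * (?f * spread k (?F \<alpha>)))"
    by (simp only: right_diff_distrib of_nat_left_commute sum_subtractf sum_distrib_left)
  have "((\<Sum>\<alpha>\<in>idxs p d. single [eps \<alpha>] (val f \<alpha>)) - ?f) * spread (Suc k) F -
      (\<Sum>\<alpha>\<in>idxs p d. ?e \<alpha> * (?S \<alpha> - ?N * (?f * spread k (?F \<alpha>)))) -
      (\<Sum>\<alpha>\<in>idxs p d. ?N * ((?e \<alpha> * ?f + ?f * ?e \<alpha>) * spread k (?F \<alpha>))) \<in> I"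
    by (intro I_diff B C D)
  also have "((\<Sum>\<alpha>\<in>idxs p d. single [eps \<alpha>] (val f \<alpha>)) - ?f) * spread (Suc k) F -
      (\<Sum>\<alpha>\<in>idxs p d. ?e \<alpha> * (?S \<alpha> - ?N * (?f * spread k (?F \<alpha>)))) -
      (\<Sum>\<alpha>\<in>idxs p d. ?N * ((?e \<alpha> * ?f + ?f * ?e \<alpha>) * spread k (?F \<alpha>))) =
      spread (Suc (Suc k)) (skew (\<lambda>\<alpha> \<gamma>. val f \<alpha> * F \<gamma>)) - of_nat (Suc (Suc k)) * (?f * spread (Suc k) F)"
    unfolding A C' D'
    unfolding left_diff_distrib of_nat_Suc[of "Suc k"] distrib_right mult_1_left by (simp del: of_nat_Suc)
  finally show ?case .
qed

lemma spread_ev: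
  "set w \<subseteq> L_sharp_dual n p e d \<Longrightarrow> spread (length w) (ev w) - of_nat (fact (length w)) * single w 1 \<in> I"
proof (induction w)
  case Nil
  show ?case by (simp add: spread_def idx_lists_0 I_0)
next
  case (Cons f w)
  let ?k = "length w" and ?f = "single [f] 1 :: koszul_elem"
  have f1: "?f \<in> TA" using Cons.prems by (intro TA_single coord_ring_1) simp
  have N: "of_nat j \<in> TA" for j unfolding of_nat_const_const by (intro TA_const coord_ring_const)
  have 1: "spread (Suc ?k) (ev (f # w)) - of_nat (Suc ?k) * (?f * spread ?k (ev w)) \<in> I"
    unfolding ev.simps using Cons.prems by (intro spread_skew ev_in_coord_ring) simp
  have "of_nat (Suc ?k) * (?f * (spread ?k (ev w) - of_nat (fact ?k) * single w 1)) \<in> I"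
    using Cons.prems by (intro I_left N f1 Cons.IH) simp
  then have 2: "of_nat (Suc ?k) * (?f * spread ?k (ev w)) - of_nat (Suc ?k) * (of_nat (fact ?k) * (?f * single w 1)) \<in> I"
    by (simp only: right_diff_distrib of_nat_left_commute[of ?f])
  have "spread (Suc ?k) (ev (f # w)) - of_nat (Suc ?k) * (of_nat (fact ?k) * (?f * single w 1)) \<in> I"
    by (rule I_trans[OF 1 2])
  also have "of_nat (Suc ?k) * (of_nat (fact ?k) * (?f * single w 1)) = of_nat (fact (Suc ?k)) * single (f # w) 1"
    by (simp only: fact_Suc of_nat_id of_nat_mult mult.assoc single_mult_word append_Cons append_Nil mult_1_left)
  finally show ?case by (simp only: length_Cons)
qed

definition TAk :: "nat \<Rightarrow> koszul_elem set" where
  "TAk k = {z \<in> TA. \<forall>w\<in>keys z. length w = k}"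

lemma TAk_sum: "(\<And>i. i \<in> J \<Longrightarrow> f i \<in> TAk k) \<Longrightarrow> (\<Sum>i\<in>J. f i) \<in> TAk k"
  unfolding TAk_def using TA_sum[of J f] by (auto elim!: keys_sumE)

lemma TAk_single: "set w \<subseteq> L_sharp_dual n p e d \<Longrightarrow> c \<in> coord_ring n d \<Longrightarrow> single w c \<in> TAk (length w)"
  by (simp add: TAk_def TA_single)

lemma TAk_add: "x \<in> TAk k \<Longrightarrow> y \<in> TAk k \<Longrightarrow> x + y \<in> TAk k"
  unfolding TAk_def using TA_add[of x y] keys_add[of x y] by auto

lemma TAk_const_mult: "x \<in> TAk k \<Longrightarrow> c \<in> coord_ring n d \<Longrightarrow> const_poly c * x \<in> TAk k"
  unfolding TAk_def using TA_mult[OF TA_const] keys_const_multE[of _ c x] by blast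

lemma TAk_uminus: "x \<in> TAk k \<Longrightarrow> - x \<in> TAk k"
  using TAk_const_mult[OF _ coord_ring_uminus[OF coord_ring_1]] by (simp add: single_uminus)

lemma TAk_diff: "x \<in> TAk k \<Longrightarrow> y \<in> TAk k \<Longrightarrow> x - y \<in> TAk k"
  using TAk_add[OF _ TAk_uminus] by simp

lemma TAk_letter_mult:
  assumes f: "f \<in> L_sharp_dual n p e d" and x: "x \<in> TAk k"
  shows "single [f] 1 * x \<in> TAk (Suc k)"
proof -
  have "single [f] 1 * x = (\<Sum>w\<in>keys x. single (f # w) (lookup x w))"
    by (subst poly_mapping_expand[of x]) (simp add: sum_distrib_left single_mult_word)
  also have "\<dots> \<in> TAk (Suc k)"
  proof (rule TAk_sum)
    fix w assume w: "w \<in> keys x"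
    then have "length (f # w) = Suc k" "set (f # w) \<subseteq> L_sharp_dual n p e d" "lookup x w \<in> coord_ring n d"
      using x f by (auto simp: TAk_def tensor_algebra_def)
    then show "single (f # w) (lookup x w) \<in> TAk (Suc k)" using TAk_single by metis
  qed
  finally show ?thesis .
qed

text \<open>Modulo the ideal, \<open>spread k (Phi u)\<close> is \<open>k!\<close> times
  \<open>u\<close>, and \<open>k!\<close> is invertible in \<complex>.\<close>

lemma Phi_eq_0_imp_ideal:
  assumes u: "u \<in> TAk k" and Phi: "Phi u = 0"
  shows "u \<in> I"
proof -
  let ?N = "of_nat (fact k) :: koszul_elem"
  have uTA: "u \<in> TA" using u by (simp add: TAk_def)
  have w: "set w \<subseteq> L_sharp_dual n p e d" "length w = k" if "w \<in> keys u" for w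
    using u that by (auto simp: TAk_def tensor_algebra_def)
  have 1: "(\<Sum>w\<in>keys u. const_poly (lookup u w) * (spread k (ev w) - ?N * single w 1)) \<in> I"
  proof (intro I_sum I_left TA_const TA_coeff uTA)
    fix w assume "w \<in> keys u"
    then show "spread k (ev w) - ?N * single w 1 \<in> I" using spread_ev[of w] w by simp
  qed
  have "(\<Sum>w\<in>keys u. const_poly (lookup u w) * spread k (ev w)) = spread k (Phi u)"
    unfolding spread_mult[symmetric] Phi_def lin_def
    by (simp add: spread_def single_sum) (rule sum.swap)
  also have "\<dots> = 0" by (simp add: Phi spread_def)
  finally have 2: "(\<Sum>w\<in>keys u. const_poly (lookup u w) * spread k (ev w)) = 0" .
  have "(\<Sum>w\<in>keys u. const_poly (lookup u w) * (?N * single w 1)) = ?N * (\<Sum>w\<in>keys u. const_poly (lookup u w) * single w 1)"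
    by (simp only: of_nat_left_commute sum_distrib_left)
  also have "(\<Sum>w\<in>keys u. const_poly (lookup u w) * single w 1) = u"
    by (subst (3) poly_mapping_expand[of u]) (simp add: mult_single)
  finally have 3: "(\<Sum>w\<in>keys u. const_poly (lookup u w) * (?N * single w 1)) = ?N * u" .
  have "- (?N * u) \<in> I" using 1 by (simp only: right_diff_distrib sum_subtractf 2 3 diff_0)
  then have "?N * u \<in> I" using I_uminus[of "- (?N * u)"] by (simp only: minus_minus)
  then have "const_poly (const_poly (1 / of_nat (fact k))) * (?N * u) \<in> I"
    by (rule I_left[OF TA_const[OF coord_ring_const]])
  moreover have "const_poly (const_poly (1 / of_nat (fact k))) * ?N = (1 :: koszul_elem)"
    unfolding of_nat_const_const by (simp add: mult_single)
  ultimately show ?thesis by (simp only: mult.assoc[symmetric] mult_1_left)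
qed

lemma val_eps: "\<beta> \<in> idxs p d \<Longrightarrow> \<alpha> \<in> idxs p d \<Longrightarrow> val (eps \<alpha>) \<beta> = (if \<beta> = \<alpha> then 1 else 0)"
  by (simp add: val_def eps_delta)

text \<open>Expanding \<open>ev\<close> along its first row leaves the claim one degree lower;
  \<open>skew_alternating\<close> then supplies the factor \<open>Suc k\<close>.\<close>

lemma sum_ev_eps:
  assumes "alternating G" "\<beta> \<in> idx_lists k"
  shows "(\<Sum>as\<in>idx_lists k. G as * ev (map eps as) \<beta>) = of_nat (fact k) * G \<beta>"
  using assms
proof (induction k arbitrary: G \<beta>)
  case 0
  then show ?case by (simp add: idx_lists_0)
next
  case (Suc k G \<beta>)
  have "(\<Sum>as\<in>idx_lists (Suc k). G as * ev (map eps as) \<beta>) =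
      (\<Sum>\<alpha>\<in>idxs p d. \<Sum>\<gamma>\<in>idx_lists k. skew (\<lambda>x \<delta>. G (\<alpha> # \<gamma>) * (val (eps \<alpha>) x * ev (map eps \<gamma>) \<delta>)) \<beta>)"
    unfolding sum_idx_lists_Suc list.map ev.simps skew_mult ..
  also have "\<dots> = skew (\<lambda>x \<delta>. \<Sum>\<alpha>\<in>idxs p d. \<Sum>\<gamma>\<in>idx_lists k. G (\<alpha> # \<gamma>) * (val (eps \<alpha>) x * ev (map eps \<gamma>) \<delta>)) \<beta>"
    unfolding skew_sum ..
  also have "\<dots> = skew (\<lambda>x \<delta>. of_nat (fact k) * G (x # \<delta>)) \<beta>"
  proof (rule skew_cong)
    fix i assume i: "i < length \<beta>"
    let ?x = "\<beta> ! i" and ?\<delta> = "del i \<beta>"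
    have x: "?x \<in> idxs p d" using Suc.prems(2) i nth_mem by (fastforce simp: idx_lists_def)
    have \<delta>: "?\<delta> \<in> idx_lists k"
      using Suc.prems(2) set_del[OF i] length_del[OF i] by (auto simp: idx_lists_def)
    have "(\<Sum>\<alpha>\<in>idxs p d. \<Sum>\<gamma>\<in>idx_lists k. G (\<alpha> # \<gamma>) * (val (eps \<alpha>) ?x * ev (map eps \<gamma>) ?\<delta>)) =
        (\<Sum>\<alpha>\<in>idxs p d. if \<alpha> = ?x then \<Sum>\<gamma>\<in>idx_lists k. G (?x # \<gamma>) * ev (map eps \<gamma>) ?\<delta> else 0)"
      by (intro sum.cong refl) (auto simp: val_eps[OF x])
    also have "\<dots> = (\<Sum>\<gamma>\<in>idx_lists k. G (?x # \<gamma>) * ev (map eps \<gamma>) ?\<delta>)"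
      using x by (simp add: finite_idxs)
    also have "\<dots> = of_nat (fact k) * G (?x # ?\<delta>)"
      by (rule Suc.IH[OF alternating_Cons[OF Suc.prems(1)] \<delta>])
    finally show "(\<Sum>\<alpha>\<in>idxs p d. \<Sum>\<gamma>\<in>idx_lists k. G (\<alpha> # \<gamma>) * (val (eps \<alpha>) ?x * ev (map eps \<gamma>) ?\<delta>)) =
        of_nat (fact k) * G (?x # ?\<delta>)" .
  qed
  also have "\<dots> = of_nat (fact k) * (of_nat (length \<beta>) * G \<beta>)"
    unfolding skew_mult skew_alternating[OF Suc.prems(1)] ..
  also have "\<dots> = of_nat (fact (Suc k)) * G \<beta>"
    using Suc.prems(2) by (simp add: idx_lists_def algebra_simps)
  finally show ?case .
qed

lemma Phi_spread:
  assumes G: "G \<in> cochains n m p r d k R"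
  shows "Phi (spread k G) = (\<lambda>\<beta>. of_nat (fact k) * G \<beta>)"
proof
  fix \<beta>
  have "Phi (spread k G) \<beta> = (\<Sum>as\<in>idx_lists k. G as * ev (map eps as) \<beta>)"
    by (simp add: Phi_def spread_def lin_sum lin_single)
  also have "\<dots> = of_nat (fact k) * G \<beta>"
  proof (cases "\<beta> \<in> idx_lists k")
    case True
    then show ?thesis by (rule sum_ev_eps[OF cochainsD(1)[OF G]])
  next
    case False
    then have "G \<beta> = 0" using cochainsD(2,3)[OF G] by (auto simp: idx_lists_def)
    moreover have "ev (map eps as) \<beta> = 0" if "as \<in> idx_lists k" for as
      using ev_nonzero[of "map eps as" \<beta>] False that by (auto simp: idx_lists_def)
    ultimately show ?thesis by simp
  qed
  finally show "Phi (spread k G) \<beta> = of_nat (fact k) * G \<beta>" .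
qed

text \<open>\<open>ev\<close> is supported on index lists whose degrees add up to the weights of the
  functionals, so generators keep their weight under \<open>Phi\<close>; sums follow by
  additivity.\<close>

lemma koszul_weight_le_cochain:
  assumes "z \<in> koszul_weight_le n m p e d k R"
  shows "z \<in> TAk k \<and> Phi z \<in> cochains n m p r d k R"
proof -
  let ?S = "{z \<in> TAk k. Phi z \<in> cochains n m p r d k R}"
  have S0: "0 \<in> ?S"
    using fscale.subspace_0[OF cochains_subspace] by (simp add: TAk_def tensor_algebra_def Phi_def lin_0 flip: zero_fun_def)
  have Sadd: "x + y \<in> ?S" if "x \<in> ?S" "y \<in> ?S" for x y
    using that fscale.subspace_add[OF cochains_subspace] TAk_add by (simp add: Phi_add)
  have closed: "z \<in> ?S" if "z \<in> finite_sums X" "X \<subseteq> ?S" for z X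
    using that(1)
  proof (induction rule: finite_sums.induct)
    case (add x y)
    then show ?case using that(2) Sadd by blast
  qed (rule S0)
  have gen: "single fs g \<in> ?S"
    if fs: "length fs = k" "list_all2 (\<lambda>f t. f \<in> L_sharp_dual_weight n m p e d t) fs ts"
      and g: "g \<in> coord_ring_weight n m d t" and t: "t + sum_list ts \<le> R" for fs g t ts
  proof -
    have gr: "g \<in> coord_ring n d" and gw: "\<And>\<mu>. \<mu> \<in> keys g \<Longrightarrow> wt m \<mu> = t"
      using g by (auto simp: coord_ring_weight_def wt_def)
    have dual: "set fs \<subseteq> L_sharp_dual n p e d"
    proof
      fix f assume "f \<in> set fs"
      then obtain i where "i < length fs" "f = fs ! i" by (metis in_set_conv_nth)
      then show "f \<in> L_sharp_dual n p e d"
        using list_all2_nthD[OF fs(2)] subsetD[OF weight_sub_dual] by blast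
    qed
    have P: "Phi (single fs g) = (\<lambda>as. g * ev fs as)" by (simp add: Phi_def lin_single)
    have "(\<lambda>as. g * ev fs as) \<in> cochains n m p r d k R"
    proof (rule cochainsI)
      show "alternating (\<lambda>as. g * ev fs as)" by (intro alternating_mult alternating_ev)
      show "length as = k \<and> set as \<subseteq> idxs p d" if "g * ev fs as \<noteq> 0" for as
      proof -
        have "ev fs as \<noteq> 0" using that by (intro notI) simp
        then show ?thesis using ev_nonzero[of fs as] fs(1) by simp
      qed
      show "keys \<mu> \<subseteq> idxs n d \<and> wt m \<mu> + sum_list (map (r \<circ> fst) as) \<le> R" if \<mu>: "\<mu> \<in> keys (g * ev fs as)" for as \<mu>
      proof -
        have "ev fs as \<noteq> 0" using \<mu> by auto
        then have s: "sum_list (map (r \<circ> fst) as) = sum_list ts" by (rule ev_weight[OF fs(2)])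
        obtain c where "ev fs as = const_poly c" using ev_const by blast
        then have "\<mu> \<in> keys (const_poly c * g)" using \<mu> by (simp add: mult.commute)
        then have \<mu>g: "\<mu> \<in> keys g" by (rule keys_const_multE)
        then have "keys \<mu> \<subseteq> idxs n d" using gr unfolding coord_ring_iff by metis
        then show ?thesis using gw[OF \<mu>g] s t by simp
      qed
    qed
    then show ?thesis using TAk_single[OF dual gr] fs(1) P by simp
  qed
  have "koszul_weight n m p e d k s \<subseteq> ?S" if "s \<le> R" for s
  proof
    fix z assume "z \<in> koszul_weight n m p e d k s"
    then show "z \<in> ?S" unfolding koszul_weight_def
      by (rule closed) (use gen that in blast)
  qed
  then have "(\<Union>s\<le>R. koszul_weight n m p e d k s) \<subseteq> ?S" by blast
  then show ?thesis using closed assms unfolding koszul_weight_le_def by blast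
qed

text \<open>Weights are prescribed on generators, so every coefficient is split into monomials, each
  of which is homogeneous.\<close>

lemma spread_koszul_weight_le:
  assumes G: "G \<in> cochains n m p r d k R"
  shows "spread k G \<in> koszul_weight_le n m p e d k R"
proof -
  have gen: "single (map eps as) (single \<mu> c) \<in> koszul_weight_le n m p e d k R"
    if as: "as \<in> idx_lists k" and \<mu>: "\<mu> \<in> keys (G as)" for as \<mu> c
  proof -
    define s where "s = wt m \<mu> + sum_list (map (r \<circ> fst) as)"
    have s: "s \<le> R" using cochainsD(5)[OF G \<mu>] by (simp add: s_def)
    have len: "length (map eps as) = k" using as by (simp add: idx_lists_def)
    have la: "list_all2 (\<lambda>f t. f \<in> L_sharp_dual_weight n m p e d t) (map eps as) (map (r \<circ> fst) as)"
      unfolding list_all2_map1 list_all2_map2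
    proof (rule list.rel_refl_strong)
      fix \<alpha> assume "\<alpha> \<in> set as"
      then have "\<alpha> \<in> idxs p d" using as by (auto simp: idx_lists_def)
      then show "eps \<alpha> \<in> L_sharp_dual_weight n m p e d ((r \<circ> fst) \<alpha>)" using eps_weight by simp
    qed
    have g: "single \<mu> c \<in> coord_ring_weight n m d (wt m \<mu>)"
      using cochainsD(4)[OF G \<mu>] by (auto simp: coord_ring_weight_def coord_ring_iff wt_def)
    have "single (map eps as) (single \<mu> c) \<in> koszul_weight n m p e d k s"
      unfolding koszul_weight_def using len la g s_def by (intro finite_sums_base) blast
    then show ?thesis unfolding koszul_weight_le_def using s by (intro finite_sums_base) blast
  qed
  have "spread k G = (\<Sum>as\<in>idx_lists k. \<Sum>\<mu>\<in>keys (G as). single (map eps as) (single \<mu> (lookup (G as) \<mu>)))"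
    unfolding spread_def single_sum[symmetric] poly_mapping_expand[symmetric] ..
  also have "\<dots> \<in> koszul_weight_le n m p e d k R"
    using gen unfolding koszul_weight_le_def by (intro finite_sums_sum)
  finally show ?thesis .
qed

lemma word_derivation_TAk:
  "set w \<subseteq> L_sharp_dual n p e d \<Longrightarrow> length w = Suc k \<Longrightarrow> word_derivation (pullback n p e d) w \<in> TAk k"
proof (induction w arbitrary: k)
  case (Cons f w)
  have f: "f \<in> L_sharp_dual n p e d" and w: "set w \<subseteq> L_sharp_dual n p e d" "length w = k" using Cons.prems by auto
  have pf: "pullback n p e d f \<in> coord_ring n d"
    unfolding pullback_eq[OF f] by (intro coord_ring_sum coord_ring_mult coord_ring_const entry_in_coord_ring)
  have "single [f] 1 * word_derivation (pullback n p e d) w \<in> TAk k"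
  proof (cases w)
    case Nil
    then show ?thesis by (simp add: TAk_def tensor_algebra_def)
  next
    case (Cons g v)
    then obtain k' where k': "k = Suc k'" using w(2) by auto
    show ?thesis unfolding k' using Cons.IH w k' f by (intro TAk_letter_mult) auto
  qed
  then show ?case using TAk_single[OF w(1) pf] w(2) by (simp add: TAk_diff)
qed simp

lemma koszul_d_TAk: "y \<in> TAk (Suc k) \<Longrightarrow> koszul_d n p e d y \<in> TAk k"
  unfolding koszul_d_def single_Nil
proof (intro TAk_sum TAk_const_mult)
  fix w assume y: "y \<in> TAk (Suc k)" and w: "w \<in> keys y"
  show "word_derivation (pullback n p e d) w \<in> TAk k"
    using y w by (intro word_derivation_TAk) (auto simp: TAk_def tensor_algebra_def)
  show "lookup y w \<in> coord_ring n d" using y by (intro TA_coeff) (simp add: TAk_def)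
qed

text \<open>A cycle modulo the ideal becomes a cycle under \<open>Phi\<close>, is a boundary in the
  model, and the bounding cochain is brought back by \<open>spread\<close>. The error lies in the
  kernel of \<open>Phi\<close> in a fixed degree, hence in the ideal.\<close>

lemma homology_vanishes:
  assumes ex: "koszul_exact n m p r e d k R"
  shows "koszul_homology_vanishes n m p e d R k"
  unfolding koszul_homology_vanishes_def
proof (intro ballI impI)
  fix z assume z: "z \<in> koszul_weight_le n m p e d k R" and dz: "koszul_d n p e d z \<in> I"
  have zk: "z \<in> TAk k" "Phi z \<in> cochains n m p r d k R" using koszul_weight_le_cochain[OF z] by auto
  have "kos_d p d e (Phi z) = 0"
    using Phi_koszul_d[of z] Phi_ideal[OF dz] zk(1) by (simp add: TAk_def)
  then obtain G where G: "G \<in> cochains n m p r d (Suc k) R" "kos_d p d e G = Phi z"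
    using ex zk(2) unfolding koszul_exact_def by blast
  \<comment> \<open>This cancels the factor by which \<open>Phi\<close> after \<open>spread\<close>
    multiplies in degree \<open>Suc k\<close>.\<close>
  define c :: complex where "c = 1 / of_nat (fact (Suc k))"
  have cG: "fscale c G \<in> cochains n m p r d (Suc k) R"
    by (rule fscale.subspace_scale[OF cochains_subspace G(1)])
  define y where "y = spread (Suc k) (fscale c G)"
  have y: "y \<in> koszul_weight_le n m p e d (Suc k) R" unfolding y_def by (rule spread_koszul_weight_le[OF cG])
  have yk: "y \<in> TAk (Suc k)" using koszul_weight_le_cochain[OF y] by blast
  have inv: "of_nat (fact (Suc k)) * (const_poly c * G as) = G as" for as
  proof -
    have "of_nat (fact (Suc k)) = (const_poly (of_nat (fact (Suc k))) :: coord_poly)" by (rule single_of_nat[symmetric])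
    then have "of_nat (fact (Suc k)) * const_poly c = (1 :: coord_poly)"
      by (simp add: c_def mult_single del: fact_Suc single_of_nat)
    then show ?thesis by (simp only: mult.assoc[symmetric] mult_1_left)
  qed
  have "Phi y = G" using Phi_spread[OF cG] unfolding y_def fscale_def inv .
  then have "Phi (koszul_d n p e d y) = Phi z" using Phi_koszul_d[of y] yk G(2) by (simp add: TAk_def)
  then have "Phi (z - koszul_d n p e d y) = 0" by (simp add: Phi_def fun_eq_iff lin_diff)
  moreover have "z - koszul_d n p e d y \<in> TAk k" by (intro TAk_diff zk(1) koszul_d_TAk yk)
  ultimately have "z - koszul_d n p e d y \<in> I" by (intro Phi_eq_0_imp_ideal)
  then show "\<exists>y\<in>koszul_weight_le n m p e d (Suc k) R. z - koszul_d n p e d y \<in> I" using y by blast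
qed

end

theorem theorem5p4p4:
  fixes n p :: nat and m r :: "nat \<Rightarrow> nat"
  assumes "admissible n m p r"
  shows "weil_generic n m p r (\<lambda>e. asymptotic_RCI n m p e)"
proof -
  have "asymptotic_RCI n m p e"
    if e: "e \<in> relation_space n m p r" "independent_mod_commutators n p e"
      "\<forall>R N. \<exists>d>N. \<forall>k>0. koszul_exact n m p r e d k R" for e
    unfolding asymptotic_RCI_def
  proof (intro allI impI)
    fix R N :: nat
    obtain d where d: "d > N" "\<forall>k>0. koszul_exact n m p r e d k R" using e(3) by blast
    interpret relations n p d m r e by unfold_locales (rule e)+
    show "\<exists>d>N. \<forall>k>0. koszul_homology_vanishes n m p e d R k" using d homology_vanishes by blast
  qed
  moreover obtain \<U> where U: "countable \<U>" "\<forall>U\<in>\<U>. zariski_open n m p r U \<and> U \<noteq> {}"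
    "\<forall>e\<in>relation_space n m p r \<inter> \<Inter>\<U>. independent_mod_commutators n p e \<and>
      (\<forall>R N. \<exists>d>N. \<forall>k>0. koszul_exact n m p r e d k R)"
    using generic_exactness[OF assms] unfolding weil_generic_def by (elim exE conjE)
  ultimately have "\<forall>e\<in>relation_space n m p r \<inter> \<Inter>\<U>. asymptotic_RCI n m p e" by simp
  then show ?thesis unfolding weil_generic_def using U(1,2) by (intro exI[of _ \<U>] conjI)
qed

end
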